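(* The Odd Cycle Transversal problem is NP-complete when restricted to line graphs.
   Context: All graphs are finite and simple. An odd cycle transversal of a graph $G$ is a set $S\subseteq V(G)$ such that $G-S$ is bipartite. The Odd Cycle Transversal problem: given a graph $G$ and an integer $k$, decide whether $G$ has an odd cycle transversal $S$ with $|S|\le k$. The line graph $L(G)$ of $G=(V,E)$ has vertex set $E$, with two vertices adjacent if and only if the corresponding edges share an end-vertex in $G$; a line graph is a graph isomorphic to $L(G)$ for some graph $G$. *)

theory Defs
  imports Main "HOL-Computational_Algebra.Polynomial"
begin

section \<open>Deterministic multi-tape Turing machines\<close>

text \<open>
  States and tape symbols are initial segments of the natural numbers. State 0 is the start
  state, 1 the accepting and 2 the rejecting state; the machine halts in states 1 and 2.
  Symbol 0 is the blank, symbols 1 and 2 are the bits False and True. A tape is infinite in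
  both directions and is given by its contents together with the position of its head.
\<close>

datatype head_move = Move_Left | Stay | Move_Right

record turing_machine =
  num_tapes :: nat
  num_states :: nat
  num_symbols :: nat
  transition :: "nat \<Rightarrow> nat list \<Rightarrow> nat \<times> (nat \<times> head_move) list"

type_synonym tape = "(int \<Rightarrow> nat) \<times> int"
type_synonym config = "nat \<times> tape list"

text \<open>
  The transition function matters only on the finitely many arguments considered here, so a
  well-formed machine is a finite object.
\<close>

definition wf_tm :: "turing_machine \<Rightarrow> bool" where
  "wf_tm M \<longleftrightarrow> num_tapes M \<ge> 1 \<and> num_states M \<ge> 3 \<and> num_symbols M \<ge> 3 \<and>
    (\<forall>q ss. q < num_states M \<longrightarrow> length ss = num_tapes M \<longrightarrow> (\<forall>s\<in>set ss. s < num_symbols M) \<longrightarrow>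
      (case transition M q ss of (q', as) \<Rightarrow>
        q' < num_states M \<and> length as = num_tapes M \<and> (\<forall>(s, m)\<in>set as. s < num_symbols M)))"

definition read_tape :: "tape \<Rightarrow> nat" where
  "read_tape tp = (fst tp) (snd tp)"

fun head_shift :: "head_move \<Rightarrow> int" where
  "head_shift Move_Left = - 1"
| "head_shift Stay = 0"
| "head_shift Move_Right = 1"

definition act_tape :: "nat \<times> head_move \<Rightarrow> tape \<Rightarrow> tape" where
  "act_tape a tp = ((fst tp)(snd tp := fst a), snd tp + head_shift (snd a))"

definition halted :: "config \<Rightarrow> bool" where
  "halted c \<longleftrightarrow> fst c = 1 \<or> fst c = 2"

definition accepting :: "config \<Rightarrow> bool" where
  "accepting c \<longleftrightarrow> fst c = 1"

definition tm_step :: "turing_machine \<Rightarrow> config \<Rightarrow> config" where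
  "tm_step M c =
    (if halted c then c
     else case transition M (fst c) (map read_tape (snd c)) of
       (q', as) \<Rightarrow> (q', map2 act_tape as (snd c)))"

definition tm_run :: "turing_machine \<Rightarrow> nat \<Rightarrow> config \<Rightarrow> config" where
  "tm_run M t = (tm_step M ^^ t)"

definition bit_symbol :: "bool \<Rightarrow> nat" where
  "bit_symbol b = (if b then 2 else 1)"

definition word_tape :: "bool list \<Rightarrow> tape" where
  "word_tape w =
    ((\<lambda>i. if 0 \<le> i \<and> i < int (length w) then bit_symbol (w ! nat i) else 0), 0)"

text \<open>Each input word is on a tape of its own; the remaining tapes are blank.\<close>

definition initial_config :: "turing_machine \<Rightarrow> bool list list \<Rightarrow> config" where
  "initial_config M ws =
    (0, map word_tape ws @ replicate (num_tapes M - length ws) (word_tape []))"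

text \<open>The output is the word on the first tape from the head up to the first blank.\<close>

definition has_output :: "config \<Rightarrow> bool list \<Rightarrow> bool" where
  "has_output c w \<longleftrightarrow>
    (case hd (snd c) of (symbol_at, h) \<Rightarrow>
      (\<forall>i < length w. symbol_at (h + int i) = bit_symbol (w ! i)) \<and>
      symbol_at (h + int (length w)) = 0)"


section \<open>Polynomial time and NP-completeness\<close>

definition polytime_computable :: "(bool list \<Rightarrow> bool list) \<Rightarrow> bool" where
  "polytime_computable f \<longleftrightarrow>
    (\<exists>M (p :: nat poly). wf_tm M \<and>
      (\<forall>x. let c = tm_run M (poly p (length x)) (initial_config M [x])
           in halted c \<and> has_output c (f x)))"

text \<open>
  Certificate definition of NP: the verifier gets the input and the certificate on its first
  two tapes, and always halts within polynomially many steps.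
\<close>

definition NP :: "bool list set set" where
  "NP = {L. \<exists>M (p :: nat poly) (q :: nat poly). wf_tm M \<and> num_tapes M \<ge> 2 \<and>
     (\<forall>x u. halted (tm_run M (poly p (length x + length u)) (initial_config M [x, u]))) \<and>
     (\<forall>x. x \<in> L \<longleftrightarrow>
       (\<exists>u. length u \<le> poly q (length x) \<and>
          accepting (tm_run M (poly p (length x + length u)) (initial_config M [x, u]))))}"

text \<open>
  NP-completeness of the problem \<open>Q\<close> restricted to the instances in \<open>I\<close>. Reductions have to
  produce instances in \<open>I\<close> for all inputs, also for those that are mapped to no-instances.
  For \<open>I = UNIV\<close> this is the usual NP-completeness of a language under polynomial-time
  many-one reductions.
\<close>

definition NP_complete_restricted :: "bool list set \<Rightarrow> bool list set \<Rightarrow> bool" where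
  "NP_complete_restricted Q I \<longleftrightarrow>
    Q \<inter> I \<in> NP \<and>
    (\<forall>A\<in>NP. \<exists>f. polytime_computable f \<and> (\<forall>x. f x \<in> I \<and> (x \<in> A \<longleftrightarrow> f x \<in> Q)))"


section \<open>Graphs\<close>

type_synonym 'a graph = "'a set \<times> 'a set set"

abbreviation verts :: "'a graph \<Rightarrow> 'a set" where "verts \<equiv> fst"
abbreviation edges :: "'a graph \<Rightarrow> 'a set set" where "edges \<equiv> snd"

definition simple_graph :: "'a graph \<Rightarrow> bool" where
  "simple_graph G \<longleftrightarrow> finite (verts G) \<and> (\<forall>e\<in>edges G. e \<subseteq> verts G \<and> card e = 2)"

definition delete_verts :: "'a graph \<Rightarrow> 'a set \<Rightarrow> 'a graph" where
  "delete_verts G S = (verts G - S, {e \<in> edges G. e \<inter> S = {}})"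

definition bipartite :: "'a graph \<Rightarrow> bool" where
  "bipartite G \<longleftrightarrow>
    (\<exists>A B. A \<inter> B = {} \<and> A \<union> B = verts G \<and> (\<forall>e\<in>edges G. \<exists>a\<in>A. \<exists>b\<in>B. e = {a, b}))"

definition odd_cycle_transversal :: "'a graph \<Rightarrow> 'a set \<Rightarrow> bool" where
  "odd_cycle_transversal G S \<longleftrightarrow> S \<subseteq> verts G \<and> bipartite (delete_verts G S)"

definition graph_isomorphic :: "'a graph \<Rightarrow> 'b graph \<Rightarrow> bool" where
  "graph_isomorphic G H \<longleftrightarrow>
    (\<exists>f. bij_betw f (verts G) (verts H) \<and>
      (\<forall>u\<in>verts G. \<forall>v\<in>verts G. {u, v} \<in> edges G \<longleftrightarrow> {f u, f v} \<in> edges H))"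

definition line_graph :: "'a graph \<Rightarrow> 'a set graph" where
  "line_graph G =
    (edges G, {{e, f} | e f. e \<in> edges G \<and> f \<in> edges G \<and> e \<noteq> f \<and> e \<inter> f \<noteq> {}})"

text \<open>
  Up to isomorphism, every finite graph has natural numbers as vertices, so fixing the vertex
  type of the root graph \<open>H\<close> loses nothing.
\<close>

definition is_line_graph :: "'a graph \<Rightarrow> bool" where
  "is_line_graph G \<longleftrightarrow>
    (\<exists>H :: nat graph. simple_graph H \<and> graph_isomorphic G (line_graph H))"


section \<open>The decision problem\<close>

text \<open>Binary representation, least significant bit first, without leading zeros.\<close>

fun binary :: "nat \<Rightarrow> bool list" where
  "binary k = (if k = 0 then [] else odd k # binary (k div 2))"

declare binary.simps [simp del]

text \<open>
  An instance \<open>(G, k)\<close>, where \<open>G\<close> has vertex set \<open>{..<n}\<close> and edge set \<open>E\<close>, is encoded as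
  \<open>n\<close> in unary, terminated by False, then the adjacency matrix row by row, then \<open>k\<close> in binary.
\<close>

definition encode_instance :: "nat \<Rightarrow> nat set set \<Rightarrow> nat \<Rightarrow> bool list" where
  "encode_instance n E k =
    replicate n True @ [False] @
    concat (map (\<lambda>i. map (\<lambda>j. {i, j} \<in> E) [0..<n]) [0..<n]) @
    binary k"

definition Odd_Cycle_Transversal :: "bool list set" where
  "Odd_Cycle_Transversal =
    {encode_instance n E k | n E k.
       simple_graph ({..<n}, E) \<and>
       (\<exists>S. odd_cycle_transversal ({..<n}, E) S \<and> card S \<le> k)}"

definition line_graph_instances :: "bool list set" where
  "line_graph_instances =
    {encode_instance n E k | n E k. simple_graph ({..<n}, E) \<and> is_line_graph ({..<n}, E)}"

end

theory Submission imports Defs begin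

text \<open>
  The line graph of \<open>H\<close> is bipartite iff the edges of \<open>H\<close> can be properly colored with two colors,
  so an odd cycle transversal of the line graph is a set of edges of \<open>H\<close> whose removal leaves only
  paths and even cycles. For hardness, satisfiability is reduced to this edge deletion problem,
  and the computations of a verifier are expressed by clauses. Both this reduction and
  the verification of certificates are given by arithmetic on numbers that are polynomially bounded
  in the size of the input, built from bounded sums and look-ups of input symbols. Such
  arithmetic is done in polynomial time by Turing machines that store a number as the
  position of the head on an otherwise empty tape.
\<close>


section \<open>While programs on tapes\<close>

text \<open>Hardness is proved from an arbitrary verifier, and a machine has to compute the
  reduction. This shapes the gadget: the end-vertices of an edge must be given by a formula in its
  number, so everything is uniform. All clauses have the same odd width, and every ring provides
  four vertices for every literal occurrence of the formula, also for those of other variables.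
  Locating a vertex then takes only \<open>div\<close> and \<open>mod\<close>. The budget is half
  the number \<open>R\<close> of ring vertices because each ring vertex has degree 3 and must lose
  an edge, while an edge accounts for at most two ring vertices. Within this budget only ring edges
  can be deleted, and every ring vertex loses exactly one. Membership in NP includes the test that
  the input is a line graph, so the certificate contains a root graph. The number \<open>k\<close>
  is given in binary and may be too large for a counter, but it only has to be compared with numbers
  up to the number of vertices.\<close>

text \<open>\<open>While \<tau> a c\<close> iterates \<open>c\<close> until the symbol under the head of tape \<open>\<tau>\<close> is \<open>a\<close>.\<close>

datatype com =
    Move nat head_move
  | Write nat nat
  | Seq com com (infixr ";;" 60)
  | Test nat nat com com
  | While nat nat com
  | Skip
  | Reject

text \<open>The control state of a program is the stack of the commands that are still to be executed.\<close>

fun next_stack :: "com list \<Rightarrow> (nat \<Rightarrow> nat) \<Rightarrow> com list \<times> (nat \<Rightarrow> nat \<times> head_move)" where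
  "next_stack [] ss = ([], \<lambda>\<tau>. (ss \<tau>, Stay))"
| "next_stack (Move \<tau>' m # k) ss = (k, \<lambda>\<tau>. (ss \<tau>, if \<tau> = \<tau>' then m else Stay))"
| "next_stack (Write \<tau>' a # k) ss = (k, \<lambda>\<tau>. (if \<tau> = \<tau>' then a else ss \<tau>, Stay))"
| "next_stack ((c ;; d) # k) ss = (c # d # k, \<lambda>\<tau>. (ss \<tau>, Stay))"
| "next_stack (Test \<tau>' a c d # k) ss = ((if ss \<tau>' = a then c else d) # k, \<lambda>\<tau>. (ss \<tau>, Stay))"
| "next_stack (While \<tau>' a c # k) ss =
     ((if ss \<tau>' = a then k else c # While \<tau>' a c # k), \<lambda>\<tau>. (ss \<tau>, Stay))"
| "next_stack (Skip # k) ss = (k, \<lambda>\<tau>. (ss \<tau>, Stay))"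
| "next_stack (Reject # k) ss = ([Reject], \<lambda>\<tau>. (ss \<tau>, Stay))"

type_synonym tapes = "nat \<Rightarrow> tape"

definition com_step :: "com list \<times> tapes \<Rightarrow> com list \<times> tapes" where
  "com_step p =
    (case next_stack (fst p) (\<lambda>\<tau>. read_tape (snd p \<tau>)) of
      (k, a) \<Rightarrow> (k, \<lambda>\<tau>. act_tape (a \<tau>) (snd p \<tau>)))"

lemma act_tape_Stay [simp]: "act_tape (read_tape tp, Stay) tp = tp"
  by (simp add: act_tape_def read_tape_def)

lemma com_step_simps [simp]:
  "com_step (Move \<tau> m # k, \<sigma>) = (k, \<sigma>(\<tau> := (fst (\<sigma> \<tau>), snd (\<sigma> \<tau>) + head_shift m)))"
  "com_step (Write \<tau> a # k, \<sigma>) = (k, \<sigma>(\<tau> := ((fst (\<sigma> \<tau>))(snd (\<sigma> \<tau>) := a), snd (\<sigma> \<tau>))))"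
  "com_step ((c ;; d) # k, \<sigma>) = (c # d # k, \<sigma>)"
  "com_step (Test \<tau> a c d # k, \<sigma>) = ((if read_tape (\<sigma> \<tau>) = a then c else d) # k, \<sigma>)"
  "com_step (While \<tau> a c # k, \<sigma>) =
     ((if read_tape (\<sigma> \<tau>) = a then k else c # While \<tau> a c # k), \<sigma>)"
  "com_step (Skip # k, \<sigma>) = (k, \<sigma>)"
  "com_step (Reject # k, \<sigma>) = ([Reject], \<sigma>)"
  "com_step ([], \<sigma>) = ([], \<sigma>)"
  by (auto simp: com_step_def fun_eq_iff act_tape_def read_tape_def)

text \<open>The number of steps \<open>t\<close> is fixed before the continuation \<open>k\<close>,
  so a run does not depend on what follows it and runs can be chained. \<open>b\<close> is only an
  upper bound for \<open>t\<close>.\<close>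

definition exec :: "com \<Rightarrow> tapes \<Rightarrow> nat \<Rightarrow> tapes \<Rightarrow> bool" where
  "exec c \<sigma> b \<sigma>' \<longleftrightarrow> (\<exists>t\<le>b. \<forall>k. (com_step ^^ t) (c # k, \<sigma>) = (k, \<sigma>'))"

lemma exec_mono: "exec c \<sigma> b \<sigma>' \<Longrightarrow> b \<le> b' \<Longrightarrow> exec c \<sigma> b' \<sigma>'"
  unfolding exec_def by (meson order_trans)

lemma funpow_Suc_apply: "(f ^^ Suc n) x = (f ^^ n) (f x)"
  by (simp add: funpow_Suc_right del: funpow.simps)

lemma exec_one:
  assumes "\<And>k. com_step (c # k, \<sigma>) = (k, \<sigma>')"
  shows "exec c \<sigma> 1 \<sigma>'"
  unfolding exec_def using assms by (intro exI[of _ 1]) simp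

lemma exec_Move: "exec (Move \<tau> m) \<sigma> 1 (\<sigma>(\<tau> := (fst (\<sigma> \<tau>), snd (\<sigma> \<tau>) + head_shift m)))"
  by (rule exec_one) simp

lemma exec_Write: "exec (Write \<tau> a) \<sigma> 1 (\<sigma>(\<tau> := ((fst (\<sigma> \<tau>))(snd (\<sigma> \<tau>) := a), snd (\<sigma> \<tau>))))"
  by (rule exec_one) simp

lemma exec_Skip: "exec Skip \<sigma> 1 \<sigma>"
  by (rule exec_one) simp

lemma exec_Seq:
  assumes "exec c \<sigma> t \<sigma>'" "exec d \<sigma>' t' \<sigma>''"
  shows "exec (c ;; d) \<sigma> (Suc (t + t')) \<sigma>''"
proof -
  obtain n where n: "n \<le> t" "\<And>k. (com_step ^^ n) (c # k, \<sigma>) = (k, \<sigma>')"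
    using assms(1) unfolding exec_def by blast
  obtain n' where n': "n' \<le> t'" "\<And>k. (com_step ^^ n') (d # k, \<sigma>') = (k, \<sigma>'')"
    using assms(2) unfolding exec_def by blast
  have "(com_step ^^ Suc (n' + n)) ((c ;; d) # k, \<sigma>) = (k, \<sigma>'')" for k
    unfolding funpow_Suc_apply by (simp add: funpow_add n(2) n'(2))
  then show ?thesis
    unfolding exec_def using n(1) n'(1) by (intro exI[of _ "Suc (n' + n)"]) auto
qed

lemma exec_step:
  assumes "\<And>k. com_step (c # k, \<sigma>) = (d # k, \<sigma>)" "exec d \<sigma> t \<sigma>'"
  shows "exec c \<sigma> (Suc t) \<sigma>'"
proof -
  obtain n where n: "n \<le> t" "\<And>k. (com_step ^^ n) (d # k, \<sigma>) = (k, \<sigma>')"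
    using assms(2) unfolding exec_def by blast
  have "(com_step ^^ Suc n) (c # k, \<sigma>) = (k, \<sigma>')" for k
    unfolding funpow_Suc_apply by (simp add: assms(1) n(2))
  then show ?thesis
    unfolding exec_def using n(1) by (intro exI[of _ "Suc n"]) auto
qed

lemma exec_Test_eq:
  "read_tape (\<sigma> \<tau>) = a \<Longrightarrow> exec c \<sigma> t \<sigma>' \<Longrightarrow> exec (Test \<tau> a c d) \<sigma> (Suc t) \<sigma>'"
  by (rule exec_step) auto

lemma exec_Test_neq:
  "read_tape (\<sigma> \<tau>) \<noteq> a \<Longrightarrow> exec d \<sigma> t \<sigma>' \<Longrightarrow> exec (Test \<tau> a c d) \<sigma> (Suc t) \<sigma>'"
  by (rule exec_step) auto

lemma exec_While_eq: "read_tape (\<sigma> \<tau>) = a \<Longrightarrow> exec (While \<tau> a c) \<sigma> 1 \<sigma>"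
  by (rule exec_one) simp

lemma exec_While_neq:
  assumes "read_tape (\<sigma> \<tau>) \<noteq> a" "exec c \<sigma> t \<sigma>'" "exec (While \<tau> a c) \<sigma>' t' \<sigma>''"
  shows "exec (While \<tau> a c) \<sigma> (Suc (t + t')) \<sigma>''"
proof -
  obtain n where n: "n \<le> t" "\<And>k. (com_step ^^ n) (c # k, \<sigma>) = (k, \<sigma>')"
    using assms(2) unfolding exec_def by blast
  obtain n' where n': "n' \<le> t'" "\<And>k. (com_step ^^ n') (While \<tau> a c # k, \<sigma>') = (k, \<sigma>'')"
    using assms(3) unfolding exec_def by blast
  have "(com_step ^^ Suc (n' + n)) (While \<tau> a c # k, \<sigma>) = (k, \<sigma>'')" for k
    unfolding funpow_Suc_apply using assms(1) by (simp add: funpow_add n(2) n'(2))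
  then show ?thesis
    unfolding exec_def using n(1) n'(1) by (intro exI[of _ "Suc (n' + n)"]) auto
qed

lemma exec_While_iterate:
  assumes "\<And>i. i < n \<Longrightarrow> read_tape (\<sigma> i \<tau>) \<noteq> a"
    and "read_tape (\<sigma> n \<tau>) = a"
    and "\<And>i. i < n \<Longrightarrow> exec c (\<sigma> i) t (\<sigma> (Suc i))"
  shows "exec (While \<tau> a c) (\<sigma> 0) (Suc (n * Suc t)) (\<sigma> n)"
  using assms
proof (induction n arbitrary: \<sigma>)
  case 0
  then show ?case by (auto intro: exec_mono exec_While_eq)
next
  case (Suc n)
  have "exec (While \<tau> a c) (\<sigma> (Suc 0)) (Suc (n * Suc t)) (\<sigma> (Suc n))"
    by (rule Suc.IH[of "\<lambda>i. \<sigma> (Suc i)"]) (use Suc.prems in auto)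
  then have "exec (While \<tau> a c) (\<sigma> 0) (Suc (t + Suc (n * Suc t))) (\<sigma> (Suc n))"
    by (rule exec_While_neq[rotated -1]) (use Suc.prems in auto)
  then show ?case by (rule exec_mono) simp
qed


section \<open>Translation to Turing machines\<close>

text \<open>The stacks that occur until \<open>c\<close> on top of \<open>k\<close> is finished.
  They correspond to positions in the program text, because \<open>While\<close> puts back the same
  continuation; hence they are finitely many and can serve as machine states.\<close>

fun stacks :: "com \<Rightarrow> com list \<Rightarrow> com list set" where
  "stacks (c ;; d) k = insert ((c ;; d) # k) (stacks c (d # k) \<union> stacks d k)"
| "stacks (Test \<tau> a c d) k = insert (Test \<tau> a c d # k) (stacks c k \<union> stacks d k)"
| "stacks (While \<tau> a c) k = insert (While \<tau> a c # k) (stacks c (While \<tau> a c # k))"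
| "stacks c k = {c # k}"

lemma finite_stacks: "finite (stacks c k)"
  by (induction c arbitrary: k) auto

lemma Cons_in_stacks: "c # k \<in> stacks c k"
  by (cases c) auto

fun com_ok :: "nat \<Rightarrow> com \<Rightarrow> bool" where
  "com_ok K (c ;; d) \<longleftrightarrow> com_ok K c \<and> com_ok K d"
| "com_ok K (Test \<tau> a c d) \<longleftrightarrow> \<tau> < K \<and> com_ok K c \<and> com_ok K d"
| "com_ok K (While \<tau> a c) \<longleftrightarrow> \<tau> < K \<and> com_ok K c"
| "com_ok K (Write \<tau> a) \<longleftrightarrow> a < 3"
| "com_ok K _ \<longleftrightarrow> True"

lemma next_stack_in_stacks:
  "stk \<in> stacks c k \<Longrightarrow>
    fst (next_stack stk ss) \<in> stacks c k \<or> fst (next_stack stk ss) = k \<or>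
    fst (next_stack stk ss) = [Reject]"
proof (induction c arbitrary: k)
  case (Seq c d)
  from Seq.prems consider "stk = (c ;; d) # k" | "stk \<in> stacks c (d # k)" | "stk \<in> stacks d k"
    by auto
  then show ?case
  proof cases
    case 1
    then show ?thesis by (simp add: Cons_in_stacks)
  next
    case 2
    from Seq.IH(1)[OF this] show ?thesis using Cons_in_stacks[of d k] by auto
  next
    case 3
    from Seq.IH(2)[OF this] show ?thesis by auto
  qed
next
  case (Test \<tau> a c d)
  from Test.prems consider "stk = Test \<tau> a c d # k" | "stk \<in> stacks c k" | "stk \<in> stacks d k"
    by auto
  then show ?case
  proof cases
    case 1
    then show ?thesis by (simp add: Cons_in_stacks)
  next
    case 2
    from Test.IH(1)[OF this] show ?thesis by auto
  next
    case 3
    from Test.IH(2)[OF this] show ?thesis by auto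
  qed
next
  case (While \<tau> a c)
  from While.prems consider "stk = While \<tau> a c # k" | "stk \<in> stacks c (While \<tau> a c # k)"
    by auto
  then show ?case
  proof cases
    case 1
    then show ?thesis by (simp add: Cons_in_stacks)
  next
    case 2
    from While.IH[OF this] show ?thesis by auto
  qed
qed auto

lemma com_ok_stacks:
  "stk \<in> stacks c k \<Longrightarrow> com_ok K c \<Longrightarrow> list_all (com_ok K) k \<Longrightarrow> list_all (com_ok K) stk"
  by (induction c arbitrary: k) fastforce+

definition stack_machine :: "nat \<Rightarrow> nat \<Rightarrow> (com list \<Rightarrow> nat) \<Rightarrow> (nat \<Rightarrow> com list) \<Rightarrow> turing_machine" where
  "stack_machine K n enc dec =
    \<lparr>num_tapes = K, num_states = n, num_symbols = 3,
     transition = (\<lambda>q ss. case next_stack (dec q) (\<lambda>\<tau>. ss ! \<tau>) of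
        (k, a) \<Rightarrow> (enc k, map a [0..<K]))\<rparr>"

text \<open>Start, accepting and rejecting state have the fixed numbers 0, 1 and 2, so three codes
  are prescribed and the other stacks are numbered from 3.\<close>

lemma ex_encoding:
  assumes "finite Q" "a \<in> Q" "b \<in> Q" "c \<in> Q" "distinct [a, b, c]"
  shows "\<exists>enc :: 'a \<Rightarrow> nat. bij_betw enc Q {..<card Q} \<and> enc a = 0 \<and> enc b = 1 \<and> enc c = 2 \<and>
    card Q \<ge> 3"
proof -
  let ?R = "Q - {a, b, c}"
  have fR: "finite ?R" using assms by auto
  have c3: "card {a, b, c} = 3" using assms(5) by simp
  have le: "{a, b, c} \<subseteq> Q" using assms by auto
  have cQ: "card Q = card ?R + 3"
    using card_Diff_subset[OF _ le] card_mono[OF assms(1) le] c3 by simp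
  obtain h where h: "bij_betw h ?R {..<card ?R}"
    using ex_bij_betw_finite_nat[OF fR] by (auto simp: atLeast0LessThan)
  define enc where "enc z = (if z = a then 0 else if z = b then 1 else if z = c then 2 else h z + 3)" for z
  have "bij_betw enc ?R {3..<card ?R + 3}"
  proof -
    have "bij_betw (\<lambda>i. i + 3) {..<card ?R} {3..<card ?R + 3}"
      by (rule bij_betw_byWitness[where f' = "\<lambda>i. i - 3"]) auto
    from bij_betw_trans[OF h this]
    have "bij_betw (\<lambda>z. h z + 3) ?R {3..<card ?R + 3}"
      by (simp add: comp_def)
    then show ?thesis
      by (rule bij_betw_cong[THEN iffD1, rotated]) (auto simp: enc_def)
  qed
  moreover have "bij_betw enc {a, b, c} {0, 1, 2}"
    using assms(5) by (auto simp: bij_betw_def enc_def inj_on_def)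
  ultimately have "bij_betw enc (?R \<union> {a, b, c}) ({3..<card ?R + 3} \<union> {0, 1, 2})"
    by (rule bij_betw_combine) auto
  moreover have "?R \<union> {a, b, c} = Q" using le by auto
  moreover have "{3..<card ?R + 3} \<union> {0, 1, 2} = {..<card Q}" using cQ by auto
  ultimately have "bij_betw enc Q {..<card Q}" by simp
  then show ?thesis
    using assms(5) cQ by (intro exI[of _ enc]) (auto simp: enc_def)
qed

text \<open>The states are the stacks. Programs act on infinitely many tapes, the machine only on
  the first \<open>K\<close>; actions on other tapes are dropped, which is harmless because
  \<open>com_ok\<close> confines the tests to tapes below \<open>K\<close>. For
  \<open>c = Reject\<close> the start state would coincide with the rejecting one.\<close>

lemma com_machine:
  assumes ok: "com_ok K c" and K: "1 \<le> K" and cR: "c \<noteq> Reject"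
  obtains M where "wf_tm M" "num_tapes M = K"
    "\<And>\<sigma> t k \<sigma>'. (com_step ^^ t) ([c], \<sigma>) = (k, \<sigma>') \<Longrightarrow>
       \<exists>q. tm_run M t (0, map \<sigma> [0..<K]) = (q, map \<sigma>' [0..<K]) \<and>
         (k = [] \<longrightarrow> q = 1) \<and> (k = [Reject] \<longrightarrow> q = 2)"
proof -
  let ?Q = "insert [] (insert [Reject] (stacks c []))"
  have fin: "finite ?Q" using finite_stacks by auto
  obtain enc where enc: "bij_betw enc ?Q {..<card ?Q}" "enc [c] = 0" "enc [] = 1"
    "enc [Reject] = 2" "card ?Q \<ge> 3"
    using ex_encoding[OF fin, of "[c]" "[]" "[Reject]"] Cons_in_stacks cR by fastforce
  define dec where "dec = inv_into ?Q enc"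
  define M where "M = stack_machine K (card ?Q) enc dec"
  have dec_enc: "dec (enc k) = k" if "k \<in> ?Q" for k
    unfolding dec_def using enc(1) that by (meson bij_betw_inv_into_left)
  have dec_in: "dec q \<in> ?Q" if "q < card ?Q" for q
    unfolding dec_def using enc(1) that
    by (metis bij_betwE bij_betw_inv_into lessThan_iff)
  have next_in: "fst (next_stack k ss) \<in> ?Q" if "k \<in> ?Q" for k ss
    using that next_stack_in_stacks[of k c "[]" ss] by auto
  have enc_less: "enc k < card ?Q" if "k \<in> ?Q" for k
    using enc(1) that by (meson bij_betwE lessThan_iff)
  have okQ: "list_all (com_ok K) k" if "k \<in> ?Q" for k
    using that com_ok_stacks[OF _ ok, of k "[]"] by auto
  have act_less: "fst (snd (next_stack k ss) \<tau>) < 3"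
    if "list_all (com_ok K) k" "ss \<tau> < 3" for k ss \<tau>
    using that by (induction k ss rule: next_stack.induct) auto
  have wf: "wf_tm M"
    unfolding wf_tm_def
  proof (intro conjI allI impI)
    fix q ss
    assume q: "q < num_states M" and len: "length ss = num_tapes M"
      and ss: "\<forall>s\<in>set ss. s < num_symbols M"
    have qQ: "dec q \<in> ?Q" using q dec_in by (simp add: M_def stack_machine_def)
    obtain k a where ka: "next_stack (dec q) (\<lambda>\<tau>. ss ! \<tau>) = (k, a)" by fastforce
    have "k \<in> ?Q" using next_in[OF qQ, of "\<lambda>\<tau>. ss ! \<tau>"] ka by simp
    moreover have "fst (a \<tau>) < 3" if "\<tau> < K" for \<tau>
      using act_less[OF okQ[OF qQ], of "\<lambda>\<tau>. ss ! \<tau>" \<tau>] ka ss that len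
      by (simp add: M_def stack_machine_def)
    ultimately show "case transition M q ss of (q', as) \<Rightarrow>
        q' < num_states M \<and> length as = num_tapes M \<and> (\<forall>(s, m)\<in>set as. s < num_symbols M)"
      using enc_less ka by (auto simp: M_def stack_machine_def split_beta)
  qed (use K enc(5) in \<open>auto simp: M_def stack_machine_def\<close>)
  have cong: "next_stack k ss = (k', a) \<Longrightarrow> \<exists>a'. next_stack k ss' = (k', a') \<and> (\<forall>\<tau><K. a' \<tau> = a \<tau>)"
    if "list_all (com_ok K) k" "\<And>\<tau>. \<tau> < K \<Longrightarrow> ss \<tau> = ss' \<tau>" for k ss ss' k' a
    using that by (induction k ss rule: next_stack.induct) auto
  have sim: "tm_step M (enc k, map \<sigma> [0..<K]) = (enc k', map \<sigma>' [0..<K])"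
    if kQ: "k \<in> ?Q" and st: "com_step (k, \<sigma>) = (k', \<sigma>')" for k \<sigma> k' \<sigma>'
  proof (cases "k = [] \<or> k = [Reject]")
    case True
    then show ?thesis
      using st enc by (auto simp: tm_step_def halted_def)
  next
    case False
    have "enc k \<noteq> 1" "enc k \<noteq> 2"
      using False dec_enc[OF kQ] dec_enc[of "[]"] dec_enc[of "[Reject]"] enc by auto
    then have nh: "\<not> halted (enc k, map \<sigma> [0..<K])" by (simp add: halted_def)
    obtain a where a: "next_stack k (\<lambda>\<tau>. read_tape (\<sigma> \<tau>)) = (k', a)"
      "\<sigma>' = (\<lambda>\<tau>. act_tape (a \<tau>) (\<sigma> \<tau>))"
      using st by (auto simp: com_step_def split: prod.splits)
    obtain a' where a': "next_stack k (\<lambda>\<tau>. map read_tape (map \<sigma> [0..<K]) ! \<tau>) = (k', a')"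
      "\<forall>\<tau><K. a' \<tau> = a \<tau>"
      using cong[OF okQ[OF kQ] _ a(1), of "\<lambda>\<tau>. map read_tape (map \<sigma> [0..<K]) ! \<tau>"] by auto
    have "map2 act_tape (map a' [0..<K]) (map \<sigma> [0..<K]) = map \<sigma>' [0..<K]"
      using a'(2) a(2) by (auto intro!: nth_equalityI)
    then show ?thesis
      using nh a'(1) dec_enc[OF kQ] by (simp add: tm_step_def M_def stack_machine_def)
  qed
  have step_in: "k' \<in> ?Q" if "k \<in> ?Q" "com_step (k, \<sigma>) = (k', \<sigma>')" for k \<sigma> k' \<sigma>'
    using next_in[OF that(1), of "\<lambda>\<tau>. read_tape (\<sigma> \<tau>)"] that(2)
    by (auto simp: com_step_def split: prod.splits)
  have run: "k \<in> ?Q \<and> tm_run M t (0, map \<sigma> [0..<K]) = (enc k, map \<sigma>' [0..<K])"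
    if "(com_step ^^ t) ([c], \<sigma>) = (k, \<sigma>')" for \<sigma> t k \<sigma>'
    using that
  proof (induction t arbitrary: k \<sigma>')
    case 0
    then show ?case using enc Cons_in_stacks by (auto simp: tm_run_def)
  next
    case (Suc t)
    obtain k1 \<sigma>1 where 1: "(com_step ^^ t) ([c], \<sigma>) = (k1, \<sigma>1)" by fastforce
    with Suc.prems have 2: "com_step (k1, \<sigma>1) = (k, \<sigma>')" by simp
    show ?case
      using Suc.IH[OF 1] sim[OF _ 2] step_in[OF _ 2] by (auto simp: tm_run_def)
  qed
  show thesis
  proof (rule that[OF wf])
    show "num_tapes M = K" by (simp add: M_def stack_machine_def)
    show "\<exists>q. tm_run M t (0, map \<sigma> [0..<K]) = (q, map \<sigma>' [0..<K]) \<and>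
         (k = [] \<longrightarrow> q = 1) \<and> (k = [Reject] \<longrightarrow> q = 2)"
      if "(com_step ^^ t) ([c], \<sigma>) = (k, \<sigma>')" for \<sigma> t k \<sigma>'
      using run[OF that] enc by auto
  qed
qed

text \<open>Allows a run of unknown length to be prolonged to the value of a polynomial time
  bound.\<close>

lemma tm_run_halted:
  assumes "halted (tm_run M t c)" "t \<le> t'"
  shows "tm_run M t' c = tm_run M t c"
proof -
  have "tm_run M (n + t) c = tm_run M t c" for n
    by (induction n) (use assms(1) in \<open>auto simp: tm_run_def tm_step_def\<close>)
  then show ?thesis using assms(2) by (metis le_add_diff_inverse2)
qed


section \<open>Counters\<close>

text \<open>
  A counter is a tape whose only nonblank cell is cell 0, with the head at the value of the
  counter. Incrementing, decrementing and testing for zero then take a single step. Tapes 0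
  and 1 hold the input words and tape 2 the output.
\<close>

definition counter :: "nat \<Rightarrow> tape" where
  "counter n = ((\<lambda>i. if i = 0 then 1 else 0), int n)"

definition layout :: "tapes \<Rightarrow> (nat \<Rightarrow> nat) \<Rightarrow> tapes" where
  "layout A r \<tau> = (if \<tau> < 3 then A \<tau> else counter (r (\<tau> - 3)))"

lemma layout_counter [simp]: "layout A r (3 + j) = counter (r j)"
  by (simp add: layout_def)

lemma layout_less [simp]: "\<tau> < 3 \<Longrightarrow> layout A r \<tau> = A \<tau>"
  by (simp add: layout_def)

lemma layout_upd_counter: "(layout A r)(3 + j := counter n) = layout A (r(j := n))"
  by (auto simp: layout_def fun_eq_iff)

lemma layout_upd_less: "\<tau> < 3 \<Longrightarrow> (layout A r)(\<tau> := tp) = layout (A(\<tau> := tp)) r"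
  by (auto simp: layout_def fun_eq_iff)

lemma read_counter [simp]:
  "read_tape (counter n) = 1 \<longleftrightarrow> n = 0" "read_tape (counter n) = Suc 0 \<longleftrightarrow> n = 0"
  by (simp_all add: read_tape_def counter_def)

definition inc :: "nat \<Rightarrow> com" where "inc j = Move (3 + j) Move_Right"
definition dec :: "nat \<Rightarrow> com" where "dec j = Move (3 + j) Move_Left"
text \<open>The loop ends when the head stands on the mark in cell 0. Decrementing comes first, so
  iteration \<open>i\<close> out of \<open>n\<close> sees the value \<open>n - Suc i\<close> in
  counter \<open>j\<close>.\<close>

definition repeat :: "nat \<Rightarrow> com \<Rightarrow> com" where "repeat j c = While (3 + j) 1 (dec j ;; c)"

lemma exec_inc: "exec (inc j) (layout A r) 1 (layout A (r(j := Suc (r j))))"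
proof -
  have "(fst (counter n), snd (counter n) + head_shift Move_Right) = counter (Suc n)" for n
    by (simp add: counter_def)
  then show ?thesis
    using exec_Move[of "3 + j" Move_Right "layout A r"] by (simp only: inc_def layout_counter layout_upd_counter)
qed

lemma exec_dec:
  assumes "r j > 0"
  shows "exec (dec j) (layout A r) 1 (layout A (r(j := r j - 1)))"
proof -
  have "(fst (counter n), snd (counter n) + head_shift Move_Left) = counter (n - 1)" if "n > 0" for n
    using that by (simp add: counter_def)
  then show ?thesis
    using exec_Move[of "3 + j" Move_Left "layout A r"] assms
    by (simp only: dec_def layout_counter layout_upd_counter)
qed

text \<open>\<open>A i\<close> and \<open>r i\<close> describe the state after \<open>i\<close>
  iterations, except that counter \<open>j\<close> is overwritten by the number of iterations left;
  the body must hand back counter \<open>j\<close> as it found it.\<close>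

lemma exec_repeat:
  assumes "\<And>i. i < n \<Longrightarrow>
      exec c (layout (A i) ((r i)(j := n - Suc i))) t (layout (A (Suc i)) ((r (Suc i))(j := n - Suc i)))"
    and "s0 = (r 0)(j := n)" "s1 = (r n)(j := 0)"
  shows "exec (repeat j c) (layout (A 0) s0) (Suc (n * (t + 3))) (layout (A n) s1)"
proof -
  have "exec (While (3 + j) 1 (dec j ;; c)) (layout (A 0) ((r 0)(j := n - 0))) (Suc (n * Suc (Suc (1 + t))))
     (layout (A n) ((r n)(j := n - n)))"
  proof (rule exec_While_iterate[where \<sigma> = "\<lambda>i. layout (A i) ((r i)(j := n - i))"])
    fix i assume i: "i < n"
    have "exec (dec j) (layout (A i) ((r i)(j := n - i))) 1 (layout (A i) ((r i)(j := n - Suc i)))"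
      using exec_dec[of "(r i)(j := n - i)" j "A i"] i by simp
    then show "exec (dec j ;; c) (layout (A i) ((r i)(j := n - i))) (Suc (1 + t))
        (layout (A (Suc i)) ((r (Suc i))(j := n - Suc i)))"
      using assms(1)[OF i] by (rule exec_Seq)
  qed (auto simp: layout_def counter_def read_tape_def)
  then have "exec (While (3 + j) 1 (dec j ;; c)) (layout (A 0) ((r 0)(j := n - 0))) (Suc (n * (t + 3)))
     (layout (A n) ((r n)(j := n - n)))"
    by (rule exec_mono) (simp add: algebra_simps)
  then show ?thesis
    unfolding repeat_def assms(2,3) by simp
qed

lemma exec_transfer:
  assumes "j \<noteq> k"
  shows "exec (repeat j (inc k)) (layout A r) (Suc (r j * 4)) (layout A (r(k := r k + r j, j := 0)))"
proof -
  have "exec (repeat j (inc k)) (layout A r) (Suc (r j * (1 + 3))) (layout A (r(k := r k + r j, j := 0)))"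
  proof (rule exec_repeat[where A = "\<lambda>_. A" and r = "\<lambda>i. r(k := r k + i)"])
    fix i
    show "exec (inc k) (layout A ((r(k := r k + i))(j := r j - Suc i))) 1
         (layout A ((r(k := r k + Suc i))(j := r j - Suc i)))"
      using exec_inc[of k A "(r(k := r k + i))(j := r j - Suc i)"] assms
      by (simp add: fun_upd_twist)
  qed auto
  then show ?thesis by simp
qed

lemma exec_clear: "exec (repeat j Skip) (layout A r) (Suc (r j * 4)) (layout A (r(j := 0)))"
proof -
  have "exec (repeat j Skip) (layout A r) (Suc (r j * (1 + 3))) (layout A (r(j := 0)))"
    by (rule exec_repeat[where A = "\<lambda>_. A" and r = "\<lambda>_. r"], rule exec_Skip) auto
  then show ?thesis by simp
qed

primrec increase :: "nat \<Rightarrow> nat \<Rightarrow> com" where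
  "increase j 0 = Skip"
| "increase j (Suc n) = inc j ;; increase j n"

lemma exec_increase: "exec (increase j n) (layout A r) (Suc (2 * n)) (layout A (r(j := r j + n)))"
proof (induction n arbitrary: r)
  case 0
  then show ?case using exec_Skip[of "layout A r"] by simp
next
  case (Suc n)
  have "exec (increase j (Suc n)) (layout A r) (Suc (1 + Suc (2 * n)))
     (layout A ((r(j := Suc (r j)))(j := (r(j := Suc (r j))) j + n)))"
    unfolding increase.simps by (rule exec_Seq[OF exec_inc Suc.IH])
  moreover have "(r(j := Suc (r j)))(j := (r(j := Suc (r j))) j + n) = r(j := r j + Suc n)"
    by (auto simp: fun_eq_iff)
  ultimately show ?case by (metis exec_mono add_Suc_right mult_2 order_refl plus_1_eq_Suc add_Suc)
qed


section \<open>Polynomially bounded functions\<close>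

definition poly_bounded :: "(nat \<Rightarrow> nat) \<Rightarrow> bool" where
  "poly_bounded f \<longleftrightarrow> (\<exists>p :: nat poly. \<forall>n. f n \<le> poly p n)"

text \<open>Coefficients are natural numbers, hence nonnegative.\<close>

lemma poly_nat_mono: "m \<le> n \<Longrightarrow> poly p m \<le> poly p n" for p :: "nat poly"
  by (induction p) (auto intro: add_mono mult_mono)

lemma poly_bounded_const: "poly_bounded (\<lambda>n. c)"
  unfolding poly_bounded_def by (rule exI[of _ "[:c:]"]) simp

lemma poly_bounded_id: "poly_bounded (\<lambda>n. n)"
  unfolding poly_bounded_def by (rule exI[of _ "[:0, 1:]"]) simp

lemma poly_bounded_add:
  assumes "poly_bounded f" "poly_bounded g"
  shows "poly_bounded (\<lambda>n. f n + g n)"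
proof -
  obtain p q where "\<forall>n. f n \<le> poly p n" "\<forall>n. g n \<le> poly q n"
    using assms unfolding poly_bounded_def by blast
  then show ?thesis
    unfolding poly_bounded_def by (intro exI[of _ "p + q"]) (auto intro: add_mono)
qed

lemma poly_bounded_mult:
  assumes "poly_bounded f" "poly_bounded g"
  shows "poly_bounded (\<lambda>n. f n * g n)"
proof -
  obtain p q where "\<forall>n. f n \<le> poly p n" "\<forall>n. g n \<le> poly q n"
    using assms unfolding poly_bounded_def by blast
  then show ?thesis
    unfolding poly_bounded_def by (intro exI[of _ "p * q"]) (auto intro: mult_mono)
qed

lemma poly_bounded_comp:
  assumes "poly_bounded f" "poly_bounded g"
  shows "poly_bounded (\<lambda>n. f (g n))"
proof -
  obtain p q where p: "\<forall>n. f n \<le> poly p n" and q: "\<forall>n. g n \<le> poly q n"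
    using assms unfolding poly_bounded_def by blast
  have "f (g n) \<le> poly (pcompose p q) n" for n
    using p q poly_nat_mono[of "g n" "poly q n" p] order_trans by (fastforce simp: poly_pcompose)
  then show ?thesis
    unfolding poly_bounded_def by blast
qed

section \<open>Arithmetic expressions over the input\<close>

text \<open>The value of \<open>Sym b e\<close> is 0 beyond the end of the word, and 1 or 2 for the bits False or True.\<close>

datatype expr =
    Const nat
  | Var nat
  | Add expr expr
  | Sub expr expr
  | Sum nat expr expr
  | Sym bool expr
  | Len bool

definition symbol :: "bool list \<Rightarrow> nat \<Rightarrow> nat" where
  "symbol w i = (if i < length w then bit_symbol (w ! i) else 0)"

fun eval :: "(bool \<Rightarrow> bool list) \<Rightarrow> (nat \<Rightarrow> nat) \<Rightarrow> expr \<Rightarrow> nat" where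
  "eval W s (Const n) = n"
| "eval W s (Var v) = s v"
| "eval W s (Add a b) = eval W s a + eval W s b"
| "eval W s (Sub a b) = eval W s a - eval W s b"
| "eval W s (Sum v a b) = (\<Sum>i<eval W s a. eval W (s(v := i)) b)"
| "eval W s (Sym b a) = symbol (W b) (eval W s a)"
| "eval W s (Len b) = length (W b)"

definition input_tape :: "bool \<Rightarrow> nat" where
  "input_tape b = (if b then 1 else 0)"

lemma input_tape_less [simp]: "input_tape b < 3"
  by (simp add: input_tape_def)

text \<open>\<open>\<rho>\<close> assigns counters to variables; \<open>k\<close> is the first free
  counter and receives the value. Reading a counter destroys it, hence \<open>Var\<close> makes two
  copies and moves one back. For \<open>Sum\<close>, counter \<open>k\<close> accumulates,
  \<open>k + 1\<close> holds the remaining iterations, \<open>k + 2\<close> the bound variable and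
  \<open>k + 3\<close> the summand. \<open>Sym\<close> and \<open>Len\<close> count head moves in
  \<open>k + 1\<close> in order to undo them.\<close>

fun compile :: "(nat \<Rightarrow> nat) \<Rightarrow> nat \<Rightarrow> expr \<Rightarrow> com" where
  "compile \<rho> k (Const n) = increase k n"
| "compile \<rho> k (Var v) = repeat (\<rho> v) (inc k ;; inc (k + 1)) ;; repeat (k + 1) (inc (\<rho> v))"
| "compile \<rho> k (Add a b) = compile \<rho> k a ;; compile \<rho> (k + 1) b ;; repeat (k + 1) (inc k)"
| "compile \<rho> k (Sub a b) =
    compile \<rho> k a ;; compile \<rho> (k + 1) b ;; repeat (k + 1) (Test (3 + k) 1 Skip (dec k))"
| "compile \<rho> k (Sum v a b) =
    compile \<rho> (k + 1) a ;;
    repeat (k + 1) (compile (\<rho>(v := k + 2)) (k + 3) b ;; repeat (k + 3) (inc k) ;; inc (k + 2)) ;;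
    repeat (k + 2) Skip"
| "compile \<rho> k (Sym b a) =
    compile \<rho> k a ;;
    repeat k (inc (k + 1) ;; Move (input_tape b) Move_Right) ;;
    Test (input_tape b) 1 (inc k) (Test (input_tape b) 2 (inc k ;; inc k) Skip) ;;
    repeat (k + 1) (Move (input_tape b) Move_Left)"
| "compile \<rho> k (Len b) =
    While (input_tape b) 0 (inc k ;; inc (k + 1) ;; Move (input_tape b) Move_Right) ;;
    repeat (k + 1) (Move (input_tape b) Move_Left)"

text \<open>One \<open>N\<close> bounds the input lengths and the variables, and one
  \<open>f\<close> bounds both value and time. The bound on values is what keeps loops polynomial,
  since a value may be the number of iterations of a sum. Free counters are 0 before and, except for
  \<open>k\<close>, also afterwards.\<close>

definition compiles :: "(nat \<Rightarrow> nat) \<Rightarrow> nat \<Rightarrow> expr \<Rightarrow> (nat \<Rightarrow> nat) \<Rightarrow> bool" where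
  "compiles \<rho> k e f \<longleftrightarrow>
    (\<forall>A W r N s. (\<forall>b. A (input_tape b) = word_tape (W b) \<and> length (W b) \<le> N) \<longrightarrow>
       (\<forall>v. r (\<rho> v) = s v \<and> s v \<le> N) \<longrightarrow> (\<forall>j\<ge>k. r j = 0) \<longrightarrow>
       eval W s e \<le> f N \<and>
       exec (compile \<rho> k e) (layout A r) (f N) (layout A (r(k := eval W s e))))"

lemma compilesD:
  assumes "compiles \<rho> k e f" "\<And>b. A (input_tape b) = word_tape (W b)" "\<And>b. length (W b) \<le> N"
    "\<And>v. r (\<rho> v) = s v" "\<And>v. s v \<le> N" "\<And>j. j \<ge> k \<Longrightarrow> r j = 0"
  shows "eval W s e \<le> f N \<and>
    exec (compile \<rho> k e) (layout A r) (f N) (layout A (r(k := eval W s e)))"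
  using assms unfolding compiles_def by presburger

lemma exec_Move_tape:
  "\<tau> < 3 \<Longrightarrow> exec (Move \<tau> m) (layout A r) 1
     (layout (A(\<tau> := (fst (A \<tau>), snd (A \<tau>) + head_shift m))) r)"
  using exec_Move[of \<tau> m "layout A r"] by (simp add: layout_upd_less)

lemma exec_Write_tape:
  "\<tau> < 3 \<Longrightarrow> exec (Write \<tau> a) (layout A r) 1
     (layout (A(\<tau> := ((fst (A \<tau>))(snd (A \<tau>) := a), snd (A \<tau>)))) r)"
  using exec_Write[of \<tau> a "layout A r"] by (simp add: layout_upd_less)

lemma exec_rewind:
  assumes "\<tau> < 3" "A \<tau> = (g, int (r k) + z)"
  shows "exec (repeat k (Move \<tau> Move_Left)) (layout A r) (Suc (r k * 4))
     (layout (A(\<tau> := (g, z))) (r(k := 0)))"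
proof -
  let ?A = "\<lambda>i. A(\<tau> := (g, int (r k) + z - int i))"
  have "exec (repeat k (Move \<tau> Move_Left)) (layout (?A 0) r) (Suc (r k * (1 + 3)))
     (layout (?A (r k)) (r(k := 0)))"
  proof (rule exec_repeat[where A = ?A and r = "\<lambda>_. r"])
    fix i
    show "exec (Move \<tau> Move_Left) (layout (?A i) (r(k := r k - Suc i))) 1
            (layout (?A (Suc i)) (r(k := r k - Suc i)))"
      using exec_Move_tape[OF assms(1), of Move_Left "?A i" "r(k := r k - Suc i)"]
      by (simp add: algebra_simps)
  qed auto
  moreover have "?A 0 = A" using assms(2) by (auto simp: fun_eq_iff)
  ultimately show ?thesis by simp
qed

lemma compiles_Const: "compiles \<rho> k (Const n) (\<lambda>N. Suc (2 * n))"
proof -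
  have "exec (increase k n) (layout A r) (Suc (2 * n)) (layout A (r(k := n)))" if "r k = 0" for A r
    using exec_increase[of k n A r] that by simp
  then show ?thesis by (simp add: compiles_def)
qed

lemma compiles_Var:
  assumes "\<And>v. \<rho> v < k"
  shows "compiles \<rho> k (Var v) (\<lambda>N. 10 * N + 10)"
proof -
  have "exec (compile \<rho> k (Var v)) (layout A r) (10 * N + 10) (layout A (r(k := s v)))"
    if r: "\<And>v. r (\<rho> v) = s v" "s v \<le> N" and 0: "\<And>j. j \<ge> k \<Longrightarrow> r j = 0" for A r N s
  proof -
    have ne: "\<rho> v \<noteq> k" "\<rho> v \<noteq> Suc k" using assms[of v] by auto
    have "exec (repeat (\<rho> v) (inc k ;; inc (k + 1))) (layout A r) (Suc (s v * (Suc (1 + 1) + 3)))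
       (layout A (r(k := s v, k + 1 := s v, \<rho> v := 0)))"
    proof (rule exec_repeat[where A = "\<lambda>_. A" and r = "\<lambda>i. r(k := i, k + 1 := i)"])
      fix i
      let ?r = "(r(k := i, k + 1 := i))(\<rho> v := s v - Suc i)"
      have "exec (inc k ;; inc (k + 1)) (layout A ?r) (Suc (1 + 1))
          (layout A ((?r(k := Suc (?r k)))(k + 1 := Suc ((?r(k := Suc (?r k))) (k + 1)))))"
        by (rule exec_Seq[OF exec_inc exec_inc])
      also have "(?r(k := Suc (?r k)))(k + 1 := Suc ((?r(k := Suc (?r k))) (k + 1))) =
          (r(k := Suc i, k + 1 := Suc i))(\<rho> v := s v - Suc i)"
        using ne by (auto simp: fun_eq_iff)
      finally show "exec (inc k ;; inc (k + 1)) (layout A ?r) (Suc (1 + 1)) 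
        (layout A ((r(k := Suc i, k + 1 := Suc i))(\<rho> v := s v - Suc i)))" .
    qed (use r 0 ne in \<open>auto simp: fun_eq_iff\<close>)
    moreover have "exec (repeat (k + 1) (inc (\<rho> v))) (layout A (r(k := s v, k + 1 := s v, \<rho> v := 0)))
       (Suc (s v * 4)) (layout A (r(k := s v)))"
    proof -
      have "(r(k := s v, k + 1 := s v, \<rho> v := 0))(\<rho> v := s v, k + 1 := 0) = r(k := s v)"
        using ne r(1)[of v] 0[of "k + 1"] by (auto simp: fun_eq_iff)
      then show ?thesis
        using exec_transfer[of "k + 1" "\<rho> v" A "r(k := s v, k + 1 := s v, \<rho> v := 0)"] ne
        by simp
    qed
    ultimately have "exec (compile \<rho> k (Var v)) (layout A r)
        (Suc (Suc (s v * (Suc (1 + 1) + 3)) + Suc (s v * 4))) (layout A (r(k := s v)))"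
      unfolding compile.simps by (rule exec_Seq)
    then show ?thesis by (rule exec_mono) (use r(2) in simp)
  qed
  moreover have "s v \<le> 10 * N + 10" if "s v \<le> N" for s :: "nat \<Rightarrow> nat" and N
    using that by simp
  ultimately show ?thesis unfolding compiles_def by (metis eval.simps(2))
qed

lemma compiles_Add:
  assumes "\<And>v. \<rho> v < k" "compiles \<rho> k a f" "compiles \<rho> (k + 1) b g"
  shows "compiles \<rho> k (Add a b) (\<lambda>N. f N + 5 * g N + 10)"
  unfolding compiles_def
proof (intro allI impI)
  fix A :: tapes and W and r :: "nat \<Rightarrow> nat" and N s
  assume A: "\<forall>b. A (input_tape b) = word_tape (W b) \<and> length (W b) \<le> N"
    and r: "\<forall>v. r (\<rho> v) = s v \<and> s v \<le> N" and 0: "\<forall>j\<ge>k. r j = 0"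
  let ?a = "eval W s a" and ?b = "eval W s b"
  have "?a \<le> f N \<and> exec (compile \<rho> k a) (layout A r) (f N) (layout A (r(k := ?a)))"
    by (rule compilesD[OF assms(2)]) (use A r 0 in auto)
  then have 1: "?a \<le> f N" "exec (compile \<rho> k a) (layout A r) (f N) (layout A (r(k := ?a)))"
    by simp_all
  have "\<rho> v \<noteq> k" for v using assms(1)[of v] by simp
  then have "?b \<le> g N \<and> exec (compile \<rho> (k + 1) b) (layout A (r(k := ?a))) (g N)
      (layout A (r(k := ?a, k + 1 := ?b)))"
    by (intro compilesD[OF assms(3)]) (use A r 0 in auto)
  then have 2: "?b \<le> g N" "exec (compile \<rho> (k + 1) b) (layout A (r(k := ?a))) (g N)
      (layout A (r(k := ?a, k + 1 := ?b)))"
    by simp_all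
  have "r(k := ?a, k + 1 := ?b, k := ?a + ?b, k + 1 := 0) = r(k := ?a + ?b)"
    using 0 by (auto simp: fun_eq_iff)
  then have 3: "exec (repeat (k + 1) (inc k)) (layout A (r(k := ?a, k + 1 := ?b))) (Suc (?b * 4))
      (layout A (r(k := ?a + ?b)))"
    using exec_transfer[of "k + 1" k A "r(k := ?a, k + 1 := ?b)"] by simp
  have "exec (compile \<rho> k (Add a b)) (layout A r) (Suc (f N + Suc (g N + Suc (?b * 4))))
      (layout A (r(k := ?a + ?b)))"
    unfolding compile.simps by (intro exec_Seq[OF 1(2)] exec_Seq[OF 2(2)] 3)
  then have "exec (compile \<rho> k (Add a b)) (layout A r) (f N + 5 * g N + 10)
      (layout A (r(k := ?a + ?b)))"
    by (rule exec_mono) (use 2(1) in simp)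
  then show "eval W s (Add a b) \<le> f N + 5 * g N + 10 \<and>
     exec (compile \<rho> k (Add a b)) (layout A r) (f N + 5 * g N + 10) (layout A (r(k := eval W s (Add a b))))"
    using 1(1) 2(1) by simp
qed

lemma compiles_Sub:
  assumes "\<And>v. \<rho> v < k" "compiles \<rho> k a f" "compiles \<rho> (k + 1) b g"
  shows "compiles \<rho> k (Sub a b) (\<lambda>N. f N + 6 * g N + 10)"
  unfolding compiles_def
proof (intro allI impI)
  fix A :: tapes and W and r :: "nat \<Rightarrow> nat" and N s
  assume A: "\<forall>b. A (input_tape b) = word_tape (W b) \<and> length (W b) \<le> N"
    and r: "\<forall>v. r (\<rho> v) = s v \<and> s v \<le> N" and 0: "\<forall>j\<ge>k. r j = 0"
  let ?a = "eval W s a" and ?b = "eval W s b"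
  have "?a \<le> f N \<and> exec (compile \<rho> k a) (layout A r) (f N) (layout A (r(k := ?a)))"
    by (rule compilesD[OF assms(2)]) (use A r 0 in auto)
  then have 1: "?a \<le> f N" "exec (compile \<rho> k a) (layout A r) (f N) (layout A (r(k := ?a)))"
    by simp_all
  have "\<rho> v \<noteq> k" for v using assms(1)[of v] by simp
  then have "?b \<le> g N \<and> exec (compile \<rho> (k + 1) b) (layout A (r(k := ?a))) (g N)
      (layout A (r(k := ?a, k + 1 := ?b)))"
    by (intro compilesD[OF assms(3)]) (use A r 0 in auto)
  then have 2: "?b \<le> g N" "exec (compile \<rho> (k + 1) b) (layout A (r(k := ?a))) (g N)
      (layout A (r(k := ?a, k + 1 := ?b)))"
    by simp_all
  have 3: "exec (repeat (k + 1) (Test (3 + k) 1 Skip (dec k))) (layout A (r(k := ?a, k + 1 := ?b)))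
      (Suc (?b * (2 + 3))) (layout A (r(k := ?a - ?b)))"
  proof (rule exec_repeat[where A = "\<lambda>_. A" and r = "\<lambda>i. r(k := ?a - i)"])
    fix i
    let ?r = "(r(k := ?a - i))(k + 1 := ?b - Suc i)"
    show "exec (Test (3 + k) 1 Skip (dec k)) (layout A ?r) 2
         (layout A ((r(k := ?a - Suc i))(k + 1 := ?b - Suc i)))"
    proof (cases "?a - i = 0")
      case True
      have "(r(k := ?a - Suc i))(k + 1 := ?b - Suc i) = ?r" using True by (auto simp: fun_eq_iff)
      moreover have "exec (Test (3 + k) 1 Skip (dec k)) (layout A ?r) (Suc 1) (layout A ?r)"
        by (rule exec_Test_eq[OF _ exec_Skip]) (use True in \<open>simp only: layout_counter, simp\<close>)
      ultimately show ?thesis by (simp add: numeral_2_eq_2)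
    next
      case False
      have "exec (Test (3 + k) 1 Skip (dec k)) (layout A ?r) (Suc 1) (layout A (?r(k := ?r k - 1)))"
        by (rule exec_Test_neq[OF _ exec_dec]) (use False in \<open>simp_all only: layout_counter, simp_all\<close>)
      moreover have "?r(k := ?r k - 1) = (r(k := ?a - Suc i))(k + 1 := ?b - Suc i)"
        by (auto simp: fun_eq_iff)
      ultimately show ?thesis by (simp add: numeral_2_eq_2)
    qed
  qed (use 0 in \<open>auto simp: fun_eq_iff\<close>)
  have "exec (compile \<rho> k (Sub a b)) (layout A r) (Suc (f N + Suc (g N + Suc (?b * (2 + 3)))))
      (layout A (r(k := ?a - ?b)))"
    unfolding compile.simps by (intro exec_Seq[OF 1(2)] exec_Seq[OF 2(2)] 3)
  then have "exec (compile \<rho> k (Sub a b)) (layout A r) (f N + 6 * g N + 10)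
      (layout A (r(k := ?a - ?b)))"
    by (rule exec_mono) (use 2(1) in simp)
  then show "eval W s (Sub a b) \<le> f N + 6 * g N + 10 \<and>
     exec (compile \<rho> k (Sub a b)) (layout A r) (f N + 6 * g N + 10) (layout A (r(k := eval W s (Sub a b))))"
    using 1(1) 2(1) by simp
qed

text \<open>The bound variable stays below the value of \<open>a\<close> and hence below
  \<open>f N\<close>, so \<open>N + f N\<close> bounds all variables of the body; this is where
  \<open>g\<close> is evaluated.\<close>

lemma compiles_Sum:
  fixes f g :: "nat \<Rightarrow> nat"
  defines "h \<equiv> \<lambda>N. 10 * f N + f N * (10 * g (N + f N) + 20) + 20"
  assumes "\<And>v. \<rho> v < k" "compiles \<rho> (k + 1) a f" "compiles (\<rho>(v := k + 2)) (k + 3) b g"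
  shows "compiles \<rho> k (Sum v a b) h"
  unfolding compiles_def
proof (intro allI impI)
  fix A :: tapes and W and r :: "nat \<Rightarrow> nat" and N s
  assume A: "\<forall>b. A (input_tape b) = word_tape (W b) \<and> length (W b) \<le> N"
    and r: "\<forall>v. r (\<rho> v) = s v \<and> s v \<le> N" and 0: "\<forall>j\<ge>k. r j = 0"
  let ?a = "eval W s a" and ?b = "\<lambda>i. eval W (s(v := i)) b"
  let ?S = "\<lambda>n. \<Sum>i<n. ?b i" and ?G = "g (N + f N)"
  have ne: "\<rho> v < k" for v by (rule assms)
  have "?a \<le> f N \<and> exec (compile \<rho> (k + 1) a) (layout A r) (f N) (layout A (r(k + 1 := ?a)))"
    by (rule compilesD[OF assms(3)]) (use A r 0 in auto)
  then have 1: "?a \<le> f N" "exec (compile \<rho> (k + 1) a) (layout A r) (f N) (layout A (r(k + 1 := ?a)))"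
    by simp_all
  let ?R = "\<lambda>i. r(k := ?S i, k + 2 := i)"
  let ?c = "compile (\<rho>(v := k + 2)) (k + 3) b ;; repeat (k + 3) (inc k) ;; inc (k + 2)"
  have 2: "exec (repeat (k + 1) ?c) (layout A (r(k + 1 := ?a)))
      (Suc (?a * (Suc (?G + Suc (Suc (?G * 4) + 1)) + 3))) (layout A (r(k := ?S ?a, k + 2 := ?a)))"
  proof (rule exec_repeat[where A = "\<lambda>_. A" and r = ?R])
    fix i assume i: "i < ?a"
    let ?q = "?a - Suc i"
    have "?b i \<le> ?G \<and> exec (compile (\<rho>(v := k + 2)) (k + 3) b) (layout A ((?R i)(k + 1 := ?q))) ?G
      (layout A ((?R i)(k + 1 := ?q, k + 3 := ?b i)))"
    proof (rule compilesD[OF assms(4)])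
      show "length (W b) \<le> N + f N" for b using A by (simp add: trans_le_add1)
      show "((?R i)(k + 1 := ?q)) ((\<rho>(v := k + 2)) v') = (s(v := i)) v'" for v'
        using r ne[of v'] by auto
      show "(s(v := i)) v' \<le> N + f N" for v' using r i 1(1) by (simp add: trans_le_add1)
    qed (use A 0 in auto)
    then have 3: "?b i \<le> ?G" "exec (compile (\<rho>(v := k + 2)) (k + 3) b) (layout A ((?R i)(k + 1 := ?q))) ?G
      (layout A ((?R i)(k + 1 := ?q, k + 3 := ?b i)))"
      by simp_all
    let ?r = "(?R i)(k + 1 := ?q, k + 3 := ?b i)"
    have "exec (repeat (k + 3) (inc k)) (layout A ?r) (Suc (?r (k + 3) * 4))
        (layout A (?r(k := ?r k + ?r (k + 3), k + 3 := 0)))"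
      by (rule exec_transfer) simp
    also have "?r(k := ?r k + ?r (k + 3), k + 3 := 0) = r(k := ?S (Suc i), k + 2 := i, k + 1 := ?q)"
      using 0 by (auto simp: fun_eq_iff)
    finally have 4: "exec (repeat (k + 3) (inc k)) (layout A ?r) (Suc (?G * 4))
        (layout A (r(k := ?S (Suc i), k + 2 := i, k + 1 := ?q)))"
      by (rule exec_mono) (simp only: fun_upd_same Suc_le_mono mult_le_mono1[OF 3(1)])
    have 5: "exec (inc (k + 2)) (layout A (r(k := ?S (Suc i), k + 2 := i, k + 1 := ?q))) 1
       (layout A ((?R (Suc i))(k + 1 := ?q)))"
      using exec_inc[of "k + 2" A "r(k := ?S (Suc i), k + 2 := i, k + 1 := ?q)"]
      by (simp add: fun_upd_twist)
    show "exec ?c (layout A ((?R i)(k + 1 := ?q))) (Suc (?G + Suc (Suc (?G * 4) + 1)))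
       (layout A ((?R (Suc i))(k + 1 := ?q)))"
      by (intro exec_Seq[OF 3(2)] exec_Seq[OF 4] 5)
  qed (use 0 in \<open>auto simp: fun_eq_iff\<close>)
  have 3: "exec (repeat (k + 2) Skip) (layout A (r(k := ?S ?a, k + 2 := ?a))) (Suc (?a * 4))
      (layout A (r(k := ?S ?a)))"
    using exec_clear[of "k + 2" A "r(k := ?S ?a, k + 2 := ?a)"] 0
    by (simp add: fun_upd_idem)
  have "exec (compile \<rho> k (Sum v a b)) (layout A r)
     (Suc (f N + Suc (Suc (?a * (Suc (?G + Suc (Suc (?G * 4) + 1)) + 3)) + Suc (?a * 4))))
     (layout A (r(k := ?S ?a)))"
    unfolding compile.simps by (intro exec_Seq[OF 1(2)] exec_Seq[OF 2] 3)
  moreover have "Suc (f N + Suc (Suc (?a * (Suc (?G + Suc (Suc (?G * 4) + 1)) + 3)) + Suc (?a * 4))) \<le> h N"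
  proof -
    have "?a * (Suc (?G + Suc (Suc (?G * 4) + 1)) + 3) \<le> f N * (10 * ?G + 20)"
      by (rule mult_le_mono[OF 1(1)]) simp
    then show ?thesis using 1(1) unfolding h_def by linarith
  qed
  ultimately have "exec (compile \<rho> k (Sum v a b)) (layout A r) (h N) (layout A (r(k := ?S ?a)))"
    by (rule exec_mono)
  moreover have "?S ?a \<le> h N"
  proof -
    have "?b i \<le> ?G" if i: "i < ?a" for i
    proof (rule compilesD[OF assms(4), where A = A and r = "r(k := 0, k + 2 := i)", THEN conjunct1])
      show "length (W b) \<le> N + f N" for b using A by (simp add: trans_le_add1)
      show "(r(k := 0, k + 2 := i)) ((\<rho>(v := k + 2)) v') = (s(v := i)) v'" for v'
        using r ne[of v'] by auto
      show "(s(v := i)) v' \<le> N + f N" for v' using r i 1(1) by (simp add: trans_le_add1)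
    qed (use A 0 in auto)
    then have "?S ?a \<le> (\<Sum>i<?a. ?G)" by (intro sum_mono) blast
    then have "?S ?a \<le> ?a * ?G" by simp
    also have "\<dots> \<le> f N * (10 * ?G + 20)" by (rule mult_le_mono[OF 1(1)]) simp
    finally show ?thesis unfolding h_def by linarith
  qed
  ultimately show "eval W s (Sum v a b) \<le> h N \<and>
     exec (compile \<rho> k (Sum v a b)) (layout A r) (h N) (layout A (r(k := eval W s (Sum v a b))))"
    by simp
qed

lemma read_word_tape: "read_tape (fst (word_tape w), int i) = symbol w i"
  by (simp add: read_tape_def word_tape_def symbol_def)

lemma word_tape_eq: "word_tape w = (fst (word_tape w), 0)"
  by (simp add: word_tape_def)

lemma compiles_Sym:
  assumes "\<And>v. \<rho> v < k" "compiles \<rho> k a f"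
  shows "compiles \<rho> k (Sym c a) (\<lambda>N. 15 * f N + 20)"
  unfolding compiles_def
proof (intro allI impI)
  fix A :: tapes and W and r :: "nat \<Rightarrow> nat" and N s
  assume A: "\<forall>b. A (input_tape b) = word_tape (W b) \<and> length (W b) \<le> N"
    and r: "\<forall>v. r (\<rho> v) = s v \<and> s v \<le> N" and 0: "\<forall>j\<ge>k. r j = 0"
  let ?a = "eval W s a" and ?t = "input_tape c" and ?g = "fst (word_tape (W c))"
  let ?v = "symbol (W c) ?a"
  have "?a \<le> f N \<and> exec (compile \<rho> k a) (layout A r) (f N) (layout A (r(k := ?a)))"
    by (rule compilesD[OF assms(2)]) (use A r 0 in auto)
  then have 1: "?a \<le> f N" "exec (compile \<rho> k a) (layout A r) (f N) (layout A (r(k := ?a)))"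
    by simp_all
  let ?A = "\<lambda>i. A(?t := (?g, int i))"
  have A0: "?A 0 = A" using A word_tape_eq[of "W c"] by (auto simp: fun_eq_iff)
  have 2: "exec (repeat k (inc (k + 1) ;; Move ?t Move_Right)) (layout (?A 0) (r(k := ?a)))
     (Suc (?a * (Suc (1 + 1) + 3))) (layout (?A ?a) (r(k + 1 := ?a)))"
  proof (rule exec_repeat[where A = ?A and r = "\<lambda>i. r(k + 1 := i)"])
    fix i
    let ?r = "\<lambda>i'. (r(k + 1 := i'))(k := ?a - Suc i)"
    have 3: "exec (inc (k + 1)) (layout (?A i) (?r i)) 1 (layout (?A i) (?r (Suc i)))"
      using exec_inc[of "k + 1" "?A i" "?r i"] by (simp add: fun_upd_twist)
    have 4: "exec (Move ?t Move_Right) (layout (?A i) (?r (Suc i))) 1 (layout (?A (Suc i)) (?r (Suc i)))"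
      using exec_Move_tape[of ?t Move_Right "?A i" "?r (Suc i)"] by (simp add: add.commute)
    show "exec (inc (k + 1) ;; Move ?t Move_Right) (layout (?A i) (?r i)) (Suc (1 + 1))
       (layout (?A (Suc i)) (?r (Suc i)))"
      by (rule exec_Seq[OF 3 4])
  qed (use 0 in \<open>auto simp: fun_eq_iff\<close>)
  let ?r = "r(k + 1 := ?a)"
  have rd: "read_tape (layout (?A ?a) ?r ?t) = ?v"
    using read_word_tape[of "W c" ?a] by simp
  have v: "?v = 0 \<or> ?v = 1 \<or> ?v = 2" by (auto simp: symbol_def bit_symbol_def)
  have 3: "exec (Test ?t 1 (inc k) (Test ?t 2 (inc k ;; inc k) Skip)) (layout (?A ?a) ?r) 5
      (layout (?A ?a) (?r(k := ?v)))"
  proof -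
    consider "?v = 0" | "?v = 1" | "?v = 2" using v by argo
    then show ?thesis
    proof cases
      case 1
      have "exec (Test ?t 1 (inc k) (Test ?t 2 (inc k ;; inc k) Skip)) (layout (?A ?a) ?r) (Suc (Suc 1))
          (layout (?A ?a) ?r)"
        by (intro exec_Test_neq exec_Skip; simp only: rd 1)
      then show ?thesis using 1 0 by (auto intro: exec_mono simp: fun_upd_idem)
    next
      case 2
      have "exec (Test ?t 1 (inc k) (Test ?t 2 (inc k ;; inc k) Skip)) (layout (?A ?a) ?r) (Suc 1)
          (layout (?A ?a) (?r(k := Suc (?r k))))"
        by (intro exec_Test_eq exec_inc; simp only: rd 2)
      then show ?thesis using 2 0 by (auto intro: exec_mono)
    next
      case 3
      have "exec (Test ?t 1 (inc k) (Test ?t 2 (inc k ;; inc k) Skip)) (layout (?A ?a) ?r)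
          (Suc (Suc (Suc (1 + 1))))
          (layout (?A ?a) ((?r(k := Suc (?r k)))(k := Suc ((?r(k := Suc (?r k))) k))))"
        by (rule exec_Test_neq, unfold rd 3, simp, rule exec_Test_eq, unfold rd 3, rule refl,
            rule exec_Seq[OF exec_inc exec_inc])
      then show ?thesis using 3 0 by (auto intro: exec_mono simp: numeral_2_eq_2)
    qed
  qed
  have 4: "exec (repeat (k + 1) (Move ?t Move_Left)) (layout (?A ?a) (?r(k := ?v))) (Suc (?a * 4))
      (layout A (r(k := ?v)))"
  proof -
    have "?r(k := ?v, k + 1 := 0) = r(k := ?v)" using 0 by (auto simp: fun_eq_iff)
    then show ?thesis
      using exec_rewind[of ?t "?A ?a" ?g "?r(k := ?v)" "k + 1" 0] A0 by simp
  qed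
  have "exec (compile \<rho> k (Sym c a)) (layout A r)
     (Suc (f N + Suc (Suc (?a * (Suc (1 + 1) + 3)) + Suc (5 + Suc (?a * 4))))) (layout A (r(k := ?v)))"
    unfolding compile.simps by (intro exec_Seq[OF 1(2)] exec_Seq[OF 2[unfolded A0]] exec_Seq[OF 3] 4)
  then have "exec (compile \<rho> k (Sym c a)) (layout A r) (15 * f N + 20) (layout A (r(k := ?v)))"
    by (rule exec_mono) (use 1(1) in simp)
  then show "eval W s (Sym c a) \<le> 15 * f N + 20 \<and>
     exec (compile \<rho> k (Sym c a)) (layout A r) (15 * f N + 20) (layout A (r(k := eval W s (Sym c a))))"
    using v by auto
qed

lemma compiles_Len: "compiles \<rho> k (Len c) (\<lambda>N. 15 * N + 20)"
  unfolding compiles_def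
proof (intro allI impI)
  fix A :: tapes and W and r :: "nat \<Rightarrow> nat" and N s
  assume A: "\<forall>b. A (input_tape b) = word_tape (W b) \<and> length (W b) \<le> N"
    and 0: "\<forall>j\<ge>k. r j = 0"
  let ?t = "input_tape c" and ?g = "fst (word_tape (W c))" and ?n = "length (W c)"
  let ?A = "\<lambda>i. A(?t := (?g, int i))" and ?r = "\<lambda>i. (r :: nat \<Rightarrow> nat)(k := i, k + 1 := i)"
  have n: "?n \<le> N" using A by blast
  have A0: "?A 0 = A" using A word_tape_eq[of "W c"] by (auto simp: fun_eq_iff)
  have r0: "?r 0 = r" using 0 by (auto simp: fun_eq_iff)
  have 1: "exec (While ?t 0 (inc k ;; inc (k + 1) ;; Move ?t Move_Right)) (layout (?A 0) (?r 0))
     (Suc (?n * Suc (Suc (1 + Suc (1 + 1))))) (layout (?A ?n) (?r ?n))"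
  proof (rule exec_While_iterate[where \<sigma> = "\<lambda>i. layout (?A i) (?r i)"])
    fix i assume i: "i < ?n"
    show "read_tape (layout (?A i) (?r i) ?t) \<noteq> 0"
      using read_word_tape[of "W c" i] i by (simp add: symbol_def bit_symbol_def)
    have 3: "exec (inc k) (layout (?A i) (?r i)) 1 (layout (?A i) (r(k := Suc i, k + 1 := i)))"
      using exec_inc[of k "?A i" "?r i"] by (simp add: fun_upd_twist)
    have 4: "exec (inc (k + 1)) (layout (?A i) (r(k := Suc i, k + 1 := i))) 1
       (layout (?A i) (?r (Suc i)))"
      using exec_inc[of "k + 1" "?A i" "r(k := Suc i, k + 1 := i)"] by simp
    have 5: "exec (Move ?t Move_Right) (layout (?A i) (?r (Suc i))) 1 (layout (?A (Suc i)) (?r (Suc i)))"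
      using exec_Move_tape[of ?t Move_Right "?A i" "?r (Suc i)"] by (simp add: add.commute)
    show "exec (inc k ;; inc (k + 1) ;; Move ?t Move_Right) (layout (?A i) (?r i))
        (Suc (1 + Suc (1 + 1))) (layout (?A (Suc i)) (?r (Suc i)))"
      by (intro exec_Seq[OF 3] exec_Seq[OF 4] 5)
  next
    show "read_tape (layout (?A ?n) (?r ?n) ?t) = 0"
      using read_word_tape[of "W c" ?n] by (simp add: symbol_def)
  qed
  have 2: "exec (repeat (k + 1) (Move ?t Move_Left)) (layout (?A ?n) (?r ?n)) (Suc (?n * 4))
      (layout A (r(k := ?n)))"
  proof -
    have "(?r ?n)(k + 1 := 0) = r(k := ?n)" using 0 by (auto simp: fun_eq_iff)
    then show ?thesis
      using exec_rewind[of ?t "?A ?n" ?g "?r ?n" "k + 1" 0] A0 by simp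
  qed
  have "exec (compile \<rho> k (Len c)) (layout A r)
     (Suc (Suc (?n * Suc (Suc (1 + Suc (1 + 1)))) + Suc (?n * 4))) (layout A (r(k := ?n)))"
    unfolding compile.simps by (rule exec_Seq[OF 1[unfolded A0 r0] 2])
  then have "exec (compile \<rho> k (Len c)) (layout A r) (15 * N + 20) (layout A (r(k := ?n)))"
    by (rule exec_mono) (use n in simp)
  then show "eval W s (Len c) \<le> 15 * N + 20 \<and>
     exec (compile \<rho> k (Len c)) (layout A r) (15 * N + 20) (layout A (r(k := eval W s (Len c))))"
    using n by simp
qed

text \<open>\<open>\<rho>\<close> and \<open>k\<close> vary in the induction because a sum binds its
  variable to a new counter and evaluates its body with later counters. For a fixed expression, the
  nesting composes finitely many polynomial bounds.\<close>

lemma compile_poly_time: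
  "(\<And>v. \<rho> v < k) \<Longrightarrow> \<exists>f. poly_bounded f \<and> compiles \<rho> k e f"
proof (induction e arbitrary: \<rho> k)
  case (Const n)
  show ?case using compiles_Const[of \<rho> k n] poly_bounded_const[of "Suc (2 * n)"] by blast
next
  case (Var v)
  have "poly_bounded (\<lambda>N. 10 * N + 10)"
    by (intro poly_bounded_add poly_bounded_mult poly_bounded_const poly_bounded_id)
  moreover have "compiles \<rho> k (Var v) (\<lambda>N. 10 * N + 10)"
    by (rule compiles_Var) (rule Var)
  ultimately show ?case by blast
next
  case (Add a b)
  have 1: "\<rho> v < k + 1" for v using Add.prems[of v] by simp
  obtain f where f: "poly_bounded f" "compiles \<rho> k a f"
    using Add.IH(1)[of \<rho> k] Add.prems by blast
  obtain g where g: "poly_bounded g" "compiles \<rho> (k + 1) b g"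
    using Add.IH(2)[of \<rho> "k + 1"] 1 by blast
  have "poly_bounded (\<lambda>N. f N + 5 * g N + 10)"
    by (intro poly_bounded_add poly_bounded_mult poly_bounded_const f(1) g(1))
  moreover have "compiles \<rho> k (Add a b) (\<lambda>N. f N + 5 * g N + 10)"
    by (rule compiles_Add[OF _ f(2) g(2)]) (rule Add.prems)
  ultimately show ?case by blast
next
  case (Sub a b)
  have 1: "\<rho> v < k + 1" for v using Sub.prems[of v] by simp
  obtain f where f: "poly_bounded f" "compiles \<rho> k a f"
    using Sub.IH(1)[of \<rho> k] Sub.prems by blast
  obtain g where g: "poly_bounded g" "compiles \<rho> (k + 1) b g"
    using Sub.IH(2)[of \<rho> "k + 1"] 1 by blast
  have "poly_bounded (\<lambda>N. f N + 6 * g N + 10)"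
    by (intro poly_bounded_add poly_bounded_mult poly_bounded_const f(1) g(1))
  moreover have "compiles \<rho> k (Sub a b) (\<lambda>N. f N + 6 * g N + 10)"
    by (rule compiles_Sub[OF _ f(2) g(2)]) (rule Sub.prems)
  ultimately show ?case by blast
next
  case (Sum v a b)
  have 1: "\<rho> v' < k + 1" "(\<rho>(v := k + 2)) v' < k + 3" for v'
    using Sum.prems[of v'] by auto
  obtain f where f: "poly_bounded f" "compiles \<rho> (k + 1) a f"
    using Sum.IH(1)[of \<rho> "k + 1"] 1(1) by blast
  obtain g where g: "poly_bounded g" "compiles (\<rho>(v := k + 2)) (k + 3) b g"
    using Sum.IH(2)[of "\<rho>(v := k + 2)" "k + 3"] 1(2) by blast
  have "poly_bounded (\<lambda>N. g (N + f N))"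
    by (rule poly_bounded_comp[OF g(1)]) (intro poly_bounded_add poly_bounded_id f(1))
  then have "poly_bounded (\<lambda>N. 10 * f N + f N * (10 * g (N + f N) + 20) + 20)"
    by (intro poly_bounded_add poly_bounded_mult poly_bounded_const f(1))
  moreover have "compiles \<rho> k (Sum v a b) (\<lambda>N. 10 * f N + f N * (10 * g (N + f N) + 20) + 20)"
    by (rule compiles_Sum[OF _ f(2) g(2)]) (rule Sum.prems)
  ultimately show ?case by blast
next
  case (Sym b a)
  obtain f where f: "poly_bounded f" "compiles \<rho> k a f"
    using Sym.IH[of \<rho> k] Sym.prems by blast
  have "poly_bounded (\<lambda>N. 15 * f N + 20)"
    by (intro poly_bounded_add poly_bounded_mult poly_bounded_const f(1))
  moreover have "compiles \<rho> k (Sym b a) (\<lambda>N. 15 * f N + 20)"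
    by (rule compiles_Sym[OF _ f(2)]) (rule Sym.prems)
  ultimately show ?case by blast
next
  case (Len b)
  have "poly_bounded (\<lambda>N. 15 * N + 20)"
    by (intro poly_bounded_add poly_bounded_mult poly_bounded_const poly_bounded_id)
  then show ?case using compiles_Len[of \<rho> k b] by blast
qed

text \<open>Only tested tapes are counted, as these are what \<open>com_ok\<close> restricts. A
  machine is then given at least this many tapes, whatever counters a compiled expression
  occupies.\<close>

fun com_bound :: "com \<Rightarrow> nat" where
  "com_bound (c ;; d) = max (com_bound c) (com_bound d)"
| "com_bound (Test \<tau> a c d) = max (Suc \<tau>) (max (com_bound c) (com_bound d))"
| "com_bound (While \<tau> a c) = max (Suc \<tau>) (com_bound c)"
| "com_bound _ = 0"

fun writes_ok :: "com \<Rightarrow> bool" where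
  "writes_ok (c ;; d) \<longleftrightarrow> writes_ok c \<and> writes_ok d"
| "writes_ok (Test \<tau> a c d) \<longleftrightarrow> writes_ok c \<and> writes_ok d"
| "writes_ok (While \<tau> a c) \<longleftrightarrow> writes_ok c"
| "writes_ok (Write \<tau> a) \<longleftrightarrow> a < 3"
| "writes_ok _ \<longleftrightarrow> True"

lemma com_okI: "writes_ok c \<Longrightarrow> com_bound c \<le> K \<Longrightarrow> com_ok K c"
  by (induction c) auto

lemma writes_ok_increase: "writes_ok (increase k n)"
  by (induction n) (auto simp: inc_def)

lemma writes_ok_compile: "writes_ok (compile \<rho> k e)"
  by (induction e arbitrary: \<rho> k) (auto simp: writes_ok_increase inc_def dec_def repeat_def)


section \<open>Computable functions of an input and several numbers\<close>

text \<open>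
  Here \<open>c\<close> consists of the input and the values of the variables; \<open>W\<close> and the list \<open>\<Gamma>\<close> select the input
  words and the single values. A variable is numbered by its distance from the end of \<open>\<Gamma>\<close>, so that
  adding a variable at the front does not change the numbers of the others.
\<close>

definition computable ::
    "('c \<Rightarrow> bool \<Rightarrow> bool list) \<Rightarrow> ('c \<Rightarrow> nat) list \<Rightarrow> ('c \<Rightarrow> nat) \<Rightarrow> bool" where
  "computable W \<Gamma> F \<longleftrightarrow>
    (\<exists>e. \<forall>c s. (\<forall>j<length \<Gamma>. s j = (rev \<Gamma> ! j) c) \<longrightarrow> eval (W c) s e = F c)"

definition decidable ::
    "('c \<Rightarrow> bool \<Rightarrow> bool list) \<Rightarrow> ('c \<Rightarrow> nat) list \<Rightarrow> ('c \<Rightarrow> bool) \<Rightarrow> bool" where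
  "decidable W \<Gamma> P \<longleftrightarrow> computable W \<Gamma> (\<lambda>c. of_bool (P c))"

abbreviation extend :: "('c \<Rightarrow> nat) list \<Rightarrow> (nat \<times> 'c \<Rightarrow> nat) list" where
  "extend \<Gamma> \<equiv> fst # map (\<lambda>g p. g (snd p)) \<Gamma>"

lemma computable_const: "computable W \<Gamma> (\<lambda>c. n)"
  unfolding computable_def by (rule exI[of _ "Const n"]) simp

lemma computable_add:
  assumes "computable W \<Gamma> F" "computable W \<Gamma> G"
  shows "computable W \<Gamma> (\<lambda>c. F c + G c)"
proof -
  obtain a b where "\<forall>c s. (\<forall>j<length \<Gamma>. s j = (rev \<Gamma> ! j) c) \<longrightarrow> eval (W c) s a = F c"
    "\<forall>c s. (\<forall>j<length \<Gamma>. s j = (rev \<Gamma> ! j) c) \<longrightarrow> eval (W c) s b = G c"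
    using assms unfolding computable_def by blast
  then show ?thesis unfolding computable_def by (intro exI[of _ "Add a b"]) simp
qed

lemma computable_sub:
  assumes "computable W \<Gamma> F" "computable W \<Gamma> G"
  shows "computable W \<Gamma> (\<lambda>c. F c - G c)"
proof -
  obtain a b where "\<forall>c s. (\<forall>j<length \<Gamma>. s j = (rev \<Gamma> ! j) c) \<longrightarrow> eval (W c) s a = F c"
    "\<forall>c s. (\<forall>j<length \<Gamma>. s j = (rev \<Gamma> ! j) c) \<longrightarrow> eval (W c) s b = G c"
    using assms unfolding computable_def by blast
  then show ?thesis unfolding computable_def by (intro exI[of _ "Sub a b"]) simp
qed

lemma computable_symbol:
  assumes "computable W \<Gamma> F"
  shows "computable W \<Gamma> (\<lambda>c. symbol (W c b) (F c))"
proof -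
  obtain a where "\<forall>c s. (\<forall>j<length \<Gamma>. s j = (rev \<Gamma> ! j) c) \<longrightarrow> eval (W c) s a = F c"
    using assms unfolding computable_def by blast
  then show ?thesis unfolding computable_def by (intro exI[of _ "Sym b a"]) simp
qed

lemma computable_length: "computable W \<Gamma> (\<lambda>c. length (W c b))"
  unfolding computable_def by (rule exI[of _ "Len b"]) simp

lemma computable_var: "g \<in> set \<Gamma> \<Longrightarrow> computable W \<Gamma> g"
proof -
  assume "g \<in> set \<Gamma>"
  then obtain j where "j < length \<Gamma>" "rev \<Gamma> ! j = g"
    by (metis in_set_conv_nth length_rev set_rev)
  then show ?thesis unfolding computable_def by (intro exI[of _ "Var j"]) auto
qed

lemma computable_fst: "computable W (extend \<Gamma>) (\<lambda>p. fst p)"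
  using computable_var[of fst "extend \<Gamma>" W] by simp

lemma computable_weaken:
  assumes "computable W \<Gamma> F"
  shows "computable (\<lambda>p. W (snd p)) (extend \<Gamma>) (\<lambda>p. F (snd p))"
proof -
  obtain a where a: "\<And>c s. (\<forall>j<length \<Gamma>. s j = (rev \<Gamma> ! j) c) \<Longrightarrow> eval (W c) s a = F c"
    using assms unfolding computable_def by blast
  have "eval (W (snd p)) s a = F (snd p)"
    if "\<forall>j<length (extend \<Gamma>). s j = (rev (extend \<Gamma>) ! j) p" for p s
  proof (rule a)
    show "\<forall>j<length \<Gamma>. s j = (rev \<Gamma> ! j) (snd p)"
      using that by (auto simp: nth_append rev_map less_Suc_eq)
  qed
  then show ?thesis unfolding computable_def by blast
qed

lemma computable_sum:
  assumes "computable W \<Gamma> N"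
    and "computable (\<lambda>p. W (snd p)) (extend \<Gamma>) (\<lambda>p. G (fst p) (snd p))"
  shows "computable W \<Gamma> (\<lambda>c. \<Sum>i<N c. G i c)"
proof -
  obtain a where a: "\<And>c s. (\<forall>j<length \<Gamma>. s j = (rev \<Gamma> ! j) c) \<Longrightarrow> eval (W c) s a = N c"
    using assms(1) unfolding computable_def by blast
  obtain b where b: "\<And>p s. (\<forall>j<length (extend \<Gamma>). s j = (rev (extend \<Gamma>) ! j) p) \<Longrightarrow>
      eval (W (snd p)) s b = G (fst p) (snd p)"
    using assms(2) unfolding computable_def by blast
  \<comment> \<open>\<open>length \<Gamma>\<close> is the number of the first entry of
    \<open>extend \<Gamma>\<close>, counted from the end, and it is fresh for
    \<open>\<Gamma>\<close>.\<close>
  have "eval (W c) s (Sum (length \<Gamma>) a b) = (\<Sum>i<N c. G i c)"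
    if s: "\<forall>j<length \<Gamma>. s j = (rev \<Gamma> ! j) c" for c s
  proof -
    have "eval (W c) (s(length \<Gamma> := i)) b = G i c" for i
      using b[of "s(length \<Gamma> := i)" "(i, c)"] s
      by (auto simp: nth_append rev_map less_Suc_eq)
    then show ?thesis using a[OF s] by simp
  qed
  then show ?thesis unfolding computable_def by blast
qed

section \<open>Arithmetic and logic from bounded sums and truncated subtraction\<close>

lemma computable_mult:
  assumes "computable W \<Gamma> F" "computable W \<Gamma> G"
  shows "computable W \<Gamma> (\<lambda>c. F c * G c)"
proof -
  have "computable W \<Gamma> (\<lambda>c. \<Sum>i<F c. G c)"
    by (rule computable_sum[OF assms(1) computable_weaken[OF assms(2)]])
  then show ?thesis by simp
qed

lemma computable_Suc:
  assumes "computable W \<Gamma> F"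
  shows "computable W \<Gamma> (\<lambda>c. Suc (F c))"
  using computable_add[OF computable_const[of W \<Gamma> 1] assms] by simp

lemma computable_of_bool:
  "decidable W \<Gamma> P \<Longrightarrow> computable W \<Gamma> (\<lambda>c. of_bool (P c))"
  unfolding decidable_def .

lemma decidable_le:
  assumes "computable W \<Gamma> F" "computable W \<Gamma> G"
  shows "decidable W \<Gamma> (\<lambda>c. F c \<le> G c)"
proof -
  have "computable W \<Gamma> (\<lambda>c. 1 - (F c - G c))"
    by (intro computable_sub computable_const assms)
  moreover have "(\<lambda>c. 1 - (F c - G c)) = (\<lambda>c. of_bool (F c \<le> G c))" by (auto simp: fun_eq_iff)
  ultimately show ?thesis unfolding decidable_def by simp
qed

lemma decidable_not:
  assumes "decidable W \<Gamma> P"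
  shows "decidable W \<Gamma> (\<lambda>c. \<not> P c)"
proof -
  have "computable W \<Gamma> (\<lambda>c. 1 - of_bool (P c))"
    by (intro computable_sub computable_const computable_of_bool assms)
  moreover have "(\<lambda>c. 1 - of_bool (P c)) = (\<lambda>c. of_bool (\<not> P c) :: nat)" by (auto simp: fun_eq_iff)
  ultimately show ?thesis unfolding decidable_def by simp
qed

lemma decidable_conj:
  assumes "decidable W \<Gamma> P" "decidable W \<Gamma> Q"
  shows "decidable W \<Gamma> (\<lambda>c. P c \<and> Q c)"
proof -
  have "computable W \<Gamma> (\<lambda>c. of_bool (P c) * of_bool (Q c))"
    by (intro computable_mult computable_of_bool assms)
  moreover have "(\<lambda>c. of_bool (P c) * of_bool (Q c)) = (\<lambda>c. of_bool (P c \<and> Q c) :: nat)"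
    by (auto simp: fun_eq_iff)
  ultimately show ?thesis unfolding decidable_def by simp
qed

lemma decidable_disj:
  assumes "decidable W \<Gamma> P" "decidable W \<Gamma> Q"
  shows "decidable W \<Gamma> (\<lambda>c. P c \<or> Q c)"
  using decidable_not[OF decidable_conj[OF decidable_not[OF assms(1)] decidable_not[OF assms(2)]]]
  by simp

lemma decidable_imp:
  assumes "decidable W \<Gamma> P" "decidable W \<Gamma> Q"
  shows "decidable W \<Gamma> (\<lambda>c. P c \<longrightarrow> Q c)"
  using decidable_disj[OF decidable_not[OF assms(1)] assms(2)] by simp

lemma decidable_iff:
  assumes "decidable W \<Gamma> P" "decidable W \<Gamma> Q"
  shows "decidable W \<Gamma> (\<lambda>c. P c \<longleftrightarrow> Q c)"
proof -
  have "decidable W \<Gamma> (\<lambda>c. (P c \<longrightarrow> Q c) \<and> (Q c \<longrightarrow> P c))"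
    by (intro decidable_conj decidable_imp assms)
  moreover have "(\<lambda>c. (P c \<longrightarrow> Q c) \<and> (Q c \<longrightarrow> P c)) = (\<lambda>c. P c \<longleftrightarrow> Q c)" by (auto simp: fun_eq_iff)
  ultimately show ?thesis by simp
qed

lemma decidable_less:
  assumes "computable W \<Gamma> F" "computable W \<Gamma> G"
  shows "decidable W \<Gamma> (\<lambda>c. F c < G c)"
  using decidable_not[OF decidable_le[OF assms(2,1)]] by (simp add: not_le)

lemma decidable_eq:
  assumes "computable W \<Gamma> F" "computable W \<Gamma> G"
  shows "decidable W \<Gamma> (\<lambda>c. F c = G c)"
proof -
  have "(\<lambda>c. F c \<le> G c \<and> G c \<le> F c) = (\<lambda>c. F c = G c)" by (auto simp: fun_eq_iff)
  then show ?thesis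
    using decidable_conj[OF decidable_le[OF assms] decidable_le[OF assms(2,1)]] by simp
qed

text \<open>A bounded existential quantifier is the positivity of a sum of truth values.\<close>

lemma decidable_ex:
  assumes "computable W \<Gamma> N"
    and "decidable (\<lambda>p. W (snd p)) (extend \<Gamma>) (\<lambda>p. P (fst p) (snd p))"
  shows "decidable W \<Gamma> (\<lambda>c. \<exists>i<N c. P i c)"
proof -
  have "computable W \<Gamma> (\<lambda>c. \<Sum>i<N c. of_bool (P i c))"
    by (rule computable_sum[OF assms(1) computable_of_bool[OF assms(2)]])
  then have "decidable W \<Gamma> (\<lambda>c. 0 < (\<Sum>i<N c. of_bool (P i c) :: nat))"
    by (intro decidable_less computable_const)
  moreover have "(\<lambda>c. 0 < (\<Sum>i<N c. of_bool (P i c) :: nat)) = (\<lambda>c. \<exists>i<N c. P i c)"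
    by (auto simp: fun_eq_iff zero_less_iff_neq_zero sum_eq_0_iff)
  ultimately show ?thesis by simp
qed

lemma decidable_all:
  assumes "computable W \<Gamma> N"
    and "decidable (\<lambda>p. W (snd p)) (extend \<Gamma>) (\<lambda>p. P (fst p) (snd p))"
  shows "decidable W \<Gamma> (\<lambda>c. \<forall>i<N c. P i c)"
  using decidable_not[OF decidable_ex[OF assms(1) decidable_not[OF assms(2)]]] by simp

lemma computable_if:
  assumes "decidable W \<Gamma> P" "computable W \<Gamma> F" "computable W \<Gamma> G"
  shows "computable W \<Gamma> (\<lambda>c. if P c then F c else G c)"
proof -
  have "computable W \<Gamma> (\<lambda>c. of_bool (P c) * F c + of_bool (\<not> P c) * G c)"
    by (intro computable_add computable_mult computable_of_bool decidable_not assms)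
  moreover have "(\<lambda>c. of_bool (P c) * F c + of_bool (\<not> P c) * G c) = (\<lambda>c. if P c then F c else G c)"
    by (auto simp: fun_eq_iff)
  ultimately show ?thesis by simp
qed

lemma decidable_if:
  assumes "decidable W \<Gamma> P" "decidable W \<Gamma> Q" "decidable W \<Gamma> R"
  shows "decidable W \<Gamma> (\<lambda>c. if P c then Q c else R c)"
proof -
  have "decidable W \<Gamma> (\<lambda>c. (P c \<longrightarrow> Q c) \<and> (\<not> P c \<longrightarrow> R c))"
    by (intro decidable_conj decidable_imp decidable_not assms)
  then show ?thesis by (simp add: if_bool_eq_conj)
qed

lemma computable_min:
  "computable W \<Gamma> F \<Longrightarrow> computable W \<Gamma> G \<Longrightarrow> computable W \<Gamma> (\<lambda>c. min (F c) (G c))"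
  unfolding min_def by (intro computable_if decidable_le)

lemma sum_of_bool_less: "(\<Sum>i<a. of_bool (i < n)) = min a n" for a n :: nat
  by (induction a) auto

text \<open>The quotient counts the positive multiples of \<open>b\<close> up to \<open>a\<close>;
  for \<open>b > 0\<close> there are at most \<open>a\<close> of them.\<close>

lemma div_eq_sum: "a div b = (if b = 0 then 0 else \<Sum>i<a. of_bool (Suc i * b \<le> a))" for a b :: nat
proof (cases "b = 0")
  case False
  then have "Suc i * b \<le> a \<longleftrightarrow> i < a div b" for i
    using less_eq_div_iff_mult_less_eq[of b "Suc i" a] by (simp add: Suc_le_eq)
  then show ?thesis using False by (simp only: sum_of_bool_less) simp
qed simp

lemma computable_div:
  assumes "computable W \<Gamma> F" "computable W \<Gamma> G"
  shows "computable W \<Gamma> (\<lambda>c. F c div G c)"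
  unfolding div_eq_sum
  by (intro computable_if decidable_eq computable_const computable_sum computable_of_bool decidable_le
      computable_mult computable_Suc computable_fst computable_weaken assms)

lemma computable_mod:
  assumes "computable W \<Gamma> F" "computable W \<Gamma> G"
  shows "computable W \<Gamma> (\<lambda>c. F c mod G c)"
  unfolding modulo_nat_def by (intro computable_sub computable_mult computable_div assms)

lemma decidable_dvd:
  assumes "computable W \<Gamma> F" "computable W \<Gamma> G"
  shows "decidable W \<Gamma> (\<lambda>c. F c dvd G c)"
  unfolding dvd_eq_mod_eq_0 by (intro decidable_eq computable_mod computable_const assms)

lemma computable_poly:
  "computable W \<Gamma> F \<Longrightarrow> computable W \<Gamma> (\<lambda>c. poly p (F c))"
proof (induction p)
  case 0
  then show ?case by (simp add: computable_const)
next
  case (pCons a p)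
  then show ?case by (simp add: computable_add computable_mult computable_const)
qed

text \<open>On a fixed finite range any function is computable by nested case distinctions. This is
  how the transition function of a machine gets into an expression.\<close>

lemma computable_table_less:
  assumes "computable W \<Gamma> F"
  shows "computable W \<Gamma> (\<lambda>c. if F c < n then f (F c) else 0)"
proof (induction n)
  case 0
  then show ?case by (simp add: computable_const)
next
  case (Suc n)
  have "computable W \<Gamma> (\<lambda>c. if F c = n then f n else if F c < n then f (F c) else 0)"
    by (intro computable_if decidable_eq computable_const assms Suc.IH)
  moreover have "(\<lambda>c. if F c = n then f n else if F c < n then f (F c) else 0) =
      (\<lambda>c. if F c < Suc n then f (F c) else 0)"
    by (auto simp: fun_eq_iff)
  ultimately show ?case by simp
qed

lemma computable_table:
  assumes "computable W \<Gamma> F" "\<And>c. F c < n"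
  shows "computable W \<Gamma> (\<lambda>c. f (F c))"
  using computable_table_less[OF assms(1), of n f] assms(2) by simp

text \<open>The two arguments are packed into the single number
  \<open>F c * m + G c\<close>.\<close>

lemma computable_table2:
  assumes "computable W \<Gamma> F" "computable W \<Gamma> G" "\<And>c. F c < n" "\<And>c. G c < m"
  shows "computable W \<Gamma> (\<lambda>c. f (F c) (G c))"
proof -
  have *: "F c * m + G c < n * m" for c
  proof -
    have "F c * m + G c < Suc (F c) * m" using assms(4)[of c] by simp
    also have "\<dots> \<le> n * m" by (rule mult_le_mono1) (use assms(3)[of c] in simp)
    finally show ?thesis .
  qed
  have "computable W \<Gamma> (\<lambda>c. (\<lambda>z. f (z div m) (z mod m)) (F c * m + G c))"
    by (rule computable_table[OF _ *]) (intro computable_add computable_mult computable_const assms)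
  moreover have "m > 0" using assms(4) gr_zeroI by force
  ultimately show ?thesis using assms(4) by simp
qed


section \<open>Membership in NP\<close>

primrec mark :: "nat \<Rightarrow> com" where
  "mark 0 = Skip"
| "mark (Suc n) = Write (3 + n) 1 ;; mark n"

text \<open>A blank tape becomes a counter with value 0 once cell 0 is marked. The first
  \<open>n\<close> counters are still blank here; those beyond count as marked already, which a
  machine with \<open>3 + n\<close> tapes cannot notice.\<close>

definition unmarked :: "nat \<Rightarrow> tapes \<Rightarrow> tapes" where
  "unmarked n A = (\<lambda>\<tau>. if 3 \<le> \<tau> \<and> \<tau> < 3 + n then word_tape [] else layout A (\<lambda>_. 0) \<tau>)"

lemma exec_mark: "exec (mark n) (unmarked n A) (Suc (2 * n)) (layout A (\<lambda>_. 0))"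
proof (induction n)
  case 0
  have "unmarked 0 A = layout A (\<lambda>_. 0)" by (auto simp: unmarked_def fun_eq_iff)
  then show ?case using exec_Skip[of "layout A (\<lambda>_. 0)"] by simp
next
  case (Suc n)
  have "exec (Write (3 + n) 1) (unmarked (Suc n) A) 1 ((unmarked (Suc n) A)(3 + n :=
     ((fst (unmarked (Suc n) A (3 + n)))(snd (unmarked (Suc n) A (3 + n)) := 1),
      snd (unmarked (Suc n) A (3 + n)))))"
    by (rule exec_Write)
  also have "(unmarked (Suc n) A)(3 + n :=
     ((fst (unmarked (Suc n) A (3 + n)))(snd (unmarked (Suc n) A (3 + n)) := 1),
      snd (unmarked (Suc n) A (3 + n)))) = unmarked n A"
    by (auto simp: unmarked_def fun_eq_iff word_tape_def layout_def counter_def)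
  finally have "exec (mark (Suc n)) (unmarked (Suc n) A) (Suc (1 + Suc (2 * n))) (layout A (\<lambda>_. 0))"
    unfolding mark.simps by (rule exec_Seq[OF _ Suc.IH])
  then show ?case by simp
qed

lemma writes_ok_mark: "writes_ok (mark n)"
  by (induction n) auto

lemma com_bound_mark: "com_bound (mark n) = 0"
  by (induction n) auto

lemma initial_tapes:
  assumes "length ws \<le> 2" "3 \<le> K"
    and "\<And>\<tau>. \<tau> < length ws \<Longrightarrow> A \<tau> = word_tape (ws ! \<tau>)"
    and "\<And>\<tau>. length ws \<le> \<tau> \<Longrightarrow> A \<tau> = word_tape []"
  shows "map word_tape ws @ replicate (K - length ws) (word_tape []) = map (unmarked (K - 3) A) [0..<K]"
  using assms by (intro nth_equalityI) (auto simp: nth_append unmarked_def layout_def)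

text \<open>The machine evaluates the truth value of \<open>P x u\<close> into a counter and rejects
  if it is 0. The time bound holds for all \<open>x\<close> and \<open>u\<close>, so the machine
  also halts on certificates that are longer than \<open>q\<close> allows.\<close>

lemma NP_I:
  assumes dec: "decidable (\<lambda>(x, u) b. if b then u else x) [] (\<lambda>(x, u). P x u)"
    and L: "\<And>x. x \<in> L \<longleftrightarrow> (\<exists>u. length u \<le> poly q (length x) \<and> P x u)"
  shows "L \<in> NP"
proof -
  obtain e where e: "\<And>x u s. eval (\<lambda>b. if b then u else x) s e = of_bool (P x u)"
    using dec by (auto simp: decidable_def computable_def)
  \<comment> \<open>The value of \<open>e\<close> does not depend on \<open>s\<close>, so all
    variables can share counter 0, which stays 0. The result goes to counter 1, that is, to tape
    4.\<close>
  obtain f where f: "poly_bounded f" "compiles (\<lambda>_. 0) 1 e f"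
    using compile_poly_time[of "\<lambda>_. 0" 1 e] by auto
  let ?c = "compile (\<lambda>_. 0) 1 e"
  define K where "K = max 5 (com_bound ?c)"
  define body where "body = mark (K - 3) ;; ?c"
  define prog where "prog = body ;; Test 4 1 Reject Skip"
  have ok: "com_ok K prog"
    by (rule com_okI) (auto simp: prog_def body_def writes_ok_mark writes_ok_compile com_bound_mark K_def)
  have "1 \<le> K" "prog \<noteq> Reject" by (simp_all add: K_def prog_def)
  from com_machine[OF ok this] obtain M where M: "wf_tm M" "num_tapes M = K"
    "\<And>\<sigma> t k \<sigma>'. (com_step ^^ t) ([prog], \<sigma>) = (k, \<sigma>') \<Longrightarrow>
       \<exists>q. tm_run M t (0, map \<sigma> [0..<K]) = (q, map \<sigma>' [0..<K]) \<and>
         (k = [] \<longrightarrow> q = 1) \<and> (k = [Reject] \<longrightarrow> q = 2)"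
    by blast
  have "poly_bounded (\<lambda>N. f N + (2 * K + 10))"
    by (intro poly_bounded_add poly_bounded_const f(1))
  then obtain p where p: "\<And>N. f N + (2 * K + 10) \<le> poly p N"
    unfolding poly_bounded_def by blast
  have run: "halted (tm_run M (poly p (length x + length u)) (initial_config M [x, u])) \<and>
     (accepting (tm_run M (poly p (length x + length u)) (initial_config M [x, u])) \<longleftrightarrow> P x u)" for x u
  proof -
    let ?N = "length x + length u"
    define A where "A = (\<lambda>\<tau>::nat. if \<tau> = 0 then word_tape x else if \<tau> = 1 then word_tape u else word_tape [])"
    let ?\<sigma> = "unmarked (K - 3) A" and ?r = "(\<lambda>_. 0 :: nat)(1 := of_bool (P x u))"
    have init: "initial_config M [x, u] = (0, map ?\<sigma> [0..<K])"
      unfolding initial_config_def M(2)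
      by (subst initial_tapes[of "[x, u]" K A]) (auto simp: A_def K_def less_Suc_eq)
    have "exec ?c (layout A (\<lambda>_. 0)) (f ?N) (layout A ?r)"
    proof -
      have "eval (\<lambda>b. if b then u else x) (\<lambda>_. 0) e \<le> f ?N \<and>
         exec ?c (layout A (\<lambda>_. 0)) (f ?N)
          (layout A ((\<lambda>_. 0)(1 := eval (\<lambda>b. if b then u else x) (\<lambda>_. 0) e)))"
        by (rule compilesD[OF f(2)]) (auto simp: A_def input_tape_def)
      then show ?thesis unfolding e by simp
    qed
    from exec_Seq[OF exec_mark[of "K - 3"] this, folded body_def]
    obtain t where t: "t \<le> Suc (Suc (2 * (K - 3)) + f ?N)"
      "\<And>k. (com_step ^^ t) (body # k, ?\<sigma>) = (k, layout A ?r)"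
      unfolding exec_def by blast
    \<comment> \<open>One step unfolds \<open>prog\<close>, \<open>t\<close> steps execute
      \<open>body\<close>, and two more steps are for the test and the chosen branch.\<close>
    have "(com_step ^^ (2 + t + 1)) ([prog], ?\<sigma>) = (if P x u then [] else [Reject], layout A ?r)"
    proof -
      have "(com_step ^^ (2 + t + 1)) ([prog], ?\<sigma>) =
          com_step (com_step ((com_step ^^ t) (com_step ([prog], ?\<sigma>))))"
        by (simp only: funpow_add) (simp add: numeral_2_eq_2)
      also have "com_step ([prog], ?\<sigma>) = ([body, Test 4 1 Reject Skip], ?\<sigma>)"
        by (simp add: prog_def)
      also have "(com_step ^^ t) ([body, Test 4 1 Reject Skip], ?\<sigma>) = ([Test 4 1 Reject Skip], layout A ?r)"
        by (rule t(2))
      also have "com_step (com_step ([Test 4 1 Reject Skip], layout A ?r)) =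
          (if P x u then [] else [Reject], layout A ?r)"
        using layout_counter[of A ?r 1] by simp
      finally show ?thesis .
    qed
    from M(3)[OF this] init obtain q where q: "tm_run M (2 + t + 1) (initial_config M [x, u]) =
        (q, map (layout A ?r) [0..<K])" "q = (if P x u then 1 else 2)"
      by (auto split: if_splits)
    have "tm_run M (poly p ?N) (initial_config M [x, u]) = tm_run M (2 + t + 1) (initial_config M [x, u])"
    proof (rule tm_run_halted)
      show "halted (tm_run M (2 + t + 1) (initial_config M [x, u]))"
        using q by (simp add: halted_def)
      show "2 + t + 1 \<le> poly p ?N" using t(1) p[of ?N] by linarith
    qed
    then show ?thesis using q by (simp add: halted_def accepting_def)
  qed
  have "num_tapes M \<ge> 2" using M(2) by (simp add: K_def)
  then show ?thesis
    unfolding NP_def mem_Collect_eq using M(1) run L by blast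
qed


section \<open>Polynomial-time computable functions\<close>

text \<open>The numbers are tape symbols: 1 and 2 give the two bits, 0 gives nothing. Positions
  without output permit a simple index range even where positions in the word are awkward to
  compute, as for binary digits.\<close>

definition emit :: "nat \<Rightarrow> bool list" where
  "emit v = (if v = 0 then [] else [v \<noteq> 1])"

definition out_tape :: "bool list \<Rightarrow> tape" where
  "out_tape w = (fst (word_tape w), int (length w))"

lemma out_tape_snoc:
  "((fst (out_tape w))(snd (out_tape w) := bit_symbol b), snd (out_tape w) + 1) = out_tape (w @ [b])"
  by (auto simp: out_tape_def word_tape_def fun_eq_iff nth_append)

text \<open>Tape 5 is counter 2. After one decrement, another test for zero separates the value 1
  from larger ones; what remains is cleared.\<close>

definition emit_com :: com where
  "emit_com = Test 5 1 Skip
     (dec 2 ;; Test 5 1 (Write 2 1) (Write 2 2) ;; Move 2 Move_Right) ;; repeat 2 Skip"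

lemma exec_emit:
  assumes "A 2 = out_tape w"
  shows "exec emit_com (layout A r) (4 * r 2 + 20) (layout (A(2 := out_tape (w @ emit (r 2)))) (r(2 := 0)))"
proof -
  have c: "layout B s 5 = counter (s 2)" for B s
    using layout_counter[of B s 2] by simp
  show ?thesis
  proof (cases "r 2 = 0")
    case True
    have "exec (Test 5 1 Skip (dec 2 ;; Test 5 1 (Write 2 1) (Write 2 2) ;; Move 2 Move_Right))
        (layout A r) (Suc 1) (layout A r)"
      by (rule exec_Test_eq[OF _ exec_Skip]) (simp add: c True)
    from exec_Seq[OF this exec_clear[of 2], folded emit_com_def]
    have "exec emit_com (layout A r) (4 * r 2 + 20) (layout A (r(2 := 0)))"
      by (rule exec_mono) simp
    moreover have "A(2 := out_tape (w @ emit (r 2))) = A"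
      using True assms by (auto simp: emit_def fun_eq_iff)
    ultimately show ?thesis by simp
  next
    case False
    let ?r = "r(2 := r 2 - 1)" and ?b = "r 2 \<noteq> 1"
    let ?A = "A(2 := ((fst (A 2))(snd (A 2) := bit_symbol ?b), snd (A 2)))"
    have 1: "exec (dec 2) (layout A r) 1 (layout A ?r)"
      by (rule exec_dec) (use False in simp)
    have 2: "exec (Test 5 1 (Write 2 1) (Write 2 2)) (layout A ?r) (Suc 1) (layout ?A ?r)"
    proof (cases "r 2 = 1")
      case True
      then show ?thesis
        using exec_Test_eq[of "layout A ?r" 5 1 "Write 2 1", OF _ exec_Write_tape[of 2 1 A ?r]]
        by (simp add: c bit_symbol_def)
    next
      case ne: False
      then show ?thesis
        using exec_Test_neq[of "layout A ?r" 5 1 "Write 2 2", OF _ exec_Write_tape[of 2 2 A ?r]] False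
        by (simp add: c bit_symbol_def)
    qed
    have 3: "exec (Move 2 Move_Right) (layout ?A ?r) 1 (layout (A(2 := out_tape (w @ emit (r 2)))) ?r)"
      using exec_Move_tape[of 2 Move_Right ?A ?r] out_tape_snoc[of w ?b] False assms
      by (simp add: emit_def)
    have "exec (Test 5 1 Skip (dec 2 ;; Test 5 1 (Write 2 1) (Write 2 2) ;; Move 2 Move_Right))
        (layout A r) (Suc (Suc (1 + Suc (Suc 1 + 1)))) (layout (A(2 := out_tape (w @ emit (r 2)))) ?r)"
      by (rule exec_Test_neq[OF _ exec_Seq[OF 1 exec_Seq[OF 2 3]]]) (simp add: c False)
    from exec_Seq[OF this exec_clear[of 2], folded emit_com_def]
    show ?thesis unfolding fun_upd_upd by (rule exec_mono) simp
  qed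
qed

text \<open>The head starts on the blank behind the word, so it first has to move off this blank
  before searching for the blank in front of the word.\<close>

definition home_com :: "nat \<Rightarrow> com" where
  "home_com \<tau> = Move \<tau> Move_Left ;; While \<tau> 0 (Move \<tau> Move_Left) ;; Move \<tau> Move_Right"

lemma exec_home:
  assumes "\<tau> < 3" "A \<tau> = (g, int n)" "g (- 1) = 0" "\<And>i. i < n \<Longrightarrow> g (int i) \<noteq> 0"
  shows "exec (home_com \<tau>) (layout A r) (2 * n + 10) (layout (A(\<tau> := (g, 0))) r)"
proof -
  let ?A = "\<lambda>i. A(\<tau> := (g, int n - 1 - int i))"
  have 1: "exec (Move \<tau> Move_Left) (layout A r) 1 (layout (?A 0) r)"
    using exec_Move_tape[OF assms(1), of Move_Left A r] assms(2) by simp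
  have 2: "exec (While \<tau> 0 (Move \<tau> Move_Left)) (layout (?A 0) r) (Suc (n * Suc 1)) (layout (?A n) r)"
  proof (rule exec_While_iterate[where \<sigma> = "\<lambda>i. layout (?A i) r"])
    fix i assume i: "i < n"
    have "int n - 1 - int i = int (n - 1 - i)" "n - 1 - i < n" using i by auto
    then have "g (int n - 1 - int i) \<noteq> 0" using assms(4) by metis
    then show "read_tape (layout (?A i) r \<tau>) \<noteq> 0"
      using assms(1) by (simp add: read_tape_def)
    show "exec (Move \<tau> Move_Left) (layout (?A i) r) 1 (layout (?A (Suc i)) r)"
      using exec_Move_tape[OF assms(1), of Move_Left "?A i" r] by (simp add: algebra_simps)
  next
    show "read_tape (layout (?A n) r \<tau>) = 0"
      using assms(1,3) by (simp add: read_tape_def)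
  qed
  have 3: "exec (Move \<tau> Move_Right) (layout (?A n) r) 1 (layout (A(\<tau> := (g, 0))) r)"
    using exec_Move_tape[OF assms(1), of Move_Right "?A n" r] by simp
  show ?thesis
    unfolding home_com_def by (rule exec_mono[OF exec_Seq[OF 1 exec_Seq[OF 2 3]]]) simp
qed

text \<open>The output has to be on the first tape, which holds the input during the evaluation;
  therefore the word is collected on tape 2 and copied at the end. \<open>Write 0 0\<close> cuts off
  what is left of a longer input.\<close>

definition copy_com :: com where
  "copy_com =
     While 2 0 (Test 2 1 (Write 0 1) (Write 0 2) ;; Move 2 Move_Right ;; Move 0 Move_Right) ;;
     Write 0 0 ;; home_com 0"

lemma exec_copy:
  assumes "A 0 = word_tape x" "A 2 = word_tape w"
  shows "\<exists>A'. exec copy_com (layout A r) (10 * length w + 20) (layout A' r) \<and>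
    snd (A' 0) = 0 \<and> (\<forall>i. fst (A' 0) (int i) = (if i < length w then bit_symbol (w ! i)
      else if i = length w then 0 else fst (A 0) (int i)))"
proof -
  let ?n = "length w"
  let ?g = "\<lambda>i j. if 0 \<le> j \<and> j < int i then bit_symbol (w ! nat j) else fst (word_tape x) j"
  let ?A = "\<lambda>i. A(0 := (?g i, int i), 2 := (fst (word_tape w), int i))"
  have "?g 0 = fst (word_tape x)" by (auto simp: fun_eq_iff)
  then have A0: "?A 0 = A"
    using assms word_tape_eq[of x] word_tape_eq[of w] by (auto simp: fun_eq_iff)
  have 1: "exec (While 2 0 (Test 2 1 (Write 0 1) (Write 0 2) ;; Move 2 Move_Right ;; Move 0 Move_Right))
      (layout (?A 0) r) (Suc (?n * Suc (Suc (Suc 1 + Suc (1 + 1))))) (layout (?A ?n) r)"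
  proof (rule exec_While_iterate[where \<sigma> = "\<lambda>i. layout (?A i) r"])
    fix i assume i: "i < ?n"
    have rd: "read_tape (layout (?A i) r 2) = bit_symbol (w ! i)"
      using read_word_tape[of w i] i by (simp add: symbol_def)
    then show "read_tape (layout (?A i) r 2) \<noteq> 0" by (simp add: bit_symbol_def)
    let ?B = "(?A i)(0 := ((?g i)(int i := bit_symbol (w ! i)), int i))"
    have 2: "exec (Test 2 1 (Write 0 1) (Write 0 2)) (layout (?A i) r) (Suc 1) (layout ?B r)"
    proof (cases "w ! i")
      case True
      then show ?thesis
        using exec_Test_neq[of "layout (?A i) r" 2 1 "Write 0 2", OF _ exec_Write_tape[of 0 2 "?A i" r]] rd
        by (simp add: bit_symbol_def)
    next
      case False
      then show ?thesis
        using exec_Test_eq[of "layout (?A i) r" 2 1 "Write 0 1", OF _ exec_Write_tape[of 0 1 "?A i" r]] rd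
        by (simp add: bit_symbol_def)
    qed
    let ?C = "?B(2 := (fst (word_tape w), int (Suc i)))"
    have 3: "exec (Move 2 Move_Right) (layout ?B r) 1 (layout ?C r)"
      using exec_Move_tape[of 2 Move_Right ?B r] by (simp add: add.commute)
    have "?C(0 := (fst (?C 0), snd (?C 0) + 1)) = ?A (Suc i)"
      by (auto simp: fun_eq_iff)
    then have 4: "exec (Move 0 Move_Right) (layout ?C r) 1 (layout (?A (Suc i)) r)"
      using exec_Move_tape[of 0 Move_Right ?C r] by (simp only: head_shift.simps)
    show "exec (Test 2 1 (Write 0 1) (Write 0 2) ;; Move 2 Move_Right ;; Move 0 Move_Right)
       (layout (?A i) r) (Suc (Suc 1 + Suc (1 + 1))) (layout (?A (Suc i)) r)"
      by (rule exec_Seq[OF 2 exec_Seq[OF 3 4]])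
  next
    show "read_tape (layout (?A ?n) r 2) = 0"
      using read_word_tape[of w ?n] by (simp add: symbol_def)
  qed
  let ?h = "(?g ?n)(int ?n := 0)"
  let ?D = "(?A ?n)(0 := (?h, int ?n))"
  have 2: "exec (Write 0 0) (layout (?A ?n) r) 1 (layout ?D r)"
    using exec_Write_tape[of 0 0 "?A ?n" r] by simp
  have 3: "exec (home_com 0) (layout ?D r) (2 * ?n + 10) (layout (?D(0 := (?h, 0))) r)"
    by (rule exec_home) (auto simp: word_tape_def bit_symbol_def)
  have "exec copy_com (layout A r) (10 * length w + 20) (layout (?D(0 := (?h, 0))) r)"
    unfolding copy_com_def
    by (rule exec_mono[OF exec_Seq[OF 1[unfolded A0] exec_Seq[OF 2 3]]]) simp
  then show ?thesis
    using assms(1) by (intro exI[of _ "?D(0 := (?h, 0))"]) auto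
qed

text \<open>Counter 0 holds the remaining iterations, counter 1 the index \<open>i\<close> and
  counter 2 the symbol \<open>F i x\<close> to be written.\<close>

lemma polytime_computableI:
  assumes N: "computable (\<lambda>x b. if b then [] else x) [] N"
    and F: "computable (\<lambda>p b. if b then [] else snd p) [fst] (\<lambda>p. F (fst p) (snd p))"
  shows "polytime_computable (\<lambda>x. concat (map (\<lambda>i. emit (F i x)) [0..<N x]))"
proof -
  obtain a where a: "\<And>x s. eval (\<lambda>b. if b then [] else x) s a = N x"
    using N by (auto simp: computable_def)
  obtain e where e: "\<And>x s. eval (\<lambda>b. if b then [] else x) s e = F (s 0) x"
  proof -
    obtain e where e: "\<forall>p s. s 0 = fst p \<longrightarrow>
        eval (\<lambda>b. if b then [] else snd p) s e = F (fst p) (snd p)"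
      using F unfolding computable_def by (auto simp del: split_paired_All)
    have "eval (\<lambda>b. if b then [] else x) s e = F (s 0) x" for x s
      by (rule e[rule_format, of s "(s 0, x)", unfolded fst_conv snd_conv, OF refl])
    then show thesis by (rule that)
  qed
  \<comment> \<open>The value of \<open>e\<close> depends on variable 0 only, so all variables can
    be read from the index in counter 1.\<close>
  let ?\<rho> = "\<lambda>_ :: nat. 1 :: nat"
  obtain f where f: "poly_bounded f" "compiles ?\<rho> 2 a f"
    using compile_poly_time[of ?\<rho> 2 a] by auto
  obtain g where g: "poly_bounded g" "compiles ?\<rho> 2 e g"
    using compile_poly_time[of ?\<rho> 2 e] by auto
  let ?a = "compile ?\<rho> 2 a" and ?e = "compile ?\<rho> 2 e"
  define main where "main = ?a ;; repeat 2 (inc 0) ;; repeat 0 (?e ;; emit_com ;; inc 1) ;;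
    home_com 2 ;; copy_com"
  define K where "K = max 6 (com_bound main)"
  define prog where "prog = mark (K - 3) ;; main"
  have ok: "com_ok K prog"
    by (rule com_okI)
      (auto simp: prog_def main_def writes_ok_mark writes_ok_compile com_bound_mark K_def emit_com_def
        home_com_def copy_com_def repeat_def inc_def dec_def)
  have "1 \<le> K" "prog \<noteq> Reject" by (simp_all add: K_def prog_def)
  from com_machine[OF ok this] obtain M where M: "wf_tm M" "num_tapes M = K"
    "\<And>\<sigma> t k \<sigma>'. (com_step ^^ t) ([prog], \<sigma>) = (k, \<sigma>') \<Longrightarrow>
       \<exists>q. tm_run M t (0, map \<sigma> [0..<K]) = (q, map \<sigma>' [0..<K]) \<and>
         (k = [] \<longrightarrow> q = 1) \<and> (k = [Reject] \<longrightarrow> q = 2)"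
    by blast
  define T where "T n = 2 * K + 50 + 20 * f n + f n * (10 * g (n + f n) + 40)" for n
  have "poly_bounded T"
    unfolding T_def
    by (intro poly_bounded_add poly_bounded_mult poly_bounded_const poly_bounded_id f(1)
        poly_bounded_comp[OF g(1)])
  then obtain p where p: "\<And>n. T n \<le> poly p n"
    unfolding poly_bounded_def by blast
  have run: "halted (tm_run M (poly p (length x)) (initial_config M [x])) \<and>
     has_output (tm_run M (poly p (length x)) (initial_config M [x]))
       (concat (map (\<lambda>i. emit (F i x)) [0..<N x]))" for x
  proof -
    let ?n = "length x" and ?W = "\<lambda>b. if b then [] else x"
    let ?w = "\<lambda>n. concat (map (\<lambda>i. emit (F i x)) [0..<n])"
    let ?G = "g (?n + f ?n)"
    define A where "A = (\<lambda>\<tau>::nat. if \<tau> = 0 then word_tape x else word_tape [])"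
    let ?A = "\<lambda>n. A(2 := out_tape (?w n))"
    let ?z = "\<lambda>_ :: nat. 0 :: nat"
    let ?\<sigma> = "unmarked (K - 3) A"
    have init: "initial_config M [x] = (0, map ?\<sigma> [0..<K])"
      unfolding initial_config_def M(2)
      by (subst initial_tapes[of "[x]" K A]) (auto simp: A_def K_def less_Suc_eq)
    have A0: "?A 0 = A" by (auto simp: A_def out_tape_def word_tape_def fun_eq_iff)
    have "eval ?W ?z a \<le> f ?n \<and> exec ?a (layout A ?z) (f ?n) (layout A (?z(2 := eval ?W ?z a)))"
      by (rule compilesD[OF f(2)]) (auto simp: A_def input_tape_def)
    then have 1: "N x \<le> f ?n" "exec ?a (layout A ?z) (f ?n) (layout A (?z(2 := N x)))"
      unfolding a by simp_all
    have "?z(2 := N x, 0 := N x, 2 := 0) = ?z(0 := N x)" by (auto simp: fun_eq_iff)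
    then have 2: "exec (repeat 2 (inc 0)) (layout A (?z(2 := N x))) (Suc (N x * 4)) (layout A (?z(0 := N x)))"
      using exec_transfer[of 2 0 A "?z(2 := N x)"] by simp
    have bd: "F i x \<le> ?G \<and> exec ?e (layout (?A i) (?z(1 := i, 0 := q))) ?G
        (layout (?A i) (?z(1 := i, 0 := q, 2 := F i x)))" if "i < N x" for i q
    proof -
      have "eval ?W (\<lambda>_. i) e \<le> ?G \<and> exec ?e (layout (?A i) (?z(1 := i, 0 := q))) ?G
        (layout (?A i) (?z(1 := i, 0 := q, 2 := eval ?W (\<lambda>_. i) e)))"
        by (rule compilesD[OF g(2)]) (use that 1(1) in \<open>auto simp: A_def input_tape_def\<close>)
      then show ?thesis unfolding e .
    qed
    have 3: "exec (repeat 0 (?e ;; emit_com ;; inc 1)) (layout (?A 0) (?z(0 := N x)))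
       (Suc (N x * (Suc (?G + Suc ((4 * ?G + 20) + 1)) + 3))) (layout (?A (N x)) (?z(1 := N x)))"
    proof (rule exec_repeat[where A = ?A and r = "\<lambda>i. ?z(1 := i)"])
      fix i assume i: "i < N x"
      let ?q = "N x - Suc i" and ?r = "?z(1 := i, 0 := N x - Suc i, 2 := F i x)"
      have "exec emit_com (layout (?A i) ?r) (4 * ?r 2 + 20)
         (layout ((?A i)(2 := out_tape (?w i @ emit (?r 2)))) (?r(2 := 0)))"
        by (rule exec_emit) simp
      also have "(?A i)(2 := out_tape (?w i @ emit (?r 2))) = ?A (Suc i)"
        by (auto simp: fun_eq_iff)
      also have "?r(2 := 0) = ?z(1 := i, 0 := ?q)" by (auto simp: fun_eq_iff)
      finally have 4: "exec emit_com (layout (?A i) ?r) (4 * ?G + 20) (layout (?A (Suc i)) (?z(1 := i, 0 := ?q)))"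
        by (rule exec_mono) (use bd[OF i] in simp)
      have 5: "exec (inc 1) (layout (?A (Suc i)) (?z(1 := i, 0 := ?q))) 1
         (layout (?A (Suc i)) (?z(1 := Suc i, 0 := ?q)))"
        using exec_inc[of 1 "?A (Suc i)" "?z(1 := i, 0 := ?q)"] by (simp add: fun_upd_twist)
      show "exec (?e ;; emit_com ;; inc 1) (layout (?A i) (?z(1 := i, 0 := ?q)))
         (Suc (?G + Suc ((4 * ?G + 20) + 1))) (layout (?A (Suc i)) (?z(1 := Suc i, 0 := ?q)))"
        by (rule exec_Seq[OF _ exec_Seq[OF 4 5]]) (use bd[OF i] in blast)
    qed (auto simp: fun_eq_iff)
    let ?v = "?w (N x)"
    have lenw: "length (?w n) \<le> n" for n
      by (induction n) (auto simp: emit_def)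
    let ?B = "A(2 := word_tape ?v)"
    have "exec (home_com 2) (layout (?A (N x)) (?z(1 := N x))) (2 * length ?v + 10)
       (layout ((?A (N x))(2 := (fst (word_tape ?v), 0))) (?z(1 := N x)))"
      by (rule exec_home) (auto simp: out_tape_def word_tape_def bit_symbol_def)
    moreover have "(?A (N x))(2 := (fst (word_tape ?v), 0)) = ?B"
      using word_tape_eq[of ?v] by simp
    ultimately have 4: "exec (home_com 2) (layout (?A (N x)) (?z(1 := N x))) (2 * length ?v + 10)
       (layout ?B (?z(1 := N x)))" by simp
    obtain A' where 5: "exec copy_com (layout ?B (?z(1 := N x))) (10 * length ?v + 20) (layout A' (?z(1 := N x)))"
      and A': "snd (A' 0) = 0"
      "\<And>i. i < length ?v \<Longrightarrow> fst (A' 0) (int i) = bit_symbol (?v ! i)" "fst (A' 0) (int (length ?v)) = 0"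
      using exec_copy[of ?B x ?v "?z(1 := N x)"] by (auto simp: A_def)
    have "exec prog ?\<sigma> (Suc (Suc (2 * (K - 3)) + Suc (f ?n + Suc (Suc (N x * 4) +
         Suc (Suc (N x * (Suc (?G + Suc ((4 * ?G + 20) + 1)) + 3)) +
         Suc ((2 * length ?v + 10) + (10 * length ?v + 20)))))))
         (layout A' (?z(1 := N x)))"
      unfolding prog_def main_def
      by (intro exec_Seq[OF exec_mark] exec_Seq[OF 1(2)] exec_Seq[OF 2] exec_Seq[OF 3[unfolded A0]]
          exec_Seq[OF 4] 5)
    moreover have "Suc (Suc (2 * (K - 3)) + Suc (f ?n + Suc (Suc (N x * 4) +
         Suc (Suc (N x * (Suc (?G + Suc ((4 * ?G + 20) + 1)) + 3)) +
         Suc ((2 * length ?v + 10) + (10 * length ?v + 20)))))) \<le> T ?n"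
    proof -
      have "N x * (Suc (?G + Suc ((4 * ?G + 20) + 1)) + 3) \<le> f ?n * (10 * ?G + 40)"
        by (rule mult_le_mono[OF 1(1)]) simp
      then show ?thesis using 1(1) lenw[of "N x"] unfolding T_def by linarith
    qed
    ultimately have "exec prog ?\<sigma> (T ?n) (layout A' (?z(1 := N x)))"
      by (rule exec_mono)
    then obtain t where t: "t \<le> T ?n" "(com_step ^^ t) ([prog], ?\<sigma>) = ([], layout A' (?z(1 := N x)))"
      unfolding exec_def by blast
    from M(3)[OF t(2)] init have q: "tm_run M t (initial_config M [x]) =
        (1, map (layout A' (?z(1 := N x))) [0..<K])"
      by auto
    have "tm_run M (poly p ?n) (initial_config M [x]) = tm_run M t (initial_config M [x])"
    proof (rule tm_run_halted)
      show "halted (tm_run M t (initial_config M [x]))" using q by (simp add: halted_def)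
      show "t \<le> poly p ?n" using t(1) p[of ?n] by linarith
    qed
    moreover have "hd (map (layout A' (?z(1 := N x))) [0..<K]) = A' 0"
      by (simp add: K_def hd_map layout_def)
    ultimately show ?thesis
      using q A' by (auto simp: halted_def has_output_def split: prod.splits)
  qed
  show ?thesis
    unfolding polytime_computable_def Let_def using M(1) run by blast
qed


section \<open>Line graphs given by the end-vertices of the edges\<close>

definition touching :: "(nat \<Rightarrow> nat) \<Rightarrow> (nat \<Rightarrow> nat) \<Rightarrow> nat \<Rightarrow> nat \<Rightarrow> bool" where
  "touching a b i j \<longleftrightarrow> i \<noteq> j \<and> (a i = a j \<or> a i = b j \<or> b i = a j \<or> b i = b j)"

definition line_edges :: "(nat \<Rightarrow> nat) \<Rightarrow> (nat \<Rightarrow> nat) \<Rightarrow> nat \<Rightarrow> nat set set" where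
  "line_edges a b n = {{i, j} | i j. i < n \<and> j < n \<and> touching a b i j}"

lemma touching_sym: "touching a b i j \<longleftrightarrow> touching a b j i"
  by (auto simp: touching_def)

lemma line_edges_iff: "{i, j} \<in> line_edges a b n \<longleftrightarrow> i < n \<and> j < n \<and> touching a b i j"
  using touching_sym by (auto simp: line_edges_def doubleton_eq_iff)

lemma simple_line_edges: "simple_graph ({..<n}, line_edges a b n)"
  by (auto simp: simple_graph_def line_edges_def touching_def)

lemma line_graph_edge_iff:
  "{e, f} \<in> edges (line_graph H) \<longleftrightarrow> e \<in> edges H \<and> f \<in> edges H \<and> e \<noteq> f \<and> e \<inter> f \<noteq> {}"
proof
  assume "{e, f} \<in> edges (line_graph H)"
  then obtain e' f' where "{e, f} = {e', f'}" "e' \<in> edges H" "f' \<in> edges H" "e' \<noteq> f'" "e' \<inter> f' \<noteq> {}"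
    by (auto simp: line_graph_def)
  then show "e \<in> edges H \<and> f \<in> edges H \<and> e \<noteq> f \<and> e \<inter> f \<noteq> {}"
    unfolding doubleton_eq_iff by blast
next
  assume "e \<in> edges H \<and> f \<in> edges H \<and> e \<noteq> f \<and> e \<inter> f \<noteq> {}"
  then show "{e, f} \<in> edges (line_graph H)"
    unfolding line_graph_def snd_conv by blast
qed

text \<open>The root graph has the edges \<open>{a i, b i}\<close>; injectivity excludes parallel
  edges, which a set of edges would merge into one.\<close>

lemma is_line_graph_line_edges:
  assumes "\<And>i. i < n \<Longrightarrow> a i \<noteq> b i" "inj_on (\<lambda>i. {a i, b i}) {..<n}"
  shows "is_line_graph ({..<n}, line_edges a b n)"
proof -
  let ?f = "\<lambda>i. {a i, b i}"
  let ?H = "(a ` {..<n} \<union> b ` {..<n}, ?f ` {..<n}) :: nat graph"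
  have "simple_graph ?H"
    using assms(1) by (auto simp: simple_graph_def)
  moreover have "graph_isomorphic ({..<n}, line_edges a b n) (line_graph ?H)"
    unfolding graph_isomorphic_def
  proof (intro exI[of _ ?f] conjI ballI)
    show "bij_betw ?f (verts ({..<n}, line_edges a b n)) (verts (line_graph ?H))"
      using assms(2) by (simp add: bij_betw_def line_graph_def)
  next
    fix i j assume "i \<in> verts ({..<n}, line_edges a b n)" "j \<in> verts ({..<n}, line_edges a b n)"
    then have ij: "i < n" "j < n" by simp_all
    have ne: "?f i \<noteq> ?f j \<longleftrightarrow> i \<noteq> j" using inj_on_eq_iff[OF assms(2), of i j] ij by simp
    have "{?f i, ?f j} \<in> edges (line_graph ?H) \<longleftrightarrow> ?f i \<noteq> ?f j \<and> ?f i \<inter> ?f j \<noteq> {}"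
      unfolding line_graph_edge_iff snd_conv using ij by blast
    also have "\<dots> \<longleftrightarrow> touching a b i j" unfolding ne by (auto simp: touching_def)
    finally show "{i, j} \<in> edges ({..<n}, line_edges a b n) \<longleftrightarrow> {?f i, ?f j} \<in> edges (line_graph ?H)"
      using ij by (simp add: line_edges_iff)
  qed
  ultimately show ?thesis unfolding is_line_graph_def by blast
qed

lemma bipartite_iff_coloring:
  assumes "simple_graph G"
  shows "bipartite G \<longleftrightarrow> (\<exists>f :: 'a \<Rightarrow> bool. \<forall>u v. {u, v} \<in> edges G \<longrightarrow> f u \<noteq> f v)"
proof
  assume "bipartite G"
  then obtain A B where AB: "A \<inter> B = {}" "A \<union> B = verts G"
    "\<forall>e\<in>edges G. \<exists>a\<in>A. \<exists>b\<in>B. e = {a, b}"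
    unfolding bipartite_def by blast
  have "(u \<in> A) \<noteq> (v \<in> A)" if uv: "{u, v} \<in> edges G" for u v
  proof -
    obtain a b where "a \<in> A" "b \<in> B" "{u, v} = {a, b}" using AB(3) uv by blast
    then show ?thesis using AB(1) by (auto simp: doubleton_eq_iff)
  qed
  then show "\<exists>f :: 'a \<Rightarrow> bool. \<forall>u v. {u, v} \<in> edges G \<longrightarrow> f u \<noteq> f v"
    by (intro exI[of _ "\<lambda>u. u \<in> A"]) blast
next
  assume "\<exists>f :: 'a \<Rightarrow> bool. \<forall>u v. {u, v} \<in> edges G \<longrightarrow> f u \<noteq> f v"
  then obtain f :: "'a \<Rightarrow> bool" where f: "\<forall>u v. {u, v} \<in> edges G \<longrightarrow> f u \<noteq> f v" by blast
  show "bipartite G"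
    unfolding bipartite_def
  proof (intro exI conjI ballI)
    let ?A = "{v \<in> verts G. f v}" and ?B = "{v \<in> verts G. \<not> f v}"
    show "?A \<inter> ?B = {}" "?A \<union> ?B = verts G" by auto
    fix e assume e: "e \<in> edges G"
    then have "e \<subseteq> verts G" "card e = 2" using assms by (auto simp: simple_graph_def)
    then obtain u v where uv: "e = {u, v}" "u \<in> verts G" "v \<in> verts G"
      by (auto simp: card_2_iff)
    then have "f u \<noteq> f v" using f e by blast
    then show "\<exists>a\<in>?A. \<exists>b\<in>?B. e = {a, b}"
      using uv by (cases "f u") (auto simp: insert_commute)
  qed
qed

lemma odd_cycle_transversal_iff_coloring:
  assumes "simple_graph G"
  shows "odd_cycle_transversal G S \<longleftrightarrow> S \<subseteq> verts G \<and>
    (\<exists>f :: 'a \<Rightarrow> bool. \<forall>u v. {u, v} \<in> edges G \<longrightarrow> u \<notin> S \<longrightarrow> v \<notin> S \<longrightarrow> f u \<noteq> f v)"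
proof -
  have "simple_graph (delete_verts G S)"
    using assms by (auto simp: simple_graph_def delete_verts_def)
  then show ?thesis
    unfolding odd_cycle_transversal_def by (simp add: bipartite_iff_coloring delete_verts_def imp_conjL)
qed


section \<open>From satisfiability to edge deletion\<close>

text \<open>
  Every variable has a ring of even length with a third edge at each ring vertex. A budget of
  half the number of ring vertices forces the deleted edges to alternate along each ring, which
  leaves one of two perfect matchings of the ring and thus encodes a truth value. Each literal
  occurrence owns four consecutive ring vertices, of which two adjacent ones are the ports;
  the ports are joined by a remaining ring edge iff the literal is false. The third edges at
  the ports connect the occurrences of a clause cyclically through vertices of degree 2, so a
  clause of odd width with no true literal leaves an odd cycle. All other third edges lead to leaves.
\<close>

definition ring_succ :: "nat \<Rightarrow> nat \<Rightarrow> nat" where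
  "ring_succ L i = i div L * L + (i mod L + 1) mod L"

text \<open>The far end of the third edge at ring vertex \<open>i\<close>. Numbers below
  \<open>R\<close> are ring vertices, \<open>R + i\<close> is a leaf, and the numbers from
  \<open>2 * R\<close> on are the vertices of degree 2, one for each occurrence
  \<open>s = c * w + l\<close>. The first port of occurrence \<open>l\<close> leads to vertex
  \<open>l\<close> of the clause, the second one to vertex \<open>l + 1\<close>, cyclically. The
  sign shifts both ports by one position and so sets the parity of the first.\<close>

definition outer_vertex ::
    "nat \<Rightarrow> nat \<Rightarrow> nat \<Rightarrow> (nat \<Rightarrow> nat \<Rightarrow> nat) \<Rightarrow> (nat \<Rightarrow> nat \<Rightarrow> bool) \<Rightarrow> nat \<Rightarrow> nat" where
  "outer_vertex R L w var sign i =
    (let s = i mod L div 4; r = i mod L mod 4; c = s div w; l = s mod w in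
     if var c l = i div L \<and> r = (if sign c l then 1 else 0) then 2 * R + s
     else if var c l = i div L \<and> r = (if sign c l then 2 else 1) then 2 * R + (c * w + (l + 1) mod w)
     else R + i)"

text \<open>Edges below \<open>R\<close> are ring edges; edge \<open>R + p\<close> is the third edge
  at ring vertex \<open>p\<close>.\<close>

definition root_end1 :: "nat \<Rightarrow> nat \<Rightarrow> nat" where
  "root_end1 R i = (if i < R then i else i - R)"

definition root_end2 ::
    "nat \<Rightarrow> nat \<Rightarrow> nat \<Rightarrow> (nat \<Rightarrow> nat \<Rightarrow> nat) \<Rightarrow> (nat \<Rightarrow> nat \<Rightarrow> bool) \<Rightarrow> nat \<Rightarrow> nat" where
  "root_end2 R L w var sign i =
    (if i < R then ring_succ L i else outer_vertex R L w var sign (i - R))"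

lemma ring_succ_div [simp]: "0 < L \<Longrightarrow> ring_succ L i div L = i div L"
  by (simp add: ring_succ_def)

lemma ring_succ_mod [simp]: "ring_succ L i mod L = (i mod L + 1) mod L"
  by (simp add: ring_succ_def)

lemma ring_succ_less: "i < V * L \<Longrightarrow> ring_succ L i < V * L"
proof -
  assume i: "i < V * L"
  then have "0 < L" by (cases L) auto
  then show ?thesis using i ring_succ_div[of L i] div_less_iff_less_mult[of L] by metis
qed

lemma ring_succ_parity: "even L \<Longrightarrow> odd (ring_succ L i mod L) \<longleftrightarrow> even (i mod L)"
  by (simp add: dvd_mod_iff)

lemma mod_succ_inj:
  fixes x y n :: nat
  assumes "(x + 1) mod n = (y + 1) mod n" "x < n" "y < n"
  shows "x = y"
  using assms by (metis Suc_eq_plus1 Suc_lessI mod_less mod_self nat.inject nat.simps(3))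

lemma ring_succ_inj:
  assumes "0 < L" "ring_succ L i = ring_succ L j"
  shows "i = j"
proof -
  have d: "i div L = j div L" using ring_succ_div[OF assms(1)] assms(2) by metis
  have "(i mod L + 1) mod L = (j mod L + 1) mod L" using ring_succ_mod assms(2) by metis
  then have "i mod L = j mod L" by (rule mod_succ_inj) (use assms(1) in simp_all)
  then show ?thesis using d div_mult_mod_eq by metis
qed

lemma bij_ring_succ: "bij_betw (ring_succ L) {..<V * L} {..<V * L}"
proof -
  have "inj_on (ring_succ L) {..<V * L}"
    by (rule inj_onI, rule ring_succ_inj[of L]) (auto intro: gr0I)
  moreover have "ring_succ L ` {..<V * L} \<subseteq> {..<V * L}" using ring_succ_less by auto
  ultimately show ?thesis
    by (simp add: bij_betw_def endo_inj_surj)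
qed

locale gadget =
  fixes V m w :: nat and var :: "nat \<Rightarrow> nat \<Rightarrow> nat" and sign :: "nat \<Rightarrow> nat \<Rightarrow> bool"
  assumes m_pos: "0 < m" and odd_w: "odd w" and var_less: "\<And>c l. c < m \<Longrightarrow> l < w \<Longrightarrow> var c l < V"
begin

abbreviation "L \<equiv> 4 * (m * w)"
abbreviation "R \<equiv> V * L"
abbreviation "outer \<equiv> outer_vertex R L w var sign"
abbreviation "a \<equiv> root_end1 R"
abbreviation "b \<equiv> root_end2 R L w var sign"

lemma w_pos: "0 < w"
  using odd_w by (auto intro: gr0I)

lemma L_pos: "0 < L"
  using m_pos w_pos by simp

lemma L_ge: "4 \<le> L"
  using m_pos w_pos by (simp add: Suc_leI)

definition port :: "nat \<Rightarrow> nat \<Rightarrow> nat \<Rightarrow> nat" where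
  "port c l r = var c l * L + (4 * (c * w + l) + r)"

abbreviation "in_port c l \<equiv> port c l (if sign c l then 1 else 0)"
abbreviation "out_port c l \<equiv> port c l (if sign c l then 2 else 1)"

lemma slot_less: "c < m \<Longrightarrow> l < w \<Longrightarrow> c * w + l < m * w"
proof -
  assume "c < m" "l < w"
  then have "c * w + l < Suc c * w" by simp
  also have "\<dots> \<le> m * w" using \<open>c < m\<close> by (intro mult_le_mono1) simp
  finally show ?thesis .
qed

context
  fixes c l r :: nat
  assumes c: "c < m" and l: "l < w" and r: "r < 4"
begin

lemma port_mod: "port c l r mod L = 4 * (c * w + l) + r"
  using slot_less[OF c l] r by (simp add: port_def)

lemma port_div: "port c l r div L = var c l"
  using slot_less[OF c l] r L_pos by (simp add: port_def)

lemma port_less: "port c l r < R"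
  using port_div var_less[OF c l] L_pos by (metis div_less_iff_less_mult)

lemma port_slot: "port c l r mod L div 4 = c * w + l" "port c l r mod L mod 4 = r"
proof -
  have "(4 * s + r) div 4 = s" "(4 * s + r) mod 4 = r" for s using r by simp_all
  then show "port c l r mod L div 4 = c * w + l" "port c l r mod L mod 4 = r"
    unfolding port_mod by blast+
qed

lemma slot_div_mod: "(c * w + l) div w = c" "(c * w + l) mod w = l"
  using l by simp_all

end

lemma port_eq:
  assumes "port c l r = port c' l' r'" "c < m" "l < w" "r < 4" "c' < m" "l' < w" "r' < 4"
  shows "c = c' \<and> l = l' \<and> r = r'"
  using assms port_slot slot_div_mod by metis

lemma outer_in:
  assumes "c < m" "l < w"
  shows "outer (in_port c l) = 2 * R + (c * w + l)"
  using port_slot[OF assms, of "if sign c l then 1 else 0"]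
    port_div[OF assms, of "if sign c l then 1 else 0"] slot_div_mod[OF assms(1,2), of 0]
  by (simp add: outer_vertex_def Let_def)

lemma outer_out:
  assumes "c < m" "l < w"
  shows "outer (out_port c l) = 2 * R + (c * w + (l + 1) mod w)"
  using port_slot[OF assms, of "if sign c l then 2 else 1"]
    port_div[OF assms, of "if sign c l then 2 else 1"] slot_div_mod[OF assms(1,2), of 0]
  by (simp add: outer_vertex_def Let_def)

lemma ring_vertex_cases:
  assumes "i < R"
  obtains (In) c l where "c < m" "l < w" "i = in_port c l"
  | (Out) c l where "c < m" "l < w" "i = out_port c l"
  | (Dead) "outer i = R + i"
proof -
  let ?s = "i mod L div 4"
  let ?r = "i mod L mod 4"
  let ?c = "?s div w"
  let ?l = "?s mod w"
  have "i mod L < 4 * (m * w)" using L_pos by simp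
  then have "?s < m * w" by (simp add: div_less_iff_less_mult mult.commute)
  then have c: "?c < m" by (simp add: div_less_iff_less_mult w_pos)
  have l: "?l < w" using w_pos by simp
  have i: "i = port ?c ?l ?r" if "var ?c ?l = i div L"
  proof -
    have "4 * (?c * w + ?l) + ?r = i mod L" by simp
    then show ?thesis unfolding port_def that by (metis div_mult_mod_eq)
  qed
  show thesis
  proof (cases "var ?c ?l = i div L \<and> ?r = (if sign ?c ?l then 1 else 0)")
    case True
    then have "i = port ?c ?l ?r" using i by blast
    also have "?r = (if sign ?c ?l then 1 else 0)" using True by blast
    finally show thesis by (rule In[OF c l])
  next
    case F1: False
    show thesis
    proof (cases "var ?c ?l = i div L \<and> ?r = (if sign ?c ?l then 2 else 1)")
      case True
      then have "i = port ?c ?l ?r" using i by blast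
      also have "?r = (if sign ?c ?l then 2 else 1)" using True by blast
      finally show thesis by (rule Out[OF c l])
    next
      case False
      show thesis
        by (rule Dead) (unfold outer_vertex_def Let_def, simp only: F1 False if_False)
    qed
  qed
qed

lemma port_less_4: "(if sign c l then 1 else 0) < (4::nat)" "(if sign c l then 2 else 1) < (4::nat)"
  by simp_all

lemma ring_succ_in_port:
  assumes "c < m" "l < w"
  shows "ring_succ L (in_port c l) = out_port c l"
proof -
  let ?i = "in_port c l" and ?o = "out_port c l"
  have "(?i mod L + 1) mod L = ?o mod L"
    unfolding port_mod[OF assms port_less_4(1)] port_mod[OF assms port_less_4(2)]
    using slot_less[OF assms] by simp
  then have "ring_succ L ?i mod L = ?o mod L" by simp
  moreover have "ring_succ L ?i div L = ?o div L"
    unfolding ring_succ_div[OF L_pos] port_div[OF assms port_less_4(1)] port_div[OF assms port_less_4(2)] ..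
  ultimately show ?thesis by (metis div_mult_mod_eq)
qed

definition live :: "nat \<Rightarrow> bool" where
  "live i \<longleftrightarrow> (\<exists>c<m. \<exists>l<w. i = in_port c l \<or> i = out_port c l)"

lemma live_mod:
  assumes "live i"
  obtains c l where "c < m" "l < w" "i div L = var c l" "i mod L div 4 = c * w + l"
    "i mod L mod 4 = (if sign c l then 1 else 0) \<or> i mod L mod 4 = (if sign c l then 2 else 1)"
    "i = port c l (i mod L mod 4)"
proof -
  obtain c l where cl: "c < m" "l < w" "i = in_port c l \<or> i = out_port c l"
    using assms unfolding live_def by blast
  then obtain r where r: "i = port c l r" "r < 4"
    "r = (if sign c l then 1 else 0) \<or> r = (if sign c l then 2 else 1)"
    using port_less_4[of c l] by metis
  show thesis
    using that[OF cl(1,2)] r port_slot[OF cl(1,2) r(2)] port_div[OF cl(1,2) r(2)] by simp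
qed

text \<open>Ports have offsets 0 to 2 in their block of four. Offset 3 separates the blocks, so
  ports of different occurrences are never neighbors on a ring.\<close>

lemma live_succ:
  assumes "i < R" "live i" "live (ring_succ L i)"
  shows "\<exists>c<m. \<exists>l<w. i = in_port c l"
proof -
  obtain c l where 1: "c < m" "l < w" "i mod L div 4 = c * w + l"
    "i mod L mod 4 = (if sign c l then 1 else 0) \<or> i mod L mod 4 = (if sign c l then 2 else 1)"
    "i = port c l (i mod L mod 4)"
    using live_mod[OF assms(2)] by metis
  let ?j = "ring_succ L i"
  obtain c' l' where 2: "c' < m" "l' < w" "?j mod L div 4 = c' * w + l'"
    "?j mod L mod 4 = (if sign c' l' then 1 else 0) \<or> ?j mod L mod 4 = (if sign c' l' then 2 else 1)"
    using live_mod[OF assms(3)] by metis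
  have r3: "i mod L mod 4 < 3" using 1(4) by (auto split: if_splits)
  have "i mod L + 1 < L"
  proof -
    have "i mod L < L" using L_pos by simp
    moreover have "i mod L + 1 \<noteq> L"
    proof
      assume "i mod L + 1 = L"
      moreover have "x mod 4 = 3" if "x + 1 = 4 * y" for x y :: nat using that by presburger
      ultimately have "i mod L mod 4 = 3" by blast
      then show False using r3 by simp
    qed
    ultimately show ?thesis by simp
  qed
  then have j: "?j mod L = i mod L + 1" by simp
  have "(x + 1) div 4 = x div 4" "(x + 1) mod 4 = x mod 4 + 1" if "x mod 4 < 3" for x :: nat
    using that by presburger+
  then have "?j mod L div 4 = i mod L div 4" "?j mod L mod 4 = i mod L mod 4 + 1"
    unfolding j using r3 by blast+
  then have s: "c' * w + l' = c * w + l" and r: "?j mod L mod 4 = i mod L mod 4 + 1"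
    using 1(3) 2(3) by simp_all
  have "c' = c" "l' = l"
    using slot_div_mod[OF 1(1,2), of 0] slot_div_mod[OF 2(1,2), of 0] s by simp_all
  then have "i mod L mod 4 = (if sign c l then 1 else 0)"
    using 1(4) 2(4) r by (auto split: if_splits)
  then show ?thesis using 1(1,2,5) by metis
qed

lemma root_ends [simp]:
  "i < R \<Longrightarrow> a i = i" "i < R \<Longrightarrow> b i = ring_succ L i" "a (R + p) = p" "b (R + p) = outer p"
  by (simp_all add: root_end1_def root_end2_def)

lemma outer_ge: "R \<le> outer i"
  by (simp add: outer_vertex_def Let_def)

lemma ring_succ_less_R: "i < R \<Longrightarrow> ring_succ L i < R"
  by (rule ring_succ_less)

lemma edge_cases:
  assumes "i < 2 * R"
  obtains (ring) "i < R" | (outer) p where "p < R" "i = R + p"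
proof (cases "i < R")
  case True
  then show thesis by (rule ring)
next
  case False
  then show thesis using outer[of "i - R"] assms by simp
qed

lemma even_L: "even L"
  by simp

text \<open>Excludes loops and parallel edges on a ring. The first part follows from parity, the
  second needs length at least 4.\<close>

lemma ring_succ_neq: "ring_succ L i \<noteq> i" "ring_succ L (ring_succ L i) \<noteq> i"
proof -
  have "odd (ring_succ L i mod L) \<noteq> odd (i mod L)" by (simp only: ring_succ_parity[OF even_L]) simp
  then show "ring_succ L i \<noteq> i" by metis
  have "((x + 1) mod n + 1) mod n \<noteq> x" if "4 \<le> n" "x < n" for x n :: nat
    using that by (cases "x + 1 < n"; cases "x + 2 < n") (auto simp: mod_if)
  from this[OF L_ge, of "i mod L"] have "ring_succ L (ring_succ L i) mod L \<noteq> i mod L"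
    using L_pos by simp
  then show "ring_succ L (ring_succ L i) \<noteq> i" by metis
qed

text \<open>Ring edges have both ends below \<open>R\<close> and third edges only one, so edges of
  the two kinds are different.\<close>

lemma is_line_graph_gadget: "is_line_graph ({..<2 * R}, line_edges a b (2 * R))"
proof (rule is_line_graph_line_edges)
  fix i assume "i < 2 * R"
  then show "a i \<noteq> b i"
  proof (cases rule: edge_cases)
    case ring
    then show ?thesis using ring_succ_neq(1)[of i] by simp
  next
    case (outer p)
    then show ?thesis using outer_ge[of p] by simp
  qed
next
  show "inj_on (\<lambda>i. {a i, b i}) {..<2 * R}"
  proof (rule inj_onI)
    fix i j assume "i \<in> {..<2 * R}" "j \<in> {..<2 * R}" and eq: "{a i, b i} = {a j, b j}"
    then have ij: "i < 2 * R" "j < 2 * R" by simp_all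
    from ij(1) show "i = j"
    proof (cases rule: edge_cases)
      case i: ring
      from ij(2) show ?thesis
      proof (cases rule: edge_cases)
        case j: ring
        have "{i, ring_succ L i} = {j, ring_succ L j}" using eq i j by simp
        then show ?thesis using ring_succ_neq(2)[of i] by (auto simp: doubleton_eq_iff)
      next
        case (outer q)
        have "{i, ring_succ L i} = {q, outer q}" using eq i outer by simp
        then have "outer q = i \<or> outer q = ring_succ L i" by blast
        then have "outer q < R" using i ring_succ_less_R[OF i] by metis
        then show ?thesis using outer_ge[of q] by simp
      qed
    next
      case i: (outer p)
      from ij(2) show ?thesis
      proof (cases rule: edge_cases)
        case j: ring
        have "{p, outer p} = {j, ring_succ L j}" using eq i j by simp
        then have "outer p = j \<or> outer p = ring_succ L j" by blast
        then have "outer p < R" using j ring_succ_less_R[OF j] by metis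
        then show ?thesis using outer_ge[of p] by simp
      next
        case (outer q)
        have "{p, outer p} = {q, outer q}" using eq i outer by simp
        then have "p = q" using i(1) outer(1) outer_ge[of p] outer_ge[of q] by (auto simp: doubleton_eq_iff)
        then show ?thesis using i outer by simp
      qed
    qed
  qed
qed

section \<open>Truth assignments as alternating deletions along the rings\<close>

definition deleted :: "(nat \<Rightarrow> bool) \<Rightarrow> nat \<Rightarrow> bool" where
  "deleted \<alpha> i \<longleftrightarrow> (odd (i mod L) \<longleftrightarrow> \<alpha> (i div L))"

lemma deleted_succ: "deleted \<alpha> (ring_succ L i) \<longleftrightarrow> \<not> deleted \<alpha> i"
  unfolding deleted_def ring_succ_div[OF L_pos] by (simp only: ring_succ_parity[OF even_L]) auto

text \<open>Blocks start at positions divisible by 4, so the position of a first port is odd exactly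
  for a positive literal.\<close>

lemma deleted_in_port:
  assumes "c < m" "l < w"
  shows "deleted \<alpha> (in_port c l) \<longleftrightarrow> \<alpha> (var c l) = sign c l"
  unfolding deleted_def port_mod[OF assms port_less_4(1)] port_div[OF assms port_less_4(1)]
  by auto

text \<open>Every ring vertex keeps one ring edge. This edge gets the color opposite to the third
  edges at its ends, so these must have equal colors, while the two edges that meet at a clause
  vertex must differ. Colors are assigned by walking around the clause cycle; the walk is cut at a
  true literal, whose ports are not joined, so that odd width causes no conflict.\<close>

lemma transversal_of_assignment:
  assumes sat: "\<And>c. c < m \<Longrightarrow> \<exists>l<w. \<alpha> (var c l) = sign c l"
  shows "\<exists>S. odd_cycle_transversal ({..<2 * R}, line_edges a b (2 * R)) S \<and> card S \<le> R div 2"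
proof -
  let ?S = "{i. i < R \<and> deleted \<alpha> i}"
  define l0 where "l0 c = (SOME l. l < w \<and> \<alpha> (var c l) = sign c l)" for c
  have l0: "l0 c < w" "\<alpha> (var c (l0 c)) = sign c (l0 c)" if "c < m" for c
    using someI_ex[of "\<lambda>l. l < w \<and> \<alpha> (var c l) = sign c l"] sat[OF that] by (auto simp: l0_def)
  \<comment> \<open>Counters along the clause cycle for the third edges at the second port
    (\<open>p\<close>) and the first port (\<open>p'\<close>) of occurrence \<open>l\<close>. At the
    true literal \<open>l0 c\<close> they are 0 and \<open>w\<close>; at all other occurrences they
    agree. From \<open>p\<close> of an occurrence to \<open>p'\<close> of the next one they grow by
    1, hence the parities differ at clause vertices.\<close>
  define p where "p c l = (l + w - l0 c) mod w" for c l
  define p' where "p' c l = (l + w - l0 c - 1) mod w + 1" for c l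
  have p_eq: "p c l = p' c l" if "c < m" "l < w" "l \<noteq> l0 c" for c l
  proof (cases "l < l0 c")
    case True
    then show ?thesis using l0(1)[OF that(1)] that by (simp add: p_def p'_def)
  next
    case False
    then have "l + w - l0 c = (l - l0 c) + w" "l + w - l0 c - 1 = (l - l0 c - 1) + w"
      using that by simp_all
    then have "p c l = (l - l0 c) mod w" "p' c l = (l - l0 c - 1) mod w + 1"
      unfolding p_def p'_def by (simp_all only: mod_add_self2)
    then show ?thesis using that False by simp
  qed
  have p_next: "p' c ((l + 1) mod w) = p c l + 1" if "c < m" "l < w" for c l
  proof (cases "l + 1 = w")
    case True
    then have "l + w - l0 c = (w - l0 c - 1) + w" using l0(1)[OF that(1)] by simp
    then have "p c l = (w - l0 c - 1) mod w" unfolding p_def by (simp only: mod_add_self2)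
    then show ?thesis using True by (simp add: p'_def)
  next
    case False
    then show ?thesis using that by (simp add: p_def p'_def)
  qed
  define \<beta> where "\<beta> i = (let s = i mod L div 4; c = s div w; l = s mod w in
     if i mod L mod 4 = (if sign c l then 1 else 0) then even (p' c l) else even (p c l))" for i
  have \<beta>_in: "\<beta> (in_port c l) = even (p' c l)" if "c < m" "l < w" for c l
    unfolding \<beta>_def Let_def port_slot[OF that port_less_4(1)] slot_div_mod[OF that port_less_4(1)] by simp
  have \<beta>_out: "\<beta> (out_port c l) = even (p c l)" if "c < m" "l < w" for c l
    unfolding \<beta>_def Let_def port_slot[OF that port_less_4(2)] slot_div_mod[OF that port_less_4(2)] by simp
  \<comment> \<open>The common color of the third edges at the two ends of ring edge
    \<open>i\<close>. A port among the ends dictates it; without ports it is arbitrary.\<close>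
  define \<chi> where "\<chi> i = (if live i then \<beta> i else if live (ring_succ L i) then \<beta> (ring_succ L i) else True)" for i
  \<comment> \<open>The ring edge that remains at ring vertex \<open>i\<close>: the outgoing one or,
    if that is deleted, the incoming one.\<close>
  define kept where "kept i = (if deleted \<alpha> i then inv_into {..<R} (ring_succ L) i else i)" for i
  have kept: "kept i = i" "kept (ring_succ L i) = i" if "i < R" "\<not> deleted \<alpha> i" for i
    using that bij_betw_inv_into_left[OF bij_ring_succ[of L V], of i]
    by (auto simp: kept_def deleted_succ)
  have kept_cases: "\<exists>i<R. \<not> deleted \<alpha> i \<and> (q = i \<or> q = ring_succ L i)" if "q < R" for q
  proof (cases "deleted \<alpha> q")
    case True
    have "q \<in> ring_succ L ` {..<R}"
      using that bij_betw_imp_surj_on[OF bij_ring_succ[of L V]] by simp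
    then obtain i where "i < R" "q = ring_succ L i" by auto
    then show ?thesis using True deleted_succ[of \<alpha> i] by blast
  next
    case False
    then show ?thesis using that by blast
  qed
  have \<chi>_live: "\<chi> (kept q) = \<beta> q" if q: "q < R" "live q" for q
  proof -
    obtain i where i: "i < R" "\<not> deleted \<alpha> i" "q = i \<or> q = ring_succ L i"
      using kept_cases[OF q(1)] by blast
    \<comment> \<open>Adjacent ports belong to one occurrence. As the edge between them is kept, its
      literal is false and therefore different from the chosen true one, so \<open>p\<close> and
      \<open>p'\<close> agree.\<close>
    have "\<beta> (ring_succ L i) = \<beta> i" if lv: "live i" "live (ring_succ L i)"
    proof -
      obtain c l where cl: "c < m" "l < w" "i = in_port c l" using live_succ[OF i(1) lv] by blast
      then have "l \<noteq> l0 c" using i(2) deleted_in_port[OF cl(1,2), of \<alpha>] l0(2)[OF cl(1)] by auto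
      then show ?thesis
        using p_eq[OF cl(1,2)] \<beta>_in[OF cl(1,2)] \<beta>_out[OF cl(1,2)] ring_succ_in_port[OF cl(1,2)] cl(3)
        by metis
    qed
    then show ?thesis using i q(2) kept[OF i(1,2)] by (auto simp: \<chi>_def)
  qed
  define col where "col i = (if i < R then \<not> \<chi> i else \<chi> (kept (i - R)))" for i
  have col: "col i = (\<not> \<chi> i)" if "i < R" for i using that by (simp add: col_def)
  have col': "col (R + q) = \<chi> (kept q)" for q by (simp add: col_def)
  have ring_outer: "col i \<noteq> col (R + q)" if "i < R" "\<not> deleted \<alpha> i" "touching a b i (R + q)" "q < R" for i q
  proof -
    have "q = i \<or> q = ring_succ L i"
      using that ring_succ_less_R[OF that(1)] outer_ge[of q] by (auto simp: touching_def)
    then have "kept q = i" using kept[OF that(1,2)] by blast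
    then show ?thesis using that(1) by (simp add: col col')
  qed
  have in_out: "col (R + in_port c l) \<noteq> col (R + out_port c' l')"
    if "c < m" "l < w" "c' < m" "l' < w" "outer (in_port c l) = outer (out_port c' l')" for c l c' l'
  proof -
    define k where "k = (l' + 1) mod w"
    have k: "k < w" using w_pos by (simp add: k_def)
    have "c * w + l = c' * w + k"
      using that(5) unfolding outer_in[OF that(1,2)] outer_out[OF that(3,4)] k_def by linarith
    then have eq: "c = c'" "l = k"
      using slot_div_mod[OF that(1,2), of 0] slot_div_mod[OF that(3) k, of 0] by simp_all
    have "p' c l = p c' l' + 1" unfolding eq k_def by (rule p_next[OF that(3,4)])
    moreover have "live (in_port c l)" "live (out_port c' l')"
      unfolding live_def using that(1-4) by blast+
    then have "col (R + in_port c l) = even (p' c l)" "col (R + out_port c' l') = even (p c' l')"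
      unfolding col' using \<chi>_live[OF port_less[OF that(1,2) port_less_4(1)]]
        \<chi>_live[OF port_less[OF that(3,4) port_less_4(2)]] \<beta>_in[OF that(1,2)] \<beta>_out[OF that(3,4)]
      by blast+
    ultimately show ?thesis by simp
  qed
  have outer_outer: "col (R + q) \<noteq> col (R + q')" if q: "q < R" "q' < R" "q \<noteq> q'" "outer q = outer q'" for q q'
  proof -
    have slot: "2 * R + s \<noteq> R + q" if "q < R" for s q using that by linarith
    from q(1) show ?thesis
    proof (cases rule: ring_vertex_cases)
      case q1: (In c l)
      from q(2) show ?thesis
      proof (cases rule: ring_vertex_cases)
        case (In c' l')
        have "c * w + l = c' * w + l'"
          using q(4) unfolding q1(3) In(3) outer_in[OF q1(1,2)] outer_in[OF In(1,2)] by linarith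
        then have "c = c'" "l = l'"
          using slot_div_mod[OF q1(1,2), of 0] slot_div_mod[OF In(1,2), of 0] by simp_all
        then show ?thesis using q(3) q1(3) In(3) by blast
      next
        case (Out c' l')
        then show ?thesis using in_out[OF q1(1,2) Out(1,2)] q(4) unfolding q1(3) Out(3) by blast
      next
        case Dead
        then show ?thesis using q(4) slot[OF q(2)] unfolding q1(3) outer_in[OF q1(1,2)] by simp
      qed
    next
      case q1: (Out c l)
      from q(2) show ?thesis
      proof (cases rule: ring_vertex_cases)
        case (In c' l')
        then show ?thesis using in_out[OF In(1,2) q1(1,2)] q(4) unfolding q1(3) In(3) by metis
      next
        case (Out c' l')
        define k k' where "k = (l + 1) mod w" "k' = (l' + 1) mod w"
        have k: "k < w" "k' < w" using w_pos by (simp_all add: k_k'_def)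
        have "c * w + k = c' * w + k'"
          using q(4) unfolding q1(3) Out(3) outer_out[OF q1(1,2)] outer_out[OF Out(1,2)] k_k'_def
          by linarith
        then have eq: "c = c'" "k = k'"
          using slot_div_mod[OF q1(1) k(1), of 0] slot_div_mod[OF Out(1) k(2), of 0] by simp_all
        have "l = l'"
          using mod_succ_inj[OF eq(2)[unfolded k_k'_def] q1(2) Out(2)] .
        then show ?thesis using q(3) q1(3) Out(3) eq(1) by blast
      next
        case Dead
        then show ?thesis using q(4) slot[OF q(2)] unfolding q1(3) outer_out[OF q1(1,2)] by simp
      qed
    next
      case q1: Dead
      from q(2) show ?thesis
      proof (cases rule: ring_vertex_cases)
        case (In c' l')
        then show ?thesis using q(4) q1 slot[OF q(1)] unfolding In(3) outer_in[OF In(1,2)] by metis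
      next
        case (Out c' l')
        then show ?thesis using q(4) q1 slot[OF q(1)] unfolding Out(3) outer_out[OF Out(1,2)] by metis
      next
        case Dead
        then show ?thesis using q(3,4) q1 by simp
      qed
    qed
  qed
  have proper: "col i \<noteq> col j"
    if "i < 2 * R" "j < 2 * R" "i \<notin> ?S" "j \<notin> ?S" and t: "touching a b i j" for i j
    using that(1)
  proof (cases rule: edge_cases)
    case i: ring
    then have ni: "\<not> deleted \<alpha> i" using that(3) by simp
    from that(2) show ?thesis
    proof (cases rule: edge_cases)
      case j: ring
      then have nj: "\<not> deleted \<alpha> j" using that(4) by simp
      have "i \<noteq> j" "i = ring_succ L j \<or> ring_succ L i = j \<or> ring_succ L i = ring_succ L j"
        using t i j by (auto simp: touching_def)
      then show ?thesis using ni nj deleted_succ ring_succ_inj[OF L_pos] by metis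
    next
      case (outer q)
      then show ?thesis using ring_outer[OF i ni] t by blast
    qed
  next
    case i: (outer p)
    from that(2) show ?thesis
    proof (cases rule: edge_cases)
      case j: ring
      then have nj: "\<not> deleted \<alpha> j" using that(4) by simp
      show ?thesis using ring_outer[OF j nj] t i touching_sym by metis
    next
      case (outer q)
      have "p \<noteq> q" "p = q \<or> p = outer q \<or> outer p = q \<or> outer p = outer q"
        using t i outer by (auto simp: touching_def)
      then have "outer p = outer q" using i(1) outer(1) outer_ge[of p] outer_ge[of q] by auto
      then show ?thesis using outer_outer[OF i(1) outer(1) \<open>p \<noteq> q\<close>] i outer by blast
    qed
  qed
  have "odd_cycle_transversal ({..<2 * R}, line_edges a b (2 * R)) ?S"
    unfolding odd_cycle_transversal_iff_coloring[OF simple_line_edges]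
  proof (intro conjI exI[of _ col] allI impI)
    show "?S \<subseteq> verts ({..<2 * R}, line_edges a b (2 * R))" by auto
    fix i j assume "{i, j} \<in> edges ({..<2 * R}, line_edges a b (2 * R))" "i \<notin> ?S" "j \<notin> ?S"
    then show "col i \<noteq> col j" using proper by (simp add: line_edges_iff)
  qed
  moreover have "card ?S \<le> R div 2"
  proof -
    \<comment> \<open>A shift along the rings maps the deleted ring edges injectively to kept ones,
      so at most half of them are deleted.\<close>
    let ?T = "{i. i < R \<and> \<not> deleted \<alpha> i}"
    have "ring_succ L ` ?S \<subseteq> ?T" using ring_succ_less_R deleted_succ by auto
    moreover have "inj_on (ring_succ L) ?S" by (rule inj_onI) (rule ring_succ_inj[OF L_pos])
    ultimately have "card ?S \<le> card ?T" by (intro card_inj_on_le) auto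
    moreover have "card (?S \<union> ?T) = card ?S + card ?T" by (rule card_Un_disjoint) auto
    moreover have "?S \<union> ?T = {..<R}" by auto
    ultimately show ?thesis by simp
  qed
  ultimately show ?thesis by blast
qed

text \<open>Double counting at the ring vertices: the three edges at such a vertex are pairwise
  adjacent in the line graph, so one of them is in \<open>S\<close>. A ring edge is counted at two
  vertices, a third edge at one. With at most \<open>R div 2\<close> elements of \<open>S\<close>,
  all estimates are tight.\<close>

lemma assignment_of_transversal:
  assumes "odd_cycle_transversal ({..<2 * R}, line_edges a b (2 * R)) S" "card S \<le> R div 2"
  shows "\<exists>\<alpha>. \<forall>c<m. \<exists>l<w. \<alpha> (var c l) = sign c l"
proof -
  obtain col :: "nat \<Rightarrow> bool" where S: "S \<subseteq> {..<2 * R}"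
    and col: "\<And>i j. i < 2 * R \<Longrightarrow> j < 2 * R \<Longrightarrow> touching a b i j \<Longrightarrow> i \<notin> S \<Longrightarrow> j \<notin> S \<Longrightarrow> col i \<noteq> col j"
    using assms(1) unfolding odd_cycle_transversal_iff_coloring[OF simple_line_edges]
    by (auto simp: line_edges_iff)
  let ?s = "\<lambda>i. of_bool (i \<in> S) :: nat"
  \<comment> \<open>The number of elements of \<open>S\<close> among the three edges at ring vertex
    \<open>ring_succ L i\<close>.\<close>
  let ?t = "\<lambda>i. ?s i + ?s (ring_succ L i) + ?s (R + ring_succ L i)"
  have t: "1 \<le> ?t i" if i: "i < R" for i
  proof (rule ccontr)
    let ?j = "ring_succ L i"
    assume "\<not> 1 \<le> ?t i"
    then have n: "i \<notin> S" "?j \<notin> S" "R + ?j \<notin> S" by (auto split: if_splits)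
    have j: "?j < R" using ring_succ_less_R[OF i] .
    have "R \<noteq> 0" using i by linarith
    then have "i \<noteq> ?j" "i \<noteq> R + ?j" "?j \<noteq> R + ?j" using i ring_succ_neq(1)[of i] by linarith+
    then have "touching a b i ?j" "touching a b i (R + ?j)" "touching a b ?j (R + ?j)"
      unfolding touching_def root_ends(3) root_ends(1,2)[OF i] root_ends(1,2)[OF j] by blast+
    then have "col i \<noteq> col ?j" "col i \<noteq> col (R + ?j)" "col ?j \<noteq> col (R + ?j)"
      using col n i j by simp_all
    then show False by blast
  qed
  have reindex: "(\<Sum>i<R. g (ring_succ L i)) = (\<Sum>i<R. g i)" for g :: "nat \<Rightarrow> nat"
    by (rule sum.reindex_bij_betw[OF bij_ring_succ])
  let ?A = "\<Sum>i<R. ?s i" and ?B = "\<Sum>i<R. ?s (R + i)"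
  have "card S = (\<Sum>i<2 * R. ?s i)"
    using S by (simp add: Int_absorb1)
  also have "\<dots> = ?A + ?B"
    using sum.atLeastLessThan_concat[of 0 R "2 * R" ?s, symmetric]
      sum.shift_bounds_nat_ivl[of ?s 0 R R] by (simp add: atLeast0LessThan mult_2 add.commute)
  finally have cS: "?A + ?B \<le> R div 2" using assms(2) by simp
  have sum_t: "(\<Sum>i<R. ?t i) = ?A + ?A + ?B"
    by (simp only: sum.distrib reindex[of ?s] reindex[of "\<lambda>i. ?s (R + i)"])
  have "(\<Sum>i<R. 1) \<le> (\<Sum>i<R. ?t i)" by (rule sum_mono) (use t in simp)
  then have le: "R \<le> ?A + ?A + ?B" unfolding sum_t by simp
  \<comment> \<open>The count gives \<open>R \<le> 2 * ?A + ?B\<close>, and the budget gives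
    \<open>2 * ?A + 2 * ?B \<le> R\<close>.\<close>
  have B0: "?B = 0" using cS le by linarith
  then have no_outer: "R + i \<notin> S" if "i < R" for i using that by (auto simp: sum_eq_0_iff)
  have "(\<Sum>i<R. ?t i - 1) = (\<Sum>i<R. ?t i) - (\<Sum>i<R. 1)"
    by (rule sum_subtractf_nat) (use t in simp)
  also have "\<dots> = 0" unfolding sum_t using cS B0 by simp
  finally have "\<forall>i<R. ?t i - 1 = 0" by (simp only: sum_eq_0_iff finite_lessThan lessThan_iff Ball_def)
  then have alt: "ring_succ L i \<in> S \<longleftrightarrow> i \<notin> S" if "i < R" for i
    using that t[OF that] no_outer[OF ring_succ_less_R[OF that]] by (cases "i \<in> S"; cases "ring_succ L i \<in> S") force+
  \<comment> \<open>By alternation, the edge at position 0 determines the whole ring. Position 0 is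
    even, so its edge is deleted exactly if the variable is false.\<close>
  define \<alpha> where "\<alpha> v \<longleftrightarrow> v * L \<notin> S" for v
  have del: "v * L + j \<in> S \<longleftrightarrow> deleted \<alpha> (v * L + j)" if "v < V" "j < L" for v j
    using that(2)
  proof (induction j)
    case 0
    have "v * L mod L = 0" "v * L div L = v" using L_pos by simp_all
    then show ?case by (simp only: deleted_def \<alpha>_def add_0_right) simp
  next
    case (Suc j)
    have "ring_succ L (v * L + j) = v * L + Suc j"
      using Suc.prems L_pos by (simp add: ring_succ_def)
    moreover have "v * L + j < R"
    proof -
      have "v * L + j < Suc v * L" using Suc.prems by simp
      also have "\<dots> \<le> R" using that(1) by (intro mult_le_mono1) simp
      finally show ?thesis .
    qed
    ultimately show ?case using alt[of "v * L + j"] deleted_succ[of \<alpha> "v * L + j"] Suc by simp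
  qed
  have "\<exists>l<w. \<alpha> (var c l) = sign c l" if c: "c < m" for c
  proof (rule ccontr)
    assume "\<not> (\<exists>l<w. \<alpha> (var c l) = sign c l)"
    then have unsat: "\<And>l. l < w \<Longrightarrow> \<alpha> (var c l) \<noteq> sign c l" by blast
    \<comment> \<open>A false literal keeps the ring edge between its ports. From one first port to
      the next the color then changes three times: at the two ports and at the clause vertex. With
      odd \<open>w\<close> this cannot close up around the clause cycle.\<close>
    let ?g = "\<lambda>l. col (R + in_port c l)"
    have step: "?g ((l + 1) mod w) = (\<not> ?g l)" if l: "l < w" for l
    proof -
      let ?i = "in_port c l" and ?o = "out_port c l" and ?l = "(l + 1) mod w"
      let ?n = "in_port c ?l"
      have l': "?l < w" using w_pos by simp
      have less: "?i < R" "?o < R" "?n < R"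
        using port_less[OF c l port_less_4(1)] port_less[OF c l port_less_4(2)]
          port_less[OF c l' port_less_4(1)] by blast+
      have "?i = var c l * L + ?i mod L"
        using port_div[OF c l port_less_4(1)] div_mult_mod_eq[of ?i L] by simp
      then have "?i \<in> S \<longleftrightarrow> deleted \<alpha> ?i"
        using del[OF var_less[OF c l], of "?i mod L"] L_pos by (metis mod_less_divisor)
      then have "?i \<notin> S" using deleted_in_port[OF c l] unsat[OF l] by blast
      moreover have "R + ?i \<noteq> ?i" "?i \<noteq> R + ?o" using less by linarith+
      then have "touching a b (R + ?i) ?i" "touching a b ?i (R + ?o)"
        unfolding touching_def root_ends(3) root_ends(1,2)[OF less(1)] ring_succ_in_port[OF c l]
        by blast+
      ultimately have "col (R + ?i) \<noteq> col ?i" "col ?i \<noteq> col (R + ?o)"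
        using col less no_outer by simp_all
      moreover have "col (R + ?o) \<noteq> col (R + ?n)"
      proof (rule col)
        have "?o \<noteq> ?n"
        proof
          assume "?o = ?n"
          from port_eq[OF this c l port_less_4(2) c l' port_less_4(1)] show False
            by (auto split: if_splits)
        qed
        moreover have "outer ?o = outer ?n"
          using outer_out[OF c l] outer_in[OF c l'] by simp
        ultimately show "touching a b (R + ?o) (R + ?n)" by (simp add: touching_def)
      qed (use less no_outer in auto)
      ultimately show ?thesis by blast
    qed
    have "?g l = (?g 0 \<longleftrightarrow> even l)" if "l < w" for l
      using that
    proof (induction l)
      case (Suc l)
      then show ?case using step[of l] by auto
    qed simp
    from this[of "w - 1"] have "?g (w - 1) = ?g 0" using odd_w w_pos by simp
    moreover have "?g 0 = (\<not> ?g (w - 1))" using step[of "w - 1"] w_pos by simp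
    ultimately show False by blast
  qed
  then show ?thesis by blast
qed

end


section \<open>Encoding of instances\<close>

lemma concat_map_rows:
  "concat (map (\<lambda>i. map (f i) [0..<n]) [0..<m]) = map (\<lambda>t. f (t div n) (t mod n)) [0..<m * n]"
proof (induction m)
  case (Suc m)
  have "map (f m) [0..<n] = map (\<lambda>t. f (t div n) (t mod n)) [m * n..<m * n + n]"
  proof (rule nth_equalityI)
    fix i assume "i < length (map (f m) [0..<n])"
    then have "i < n" by simp
    then show "map (f m) [0..<n] ! i = map (\<lambda>t. f (t div n) (t mod n)) [m * n..<m * n + n] ! i"
      by simp
  qed simp
  moreover have "[0..<Suc m * n] = [0..<m * n] @ [m * n..<m * n + n]"
    using upt_add_eq_append[of 0 "m * n" n] by (simp add: add.commute)
  ultimately show ?case using Suc.IH by simp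
qed simp

lemma encode_instance_eq:
  "encode_instance n E k = replicate n True @ [False] @
     map (\<lambda>t. {t div n, t mod n} \<in> E) [0..<n * n] @ binary k"
  by (simp add: encode_instance_def concat_map_rows)

lemma simple_graph_pairs:
  assumes "simple_graph ({..<n}, E)"
  shows "E = {{i, j} | i j. i < n \<and> j < n \<and> {i, j} \<in> E}"
proof
  show "E \<subseteq> {{i, j} | i j. i < n \<and> j < n \<and> {i, j} \<in> E}"
  proof
    fix e assume e: "e \<in> E"
    then have "e \<subseteq> {..<n}" "card e = 2" using assms by (auto simp: simple_graph_def)
    then obtain i j where "e = {i, j}" "i < n" "j < n" by (auto simp: card_2_iff)
    then show "e \<in> {{i, j} | i j. i < n \<and> j < n \<and> {i, j} \<in> E}" using e by blast
  qed
qed blast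

fun binary_value :: "bool list \<Rightarrow> nat" where
  "binary_value [] = 0"
| "binary_value (b # w) = of_bool b + 2 * binary_value w"

lemma binary_value_binary [simp]: "binary_value (binary k) = k"
proof (induction k rule: binary.induct)
  case (1 k)
  then show ?case by (subst binary.simps) (auto simp: odd_two_times_div_two_succ)
qed

lemma replicate_True_eq:
  assumes "replicate n True @ False # xs = replicate m True @ False # ys"
  shows "n = m \<and> xs = ys"
proof -
  have *: "takeWhile (\<lambda>b. b) (replicate n True @ False # xs) = replicate n True" for n and xs :: "bool list"
    by (induction n) auto
  have "n = m" using arg_cong[OF assms, of "\<lambda>w. length (takeWhile (\<lambda>b. b) w)"] by (simp add: *)
  then show ?thesis using assms by simp
qed

text \<open>Both languages quantify existentially over graphs, so membership of a code word refers
  to one graph only because of injectivity. Simplicity is what makes \<open>E\<close> determined by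
  its adjacency matrix.\<close>

lemma encode_instance_inj:
  assumes "encode_instance n E k = encode_instance n' E' k'"
    "simple_graph ({..<n}, E)" "simple_graph ({..<n'}, E')"
  shows "n' = n \<and> E' = E \<and> k' = k"
proof -
  have n: "n = n'" and eq: "map (\<lambda>t. {t div n, t mod n} \<in> E) [0..<n * n] @ binary k =
      map (\<lambda>t. {t div n', t mod n'} \<in> E') [0..<n' * n'] @ binary k'"
    using replicate_True_eq[OF assms(1)[unfolded encode_instance_eq append_Cons append_Nil]] by blast+
  have m: "map (\<lambda>t. {t div n, t mod n} \<in> E) [0..<n * n] =
      map (\<lambda>t. {t div n, t mod n} \<in> E') [0..<n * n]" and k: "binary k = binary k'"
    using append_eq_append_conv[THEN iffD1, OF disjI1, OF _ eq[folded n]] by simp_all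
  have "{i, j} \<in> E \<longleftrightarrow> {i, j} \<in> E'" if "i < n" "j < n" for i j
  proof -
    have "i * n + j < n * n"
    proof -
      have "i * n + j < Suc i * n" using that by simp
      also have "\<dots> \<le> n * n" using that by (intro mult_le_mono1) simp
      finally show ?thesis .
    qed
    then have "map (\<lambda>t. {t div n, t mod n} \<in> E) [0..<n * n] ! (i * n + j) \<longleftrightarrow> {i, j} \<in> E"
      "map (\<lambda>t. {t div n, t mod n} \<in> E') [0..<n * n] ! (i * n + j) \<longleftrightarrow> {i, j} \<in> E'"
      using that by simp_all
    then show ?thesis using m by simp
  qed
  then have "{{i, j} | i j. i < n \<and> j < n \<and> {i, j} \<in> E} = {{i, j} | i j. i < n \<and> j < n \<and> {i, j} \<in> E'}"
    by blast
  then have "E = E'"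
    using simple_graph_pairs[OF assms(2)] simple_graph_pairs[OF assms(3)] n by simp
  moreover have "k = k'" using arg_cong[OF k, of binary_value] by simp
  ultimately show ?thesis using n by simp
qed

lemma encode_in_Odd_Cycle_Transversal:
  assumes "simple_graph ({..<n}, E)"
  shows "encode_instance n E k \<in> Odd_Cycle_Transversal \<longleftrightarrow>
    (\<exists>S. odd_cycle_transversal ({..<n}, E) S \<and> card S \<le> k)"
  unfolding Odd_Cycle_Transversal_def using encode_instance_inj[OF _ assms] assms by blast

text \<open>Powers of two without exponentiation, by bounded quantification only: numbers with no
  odd divisor except 1.\<close>

definition is_pow2 :: "nat \<Rightarrow> bool" where
  "is_pow2 z \<longleftrightarrow> 1 \<le> z \<and> (\<forall>d<Suc z. d dvd z \<longrightarrow> d = 1 \<or> even d)"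

lemma decidable_pow2:
  assumes "computable W \<Gamma> F"
  shows "decidable W \<Gamma> (\<lambda>c. is_pow2 (F c))"
  unfolding is_pow2_def
  by (rule decidable_conj decidable_le computable_const decidable_all computable_Suc assms
      decidable_imp decidable_dvd computable_fst computable_weaken decidable_disj decidable_eq)+

lemma is_pow2_0 [simp]: "\<not> is_pow2 0"
  by (simp add: is_pow2_def)

lemma is_pow2_odd: "odd z \<Longrightarrow> is_pow2 z \<longleftrightarrow> z = 1"
  by (auto simp: is_pow2_def less_Suc_eq_le dest: spec[of _ z])

lemma is_pow2_iff: "z \<noteq> 0 \<Longrightarrow> is_pow2 z \<longleftrightarrow> (\<forall>d. d dvd z \<longrightarrow> d = 1 \<or> even d)"
  unfolding is_pow2_def using dvd_imp_le[of _ z] by (auto simp: less_Suc_eq_le Suc_le_eq)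

lemma is_pow2_double [simp]: "is_pow2 (2 * y) \<longleftrightarrow> is_pow2 y"
proof (cases "y = 0")
  case False
  have "d dvd y" if "d dvd 2 * y" "odd d" for d
  proof -
    have "coprime d 2" using that(2) by simp
    then show ?thesis using that(1) coprime_dvd_mult_right_iff by blast
  qed
  then have "(\<forall>d. d dvd 2 * y \<longrightarrow> d = 1 \<or> even d) \<longleftrightarrow> (\<forall>d. d dvd y \<longrightarrow> d = 1 \<or> even d)"
    using dvd_mult[of _ y 2] by blast
  then show ?thesis using False is_pow2_iff[of y] is_pow2_iff[of "2 * y"] by simp
qed simp

text \<open>The counterpart of the recursion of \<open>binary\<close>: removing the lowest digit
  halves all remaining weights.\<close>

lemma filter_pow2_upt:
  assumes "0 < k"
  shows "filter is_pow2 [0..<Suc k] = 1 # map ((*) 2) (filter is_pow2 [0..<Suc (k div 2)])" (is "?l = ?r")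
proof (rule sorted_distinct_set_unique)
  show "sorted ?l" "distinct ?l" by (simp_all del: upt_Suc add: sorted_wrt_filter)
  have pos: "1 < 2 * y" if "is_pow2 y" for y using that by (auto simp: is_pow2_def)
  have "sorted (map ((*) 2) (filter is_pow2 [0..<Suc (k div 2)]))"
    by (simp del: upt_Suc add: sorted_map sorted_wrt_filter)
  moreover have "\<forall>z\<in>set (map ((*) 2) (filter is_pow2 [0..<Suc (k div 2)])). 1 < z"
    using pos by (auto simp del: upt_Suc)
  ultimately show "sorted ?r" by (auto simp del: upt_Suc simp: le_less)
  have "distinct (map ((*) 2) (filter is_pow2 [0..<Suc (k div 2)]))"
    by (simp del: upt_Suc add: distinct_map inj_on_def)
  then show "distinct ?r"
    using \<open>\<forall>z\<in>set (map ((*) 2) (filter is_pow2 [0..<Suc (k div 2)])). 1 < z\<close> by auto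
  show "set ?l = set ?r"
  proof (rule set_eqI)
    fix z
    show "z \<in> set ?l \<longleftrightarrow> z \<in> set ?r"
    proof (cases "even z")
      case True
      then obtain y where y: "z = 2 * y" by blast
      have "z \<in> set ?l \<longleftrightarrow> is_pow2 y \<and> 2 * y \<le> k" using y by (auto simp del: upt_Suc)
      also have "\<dots> \<longleftrightarrow> is_pow2 y \<and> y \<le> k div 2" by auto
      also have "\<dots> \<longleftrightarrow> z \<in> set ?r" using y by (auto simp del: upt_Suc)
      finally show ?thesis .
    next
      case False
      then show ?thesis using is_pow2_odd[OF False] assms by (auto simp del: upt_Suc)
    qed
  qed
qed

text \<open>Digits are indexed by their weights, which avoids logarithms. Running through all
  numbers up to \<open>k\<close> is affordable because the reduction only writes polynomially
  bounded numbers.\<close>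

lemma binary_eq_map: "binary k = map (\<lambda>z. odd (k div z)) (filter is_pow2 [0..<Suc k])"
proof (induction k rule: less_induct)
  case (less k)
  show ?case
  proof (cases "k = 0")
    case True
    then show ?thesis by (simp add: binary.simps)
  next
    case False
    then have "binary k = odd k # binary (k div 2)" by (subst binary.simps) simp
    also have "binary (k div 2) = map (\<lambda>z. odd (k div 2 div z)) (filter is_pow2 [0..<Suc (k div 2)])"
      by (rule less) (use False in simp)
    also have "odd k # \<dots> = map (\<lambda>z. odd (k div z)) (1 # map ((*) 2) (filter is_pow2 [0..<Suc (k div 2)]))"
      by (simp add: div_mult2_eq del: upt_Suc)
    finally show ?thesis using filter_pow2_upt[of k] False by simp
  qed
qed

lemma concat_map_upt_add:
  "concat (map g [0..<a + b]) = concat (map g [0..<a]) @ concat (map (\<lambda>i. g (a + i)) [0..<b])"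
  by (induction b) (auto simp: add.commute)

lemma concat_map_filter:
  "concat (map (\<lambda>z. if P z then [f z] else []) xs) = map f (filter P xs)"
  by (induction xs) auto


section \<open>The reduction from satisfiability\<close>

text \<open>Behind the matrix, the offset of \<open>t\<close> is the weight of a digit and not its
  position; offsets that are not powers of two give 0 and thus no output.\<close>

definition encode_symbol :: "nat \<Rightarrow> (nat \<Rightarrow> nat \<Rightarrow> bool) \<Rightarrow> nat \<Rightarrow> nat \<Rightarrow> nat" where
  "encode_symbol n adj k t =
    (if t < n then 2 else if t = n then 1
     else if t < n + 1 + n * n then
       (if adj ((t - (n + 1)) div n) ((t - (n + 1)) mod n) then 2 else 1)
     else if is_pow2 (t - (n + 1 + n * n)) then
       (if k div (t - (n + 1 + n * n)) mod 2 = 1 then 2 else 1) else 0)"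

lemma encode_instance_emit:
  assumes "\<And>i j. i < n \<Longrightarrow> j < n \<Longrightarrow> {i, j} \<in> E \<longleftrightarrow> adj i j"
  shows "encode_instance n E k =
    concat (map (\<lambda>t. emit (encode_symbol n adj k t)) [0..<n + (1 + (n * n + (k + 1)))])"
proof -
  let ?g = "\<lambda>t. emit (encode_symbol n adj k t)"
  have 1: "concat (map ?g [0..<n]) = replicate n True"
  proof -
    have "concat (map ?g [0..<n]) = concat (map (\<lambda>t. [True]) [0..<n])"
      by (intro arg_cong[of _ _ concat] map_cong refl) (auto simp: encode_symbol_def emit_def)
    also have "\<dots> = replicate n True" by (induction n) (auto simp: replicate_append_same)
    finally show ?thesis .
  qed
  have 2: "concat (map (\<lambda>i. ?g (n + i)) [0..<1]) = [False]"
    by (simp add: encode_symbol_def emit_def)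
  have 3: "concat (map (\<lambda>i. ?g (n + (1 + i))) [0..<n * n]) = map (\<lambda>t. {t div n, t mod n} \<in> E) [0..<n * n]"
  proof -
    have "?g (n + (1 + t)) = [{t div n, t mod n} \<in> E]" if "t < n * n" for t
    proof -
      have "t div n < n" "t mod n < n"
        using that by (auto simp: less_mult_imp_div_less intro!: mod_less_divisor intro: gr0I)
      then show ?thesis using that assms by (simp add: encode_symbol_def emit_def)
    qed
    then have eq: "map (\<lambda>i. ?g (n + (1 + i))) [0..<n * n] = map (\<lambda>t. [{t div n, t mod n} \<in> E]) [0..<n * n]"
      by (intro map_cong refl) simp
    show ?thesis unfolding eq by (simp only: concat_map_singleton)
  qed
  have 4: "concat (map (\<lambda>i. ?g (n + (1 + (n * n + i)))) [0..<k + 1]) = binary k"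
  proof -
    have "?g (n + (1 + (n * n + z))) = (if is_pow2 z then [odd (k div z)] else [])" for z
      by (simp add: encode_symbol_def emit_def odd_iff_mod_2_eq_one)
    then show ?thesis unfolding binary_eq_map by (simp add: concat_map_filter del: upt_Suc)
  qed
  have "concat (map ?g [0..<n + (1 + (n * n + (k + 1)))]) =
     concat (map ?g [0..<n]) @ concat (map (\<lambda>i. ?g (n + i)) [0..<1]) @
     concat (map (\<lambda>i. ?g (n + (1 + i))) [0..<n * n]) @
     concat (map (\<lambda>i. ?g (n + (1 + (n * n + i)))) [0..<k + 1])"
    by (simp only: concat_map_upt_add[of ?g n "1 + (n * n + (k + 1))"]
        concat_map_upt_add[of "\<lambda>i. ?g (n + i)" 1 "n * n + (k + 1)"]
        concat_map_upt_add[of "\<lambda>i. ?g (n + (1 + i))" "n * n" "k + 1"])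
  then show ?thesis
    unfolding 1 2 3 4 encode_instance_eq by (rule sym)
qed

text \<open>\<open>var\<close> and \<open>sign\<close> are only assumed to preserve computability of
  their arguments, which here are terms in \<open>div\<close> and \<open>mod\<close>.\<close>

lemma computable_outer_vertex:
  assumes "computable W \<Gamma> R" "computable W \<Gamma> L" "computable W \<Gamma> i"
    and var: "\<And>C D. computable W \<Gamma> C \<Longrightarrow> computable W \<Gamma> D \<Longrightarrow> computable W \<Gamma> (\<lambda>p. var p (C p) (D p))"
    and sign: "\<And>C D. computable W \<Gamma> C \<Longrightarrow> computable W \<Gamma> D \<Longrightarrow> decidable W \<Gamma> (\<lambda>p. sign p (C p) (D p))"
  shows "computable W \<Gamma> (\<lambda>p. outer_vertex (R p) (L p) w (var p) (sign p) (i p))"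
  unfolding outer_vertex_def Let_def
  by (rule computable_if decidable_conj decidable_eq var sign assms(1-3) computable_div computable_mod
      computable_add computable_mult computable_const)+

lemma computable_root_end1:
  assumes "computable W \<Gamma> R" "computable W \<Gamma> i"
  shows "computable W \<Gamma> (\<lambda>p. root_end1 (R p) (i p))"
  unfolding root_end1_def by (rule computable_if decidable_less computable_sub assms)+

lemma computable_root_end2:
  assumes "computable W \<Gamma> R" "computable W \<Gamma> L" "computable W \<Gamma> i"
    and "\<And>C D. computable W \<Gamma> C \<Longrightarrow> computable W \<Gamma> D \<Longrightarrow> computable W \<Gamma> (\<lambda>p. var p (C p) (D p))"
    and "\<And>C D. computable W \<Gamma> C \<Longrightarrow> computable W \<Gamma> D \<Longrightarrow> decidable W \<Gamma> (\<lambda>p. sign p (C p) (D p))"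
  shows "computable W \<Gamma> (\<lambda>p. root_end2 (R p) (L p) w (var p) (sign p) (i p))"
proof -
  have "computable W \<Gamma> (\<lambda>p. outer_vertex (R p) (L p) w (var p) (sign p) (i p - R p))"
    by (rule computable_outer_vertex[OF assms(1,2) computable_sub[OF assms(3,1)]]) (rule assms; assumption)+
  then show ?thesis
    unfolding root_end2_def ring_succ_def
    by (intro computable_if decidable_less computable_add computable_mult computable_div
        computable_mod computable_const assms(1-3))
qed

lemma reduction_from_satisfiability:
  fixes V m :: "bool list \<Rightarrow> nat" and w :: nat
    and var :: "bool list \<Rightarrow> nat \<Rightarrow> nat \<Rightarrow> nat" and sign :: "bool list \<Rightarrow> nat \<Rightarrow> nat \<Rightarrow> bool"
  defines "W1 \<equiv> (\<lambda>p b. if b then [] else snd p) :: nat \<times> bool list \<Rightarrow> bool \<Rightarrow> bool list"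
  assumes V: "computable (\<lambda>x b. if b then [] else x) [] V"
    and m: "computable (\<lambda>x b. if b then [] else x) [] m"
    and var: "\<And>C D. computable W1 [fst] C \<Longrightarrow> computable W1 [fst] D \<Longrightarrow>
      computable W1 [fst] (\<lambda>p. var (snd p) (C p) (D p))"
    and sign: "\<And>C D. computable W1 [fst] C \<Longrightarrow> computable W1 [fst] D \<Longrightarrow>
      decidable W1 [fst] (\<lambda>p. sign (snd p) (C p) (D p))"
    and gadget: "\<And>x. gadget (V x) (m x) w (var x)"
  shows "\<exists>f. polytime_computable f \<and> (\<forall>x. f x \<in> line_graph_instances \<and>
     (f x \<in> Odd_Cycle_Transversal \<longleftrightarrow> (\<exists>\<alpha>. \<forall>c<m x. \<exists>l<w. \<alpha> (var x c l) = sign x c l)))"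
proof -
  define L where "L x = 4 * (m x * w)" for x
  define R where "R x = V x * L x" for x
  define a where "a x = root_end1 (R x)" for x
  define b where "b x = root_end2 (R x) (L x) w (var x) (sign x)" for x
  define F where "F t x = encode_symbol (2 * R x) (touching (a x) (b x)) (R x div 2) t" for t x
  define N where "N x = 2 * R x + (1 + (2 * R x * (2 * R x) + (R x div 2 + 1)))" for x
  have LR: "computable (\<lambda>x b. if b then [] else x) [] L" "computable (\<lambda>x b. if b then [] else x) [] R"
    unfolding L_def R_def by (rule computable_mult computable_const V m)+
  have LR1: "computable W1 [fst] (\<lambda>p. L (snd p))" "computable W1 [fst] (\<lambda>p. R (snd p))"
    using computable_weaken[OF LR(1)] computable_weaken[OF LR(2)] by (simp_all add: W1_def)
  have fst1: "computable W1 [fst] fst" by (rule computable_var) simp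
  have "polytime_computable (\<lambda>x. concat (map (\<lambda>t. emit (F t x)) [0..<N x]))"
  proof (rule polytime_computableI)
    show "computable (\<lambda>x b. if b then [] else x) [] N"
      unfolding N_def by (rule computable_add computable_mult computable_div computable_const LR)+
    have "computable W1 [fst] (\<lambda>p. F (fst p) (snd p))"
      unfolding F_def encode_symbol_def touching_def a_def b_def
      by (rule computable_if decidable_less decidable_eq decidable_conj decidable_disj decidable_not
          decidable_pow2 computable_add computable_mult computable_sub computable_div computable_mod
          computable_const computable_root_end1 computable_root_end2 LR1 fst1 | erule (1) var sign)+
    then show "computable (\<lambda>p b. if b then [] else snd p) [fst] (\<lambda>p. F (fst p) (snd p))"
      by (simp add: W1_def)
  qed
  moreover have "concat (map (\<lambda>t. emit (F t x)) [0..<N x]) =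
      encode_instance (2 * R x) (line_edges (a x) (b x) (2 * R x)) (R x div 2)" for x
    unfolding F_def N_def by (rule encode_instance_emit[symmetric]) (simp add: line_edges_iff)
  moreover have "encode_instance (2 * R x) (line_edges (a x) (b x) (2 * R x)) (R x div 2) \<in> line_graph_instances"
    for x
    using gadget.is_line_graph_gadget[OF gadget, of x] simple_line_edges
    unfolding line_graph_instances_def a_def b_def R_def L_def by blast
  moreover have "encode_instance (2 * R x) (line_edges (a x) (b x) (2 * R x)) (R x div 2) \<in> Odd_Cycle_Transversal
      \<longleftrightarrow> (\<exists>\<alpha>. \<forall>c<m x. \<exists>l<w. \<alpha> (var x c l) = sign x c l)" for x
    unfolding encode_in_Odd_Cycle_Transversal[OF simple_line_edges] a_def b_def R_def L_def
  proof (intro iffI; elim exE conjE)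
    fix \<alpha> assume "\<forall>c<m x. \<exists>l<w. \<alpha> (var x c l) = sign x c l"
    then show "\<exists>S. odd_cycle_transversal ({..<2 * (V x * (4 * (m x * w)))}, line_edges (root_end1 (V x * (4 * (m x * w))))
        (root_end2 (V x * (4 * (m x * w))) (4 * (m x * w)) w (var x) (sign x)) (2 * (V x * (4 * (m x * w))))) S \<and>
       card S \<le> V x * (4 * (m x * w)) div 2"
      by (intro gadget.transversal_of_assignment[OF gadget, where \<alpha> = \<alpha>]) blast
  qed (rule gadget.assignment_of_transversal[OF gadget])
  ultimately show ?thesis by (intro exI conjI allI) auto
qed


section \<open>Satisfiability is NP-hard\<close>

lemma mixed_radix_less:
  fixes a b n N :: nat
  assumes "a < n" "b < N"
  shows "a + n * b < n * N"
proof -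
  have "a + n * b < n * Suc b" using assms(1) by simp
  also have "\<dots> \<le> n * N" using assms(2) by (intro mult_le_mono2) simp
  finally show ?thesis .
qed

lemma mixed_radix_decode:
  fixes a b n :: nat
  assumes "a < n"
  shows "(a + n * b) mod n = a" "(a + n * b) div n = b"
  using assms by simp_all

text \<open>
  Tape contents are described relative to the head, so that the cells read in a step are always
  the cells with offset 0, and moving the head shifts the tape. The state is treated as the
  content of cell 0 of an additional tape with number \<open>K\<close>.
\<close>

locale verifier =
  fixes M :: turing_machine and p q :: "nat poly"
  assumes wf: "wf_tm M" and tapes: "2 \<le> num_tapes M"
begin

definition "K = num_tapes M"
definition "S = max (num_states M) (num_symbols M)"

lemma K_ge: "2 \<le> K"
  using tapes by (simp add: K_def)

lemma S_ge: "3 \<le> S"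
  using wf by (auto simp: wf_tm_def S_def)

text \<open>\<open>v\<close> lists the symbols under the heads, followed by the state at index
  \<open>K\<close>. Halting states get an explicit idle action, so that all steps have the same form
  and runs can be continued to a fixed time.\<close>

definition action :: "nat list \<Rightarrow> nat \<times> (nat \<times> head_move) list" where
  "action v = (if v ! K = 1 \<or> v ! K = 2 then (v ! K, map (\<lambda>s. (s, Stay)) (take K v))
     else transition M (v ! K) (take K v))"

definition written :: "nat list \<Rightarrow> nat \<Rightarrow> nat" where
  "written v \<tau> = (if \<tau> = K then fst (action v) else fst (snd (action v) ! \<tau>))"

definition shift :: "nat list \<Rightarrow> nat \<Rightarrow> int" where
  "shift v \<tau> = (if \<tau> = K then 0 else head_shift (snd (snd (action v) ! \<tau>)))"

lemma shift_cases: "shift v \<tau> = - 1 \<or> shift v \<tau> = 0 \<or> shift v \<tau> = 1"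
proof -
  have "head_shift a = - 1 \<or> head_shift a = 0 \<or> head_shift a = 1" for a by (cases a) auto
  then show ?thesis by (auto simp: shift_def)
qed

definition cell :: "config \<Rightarrow> nat \<Rightarrow> int \<Rightarrow> nat" where
  "cell c \<tau> d = (if \<tau> = K then (if d = 0 then fst c else 0)
     else fst (snd c ! \<tau>) (snd (snd c ! \<tau>) + d))"

definition heads :: "config \<Rightarrow> nat list" where
  "heads c = map (\<lambda>\<tau>. cell c \<tau> 0) [0..<K + 1]"

definition valid :: "config \<Rightarrow> bool" where
  "valid c \<longleftrightarrow> length (snd c) = K \<and> fst c < num_states M \<and>
     (\<forall>\<tau><K. \<forall>i. fst (snd c ! \<tau>) i < num_symbols M)"

lemma take_heads:
  assumes "valid c"
  shows "take K (heads c) = map read_tape (snd c)"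
proof (rule nth_equalityI)
  show "length (take K (heads c)) = length (map read_tape (snd c))"
    using assms by (simp add: heads_def valid_def)
  fix i assume "i < length (take K (heads c))"
  then have "i < K" by (simp add: heads_def)
  then show "take K (heads c) ! i = map read_tape (snd c) ! i"
    using assms by (simp add: heads_def valid_def cell_def read_tape_def nth_append)
qed

lemma heads_K: "heads c ! K = fst c"
  by (simp add: heads_def cell_def nth_append)

lemma valid_action:
  assumes "valid c"
  shows "tm_step M c = (fst (action (heads c)), map2 act_tape (snd (action (heads c))) (snd c))"
    "length (snd (action (heads c))) = K" "fst (action (heads c)) < num_states M"
    "\<And>\<tau>. \<tau> < K \<Longrightarrow> fst (snd (action (heads c)) ! \<tau>) < num_symbols M"
proof -
  have len: "length (snd c) = K" and st: "fst c < num_states M" using assms by (simp_all add: valid_def)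
  have sy: "\<forall>s\<in>set (map read_tape (snd c)). s < num_symbols M"
  proof
    fix s assume "s \<in> set (map read_tape (snd c))"
    then obtain \<tau> where "\<tau> < length (map read_tape (snd c))" "s = map read_tape (snd c) ! \<tau>"
      by (metis in_set_conv_nth)
    then show "s < num_symbols M" using assms by (simp add: valid_def read_tape_def)
  qed
  have "tm_step M c = (fst (action (heads c)), map2 act_tape (snd (action (heads c))) (snd c)) \<and>
    length (snd (action (heads c))) = K \<and> fst (action (heads c)) < num_states M \<and>
    (\<forall>\<tau><K. fst (snd (action (heads c)) ! \<tau>) < num_symbols M)"
  proof (cases "halted c")
    case True
    then have a: "action (heads c) = (fst c, map (\<lambda>s. (s, Stay)) (map read_tape (snd c)))"
      unfolding action_def heads_K take_heads[OF assms] by (simp add: halted_def)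
    have "map2 act_tape (map (\<lambda>s. (s, Stay)) (map read_tape (snd c))) (snd c) = snd c"
      by (rule nth_equalityI) auto
    then show ?thesis
      using True len st sy unfolding a by (simp add: tm_step_def)
  next
    case False
    then have a: "action (heads c) = transition M (fst c) (map read_tape (snd c))"
      unfolding action_def heads_K take_heads[OF assms] by (simp add: halted_def)
    obtain q' as where qas: "transition M (fst c) (map read_tape (snd c)) = (q', as)" by fastforce
    have "q' < num_states M \<and> length as = num_tapes M \<and> (\<forall>(s, m)\<in>set as. s < num_symbols M)"
    proof -
      have "length (map read_tape (snd c)) = num_tapes M" using len by (simp add: K_def)
      from conjunct2[OF conjunct2[OF conjunct2[OF wf[unfolded wf_tm_def]]], THEN spec, THEN spec,
          THEN mp, THEN mp, OF st this, THEN mp, OF sy]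
      have "case transition M (fst c) (map read_tape (snd c)) of (q', as) \<Rightarrow>
          q' < num_states M \<and> length as = num_tapes M \<and> (\<forall>(s, m)\<in>set as. s < num_symbols M)" .
      then show ?thesis unfolding qas by simp
    qed
    then show ?thesis
      using False unfolding a qas by (auto simp: tm_step_def qas K_def split_beta)
  qed
  then show "tm_step M c = (fst (action (heads c)), map2 act_tape (snd (action (heads c))) (snd c))"
    "length (snd (action (heads c))) = K" "fst (action (heads c)) < num_states M"
    "\<And>\<tau>. \<tau> < K \<Longrightarrow> fst (snd (action (heads c)) ! \<tau>) < num_symbols M"
    by blast+
qed

lemma valid_step:
  assumes "valid c"
  shows "valid (tm_step M c)"
  unfolding valid_action(1)[OF assms] valid_def
  using assms valid_action(2-4)[OF assms] by (auto simp: valid_def act_tape_def)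

text \<open>The head move renumbers all cells and only offset 0 is rewritten. Hence the new contents
  of a cell are determined by its old contents and the symbols under the heads, which is what makes
  clauses of bounded width possible.\<close>

lemma cell_step:
  assumes "valid c" "\<tau> \<le> K"
  shows "cell (tm_step M c) \<tau> (d - shift (heads c) \<tau>) =
    (if d = 0 then written (heads c) \<tau> else cell c \<tau> d)"
proof (cases "\<tau> = K")
  case True
  then show ?thesis unfolding valid_action(1)[OF assms(1)] by (simp add: cell_def shift_def written_def)
next
  case False
  then have "\<tau> < K" using assms(2) by simp
  then show ?thesis
    using assms(1) valid_action(2)[OF assms(1)] unfolding valid_action(1)[OF assms(1)]
    by (simp add: cell_def shift_def written_def act_tape_def valid_def)
qed

lemma cell_less: "valid c \<Longrightarrow> \<tau> \<le> K \<Longrightarrow> cell c \<tau> d < S"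
  using S_ge by (auto simp: cell_def valid_def S_def less_max_iff_disj)

abbreviation run :: "bool list \<Rightarrow> bool list \<Rightarrow> nat \<Rightarrow> config" where
  "run x u t \<equiv> tm_run M t (initial_config M [x, u])"

lemma run_Suc: "run x u (Suc t) = tm_step M (run x u t)"
  by (simp add: tm_run_def)

lemma initial_tape:
  "\<tau> < K \<Longrightarrow> snd (initial_config M [x, u]) ! \<tau> =
     (if \<tau> = 0 then word_tape x else if \<tau> = 1 then word_tape u else word_tape [])"
  by (auto simp: initial_config_def K_def[symmetric] nth_append nth_Cons split: nat.splits)

lemma cell_run_0:
  assumes "\<tau> \<le> K"
  shows "cell (run x u 0) \<tau> d =
     (if \<tau> = 0 \<and> 0 \<le> d then symbol x (nat d) else if \<tau> = 1 \<and> 0 \<le> d then symbol u (nat d) else 0)"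
proof (cases "\<tau> = K")
  case True
  then show ?thesis using K_ge by (simp add: tm_run_def initial_config_def cell_def)
next
  case False
  have w: "fst (word_tape w) (snd (word_tape w) + d) = (if 0 \<le> d then symbol w (nat d) else 0)" for w
    by (auto simp: word_tape_def symbol_def)
  have "cell (run x u 0) \<tau> d = (let tp = if \<tau> = 0 then word_tape x else if \<tau> = 1 then word_tape u
      else word_tape [] in fst tp (snd tp + d))"
    using False assms initial_tape[of \<tau> x u] by (simp add: tm_run_def cell_def Let_def)
  then show ?thesis using w[of x] w[of u] w[of "[]"] by (simp add: Let_def symbol_def[of "[]"])
qed

lemma valid_run: "valid (run x u t)"
proof (induction t)
  case 0
  have 3: "3 \<le> num_symbols M" "3 \<le> num_states M" using wf by (simp_all add: wf_tm_def)
  have "fst (word_tape w) i < 3" for w i by (simp add: word_tape_def bit_symbol_def)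
  then have w: "fst (word_tape w) i < num_symbols M" for w i using 3 by (meson less_le_trans)
  have "length (snd (initial_config M [x, u])) = K" "fst (initial_config M [x, u]) = 0"
    using K_ge by (simp_all add: initial_config_def K_def)
  moreover have "fst (snd (initial_config M [x, u]) ! \<tau>) i < num_symbols M" if "\<tau> < K" for \<tau> i
    unfolding initial_tape[OF that] using w by simp
  ultimately show ?case using 3 by (simp add: valid_def tm_run_def)
next
  case (Suc t)
  then show ?case using valid_step by (simp add: run_Suc)
qed

text \<open>Any enumeration will do; vectors that no configuration reads may occur in it. Its length
  depends on the machine alone, which permits finite tables.\<close>

definition vectors :: "nat list list" where
  "vectors = (SOME vs. set vs = {v. set v \<subseteq> {..<S} \<and> length v = K + 1})"

lemma set_vectors: "set vectors = {v. set v \<subseteq> {..<S} \<and> length v = K + 1}"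
  unfolding vectors_def
  by (rule someI_ex, rule finite_list) (rule finite_lists_length_eq, simp)

definition "NV = length vectors"

lemma ex_vector:
  assumes "valid c"
  shows "\<exists>\<iota><NV. vectors ! \<iota> = heads c"
proof -
  have "heads c \<in> set vectors"
    using cell_less[OF assms] by (auto simp: set_vectors heads_def)
  then show ?thesis by (auto simp: in_set_conv_nth NV_def)
qed

lemma NV_pos: "0 < NV"
proof -
  have "replicate (K + 1) 0 \<in> set vectors"
    using S_ge by (auto simp: set_vectors)
  then show ?thesis unfolding NV_def by (cases vectors) auto
qed

definition Q :: "bool list \<Rightarrow> nat" where
  "Q x = poly q (length x)"

text \<open>The summand \<open>Q x\<close> keeps the certificate within the cells that are covered by clauses.\<close>

definition T :: "bool list \<Rightarrow> nat" where
  "T x = Suc (poly p (length x + Q x) + Q x)"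

text \<open>
  With \<open>n\<close> the time bound, this variable says that at time \<open>t\<close> the cell of tape \<open>\<tau>\<close> with offset
  \<open>P - (n + 1)\<close> from the head contains \<open>s\<close>.
\<close>

definition var_cell :: "nat \<Rightarrow> nat \<Rightarrow> nat \<Rightarrow> nat \<Rightarrow> nat \<Rightarrow> nat" where
  "var_cell n \<tau> t P s = s + S * (P + (2 * n + 3) * (t + (n + 1) * \<tau>))"

definition num_vars :: "bool list \<Rightarrow> nat" where
  "num_vars x = S * ((2 * T x + 3) * ((T x + 1) * (K + 1)))"

lemma var_cell_less:
  "s < S \<Longrightarrow> P < 2 * T x + 3 \<Longrightarrow> t < T x + 1 \<Longrightarrow> \<tau> < K + 1 \<Longrightarrow> var_cell (T x) \<tau> t P s < num_vars x"
  unfolding var_cell_def num_vars_def by (intro mixed_radix_less)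

definition computation_assignment :: "bool list \<Rightarrow> bool list \<Rightarrow> nat \<Rightarrow> bool" where
  "computation_assignment x u v \<longleftrightarrow>
    (let n = T x; s = v mod S; v1 = v div S; P = v1 mod (2 * n + 3); v2 = v1 div (2 * n + 3);
       t = v2 mod (n + 1); \<tau> = v2 div (n + 1)
     in cell (run x u t) \<tau> (int P - int (n + 1)) = s)"

lemma computation_assignment:
  assumes "s < S" "P < 2 * T x + 3" "t < T x + 1"
  shows "computation_assignment x u (var_cell (T x) \<tau> t P s) \<longleftrightarrow>
    cell (run x u t) \<tau> (int P - int (T x + 1)) = s"
  unfolding computation_assignment_def var_cell_def Let_def
    mixed_radix_decode[OF assms(1)] mixed_radix_decode[OF assms(2)] mixed_radix_decode[OF assms(3)] ..

text \<open>
  Kinds of clauses: 0 is a transition, 1 and 2 describe the initial contents (kind 2 says that the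
  cells after a blank cell of the certificate are blank), 3 is acceptance. Clauses of kind 0 say: if the
  heads read \<open>vectors ! \<iota>\<close> and tape \<open>\<tau>\<close> contains \<open>s\<close> in some cell, then the contents of that cell
  after the step are as determined by the transition function. Literals beyond the ones needed repeat
  the last one, and all clauses are indexed by the same parameters, whether they use them or not.
\<close>

definition in_certificate :: "bool list \<Rightarrow> nat \<Rightarrow> nat \<Rightarrow> bool" where
  "in_certificate x \<tau> D \<longleftrightarrow> \<tau> = 1 \<and> T x \<le> D \<and> D < T x + Q x"

text \<open>Clauses speak of the cells \<open>P = D + 1\<close> with \<open>D < 2 * T x + 1\<close>,
  which leaves a margin of one cell on both sides for head moves.
  \<open>D + 2 - nat (shift + 1)\<close> is \<open>D + 1\<close> minus the shift, written without
  negative numbers, and \<open>D = T x\<close> is the cell under the head. \<open>mod S\<close>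
  keeps variables in range for vectors that no valid configuration reads; it does not change the
  symbols written from a valid configuration.\<close>

definition literal_var :: "bool list \<Rightarrow> nat \<Rightarrow> nat \<Rightarrow> nat \<Rightarrow> nat \<Rightarrow> nat \<Rightarrow> nat \<Rightarrow> nat \<Rightarrow> nat" where
  "literal_var x k s \<iota> \<tau> D t l =
    (if k = 0 then
       if l < K + 1 then var_cell (T x) (min l K) t (T x + 1) (vectors ! \<iota> ! min l K)
       else if l = K + 1 then var_cell (T x) \<tau> t (D + 1) s
       else var_cell (T x) \<tau> (t + 1) (D + 2 - nat (shift (vectors ! \<iota>) \<tau> + 1))
         (if D = T x then written (vectors ! \<iota>) \<tau> mod S else s)
     else if k = 3 then var_cell (T x) K (T x) (T x + 1) s
     else if in_certificate x \<tau> D then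
       if k = 1 then var_cell (T x) 1 0 (D + 1) (min l 2)
       else if l = 0 then var_cell (T x) 1 0 (D + 1) 0 else var_cell (T x) 1 0 (D + 2) 0
     else var_cell (T x) \<tau> 0 (D + 1) (if \<tau> = 0 \<and> T x \<le> D then symbol x (D - T x) else 0))"

text \<open>A clause of kind 0 is an implication with the negative literals as premises. Kind 3
  asserts state 1 and denies every other state.\<close>

definition literal_sign :: "bool list \<Rightarrow> nat \<Rightarrow> nat \<Rightarrow> nat \<Rightarrow> nat \<Rightarrow> nat \<Rightarrow> bool" where
  "literal_sign x k s \<tau> D l =
    (if k = 0 then K + 2 \<le> l else if k = 3 then s = 1
     else if in_certificate x \<tau> D then k = 1 \<or> l \<noteq> 0 else True)"

text \<open>Kind 0 needs \<open>K + 3\<close> literals; \<open>2 * K + 5\<close> is large enough and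
  odd for every \<open>K\<close>.\<close>

definition "width = 2 * K + 5"

definition num_clauses :: "bool list \<Rightarrow> nat" where
  "num_clauses x = 4 * (S * (NV * ((K + 1) * ((2 * T x + 1) * T x))))"

definition clause_var :: "bool list \<Rightarrow> nat \<Rightarrow> nat \<Rightarrow> nat" where
  "clause_var x c l =
    literal_var x (c mod 4) (c div 4 mod S) (c div 4 div S mod NV) (c div 4 div S div NV mod (K + 1))
      (c div 4 div S div NV div (K + 1) mod (2 * T x + 1))
      (c div 4 div S div NV div (K + 1) div (2 * T x + 1) mod T x) l"

definition clause_sign :: "bool list \<Rightarrow> nat \<Rightarrow> nat \<Rightarrow> bool" where
  "clause_sign x c l =
    literal_sign x (c mod 4) (c div 4 mod S) (c div 4 div S div NV mod (K + 1))
      (c div 4 div S div NV div (K + 1) mod (2 * T x + 1)) l"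

lemma T_pos: "0 < T x"
  by (simp add: T_def)

lemma written_less: "written v \<tau> mod S < S"
  using S_ge by simp

lemma symbol_less: "symbol w i < S"
  using S_ge by (auto simp: symbol_def bit_symbol_def)

lemma literal_var_less:
  assumes "s < S" "\<iota> < NV" "\<tau> < K + 1" "D < 2 * T x + 1" "t < T x"
  shows "literal_var x k s \<iota> \<tau> D t l < num_vars x"
proof -
  have "vectors ! \<iota> \<in> set vectors" using assms(2) by (simp add: NV_def)
  then have "set (vectors ! \<iota>) \<subseteq> {..<S}" "length (vectors ! \<iota>) = K + 1" by (simp_all add: set_vectors)
  then have vl: "length (vectors ! \<iota>) = K + 1" and vsub: "set (vectors ! \<iota>) \<subseteq> {..<S}" by blast+
  have "vectors ! \<iota> ! min l K \<in> set (vectors ! \<iota>)" by (rule nth_mem) (simp add: vl)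
  then have "vectors ! \<iota> ! min l K < S" using vsub by blast
  then have "var_cell (T x) (min l K) t (T x + 1) (vectors ! \<iota> ! min l K) < num_vars x"
    by (rule var_cell_less) (use assms in simp_all)
  moreover have "var_cell (T x) \<tau> t (D + 1) s < num_vars x"
    by (rule var_cell_less) (use assms in simp_all)
  moreover have "(if D = T x then written (vectors ! \<iota>) \<tau> mod S else s) < S"
    using assms(1) written_less by simp
  then have "var_cell (T x) \<tau> (t + 1) (D + 2 - nat (shift (vectors ! \<iota>) \<tau> + 1))
      (if D = T x then written (vectors ! \<iota>) \<tau> mod S else s) < num_vars x"
    by (rule var_cell_less) (use assms in simp_all)
  moreover have "var_cell (T x) K (T x) (T x + 1) s < num_vars x"
    by (rule var_cell_less) (use assms in simp_all)
  moreover have "var_cell (T x) 1 0 (D + 1) (min l 2) < num_vars x" "var_cell (T x) 1 0 (D + 1) 0 < num_vars x"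
    "var_cell (T x) 1 0 (D + 2) 0 < num_vars x"
    by (rule var_cell_less; use assms S_ge K_ge in simp)+
  moreover have "(if \<tau> = 0 \<and> T x \<le> D then symbol x (D - T x) else 0) < S"
    using symbol_less[of x] S_ge by simp
  then have "var_cell (T x) \<tau> 0 (D + 1) (if \<tau> = 0 \<and> T x \<le> D then symbol x (D - T x) else 0) < num_vars x"
    by (rule var_cell_less) (use assms in simp_all)
  ultimately show ?thesis
    unfolding literal_var_def by presburger
qed

lemma gadget_clauses: "gadget (num_vars x) (num_clauses x) width (clause_var x)"
proof
  show "0 < num_clauses x" using S_ge NV_pos T_pos by (simp add: num_clauses_def)
  show "odd width" by (simp add: width_def)
  show "clause_var x c l < num_vars x" for c l
    unfolding clause_var_def
    using S_ge NV_pos T_pos by (intro literal_var_less mod_less_divisor) simp_all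
qed

definition satisfied :: "(nat \<Rightarrow> bool) \<Rightarrow> bool list \<Rightarrow> nat \<Rightarrow> nat \<Rightarrow> nat \<Rightarrow> nat \<Rightarrow> nat \<Rightarrow> nat \<Rightarrow> bool" where
  "satisfied \<alpha> x k s \<iota> \<tau> D t \<longleftrightarrow>
    (\<exists>l<width. \<alpha> (literal_var x k s \<iota> \<tau> D t l) = literal_sign x k s \<tau> D l)"

lemma satisfies_all_iff:
  "(\<forall>c<num_clauses x. \<exists>l<width. \<alpha> (clause_var x c l) = clause_sign x c l) \<longleftrightarrow>
    (\<forall>k<4. \<forall>s<S. \<forall>\<iota><NV. \<forall>\<tau><K + 1. \<forall>D<2 * T x + 1. \<forall>t<T x. satisfied \<alpha> x k s \<iota> \<tau> D t)"
proof
  assume L: "\<forall>c<num_clauses x. \<exists>l<width. \<alpha> (clause_var x c l) = clause_sign x c l"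
  show "\<forall>k<4. \<forall>s<S. \<forall>\<iota><NV. \<forall>\<tau><K + 1. \<forall>D<2 * T x + 1. \<forall>t<T x. satisfied \<alpha> x k s \<iota> \<tau> D t"
  proof (intro allI impI)
    fix k s \<iota> \<tau> D t assume *: "k < (4::nat)" "s < S" "\<iota> < NV" "\<tau> < K + 1" "D < 2 * T x + 1" "t < T x"
    let ?c = "k + 4 * (s + S * (\<iota> + NV * (\<tau> + (K + 1) * (D + (2 * T x + 1) * t))))"
    have "?c < num_clauses x" unfolding num_clauses_def by (intro mixed_radix_less *)
    then have "\<exists>l<width. \<alpha> (clause_var x ?c l) = clause_sign x ?c l" using L by blast
    then show "satisfied \<alpha> x k s \<iota> \<tau> D t"
      unfolding clause_var_def clause_sign_def satisfied_def
        mixed_radix_decode[OF *(1)] mixed_radix_decode[OF *(2)] mixed_radix_decode[OF *(3)]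
        mixed_radix_decode[OF *(4)] mixed_radix_decode[OF *(5)] mod_less[OF *(6)] .
  qed
next
  assume R: "\<forall>k<4. \<forall>s<S. \<forall>\<iota><NV. \<forall>\<tau><K + 1. \<forall>D<2 * T x + 1. \<forall>t<T x. satisfied \<alpha> x k s \<iota> \<tau> D t"
  show "\<forall>c<num_clauses x. \<exists>l<width. \<alpha> (clause_var x c l) = clause_sign x c l"
    unfolding clause_var_def clause_sign_def satisfied_def[symmetric]
    using S_ge NV_pos T_pos by (intro allI impI R[rule_format] mod_less_divisor) simp_all
qed

text \<open>A clause of kind 0 holds since either a premise fails or the step determines the new
  contents. The bound on \<open>u\<close> makes the cells of tape 1 behind the certificate area
  blank, as the initial clauses demand.\<close>

lemma computation_satisfies:
  assumes u: "length u \<le> Q x" and acc: "accepting (run x u (T x))"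
    and *: "k < 4" "s < S" "\<iota> < NV" "\<tau> < K + 1" "D < 2 * T x + 1" "t < T x"
  shows "satisfied (computation_assignment x u) x k s \<iota> \<tau> D t"
proof -
  let ?\<alpha> = "computation_assignment x u" and ?n = "T x"
  have v: "vectors ! \<iota> \<in> set vectors" using *(3) by (simp add: NV_def)
  then have vl: "length (vectors ! \<iota>) = K + 1" and vsub: "set (vectors ! \<iota>) \<subseteq> {..<S}"
    by (simp_all add: set_vectors)
  have vS: "vectors ! \<iota> ! l < S" if "l < K + 1" for l
  proof -
    have "vectors ! \<iota> ! l \<in> set (vectors ! \<iota>)" by (rule nth_mem) (use vl that in simp)
    then show ?thesis using vsub by blast
  qed
  consider "k = 0" | "k = 3" | "k \<noteq> 0" "k \<noteq> 3" "in_certificate x \<tau> D" | "k \<noteq> 0" "k \<noteq> 3" "\<not> in_certificate x \<tau> D"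
    by blast
  then show ?thesis
  proof cases
    case 1
    show ?thesis
    proof (cases "\<forall>l<K + 1. ?\<alpha> (literal_var x k s \<iota> \<tau> D t l)")
      case False
      then obtain l where l: "l < K + 1" "\<not> ?\<alpha> (literal_var x k s \<iota> \<tau> D t l)" by blast
      then show ?thesis
        unfolding satisfied_def by (intro exI[of _ l]) (simp add: 1 literal_sign_def width_def)
    next
      case all: True
      show ?thesis
      proof (cases "?\<alpha> (literal_var x k s \<iota> \<tau> D t (K + 1))")
        case False
        then show ?thesis
          unfolding satisfied_def by (intro exI[of _ "K + 1"]) (simp add: 1 literal_sign_def width_def)
      next
        case True
        let ?c = "run x u t"
        have "cell ?c l 0 = vectors ! \<iota> ! l" if l: "l < K + 1" for l
        proof -
          have "?\<alpha> (var_cell ?n l t (?n + 1) (vectors ! \<iota> ! l))"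
          proof -
            have "?\<alpha> (literal_var x k s \<iota> \<tau> D t l)" using all l by blast
            then show ?thesis unfolding literal_var_def using 1 l by (simp add: min_absorb1)
          qed
          then show ?thesis using computation_assignment[of "vectors ! \<iota> ! l" "?n + 1" x t u l] vS[OF l] *(6) by simp
        qed
        then have h: "heads ?c = vectors ! \<iota>"
          using vl by (intro nth_equalityI) (simp_all add: heads_def del: upt_Suc)
        have "?\<alpha> (var_cell ?n \<tau> t (D + 1) s)"
          using True 1 by (simp add: literal_var_def)
        then have s: "cell ?c \<tau> (int D - int ?n) = s"
          using computation_assignment[of s "D + 1" x t u \<tau>] * by simp
        let ?sh = "shift (vectors ! \<iota>) \<tau>"
        have \<tau>: "\<tau> \<le> K" using *(4) by simp
        have st: "cell (run x u (Suc t)) \<tau> (int D - int ?n - ?sh) =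
            (if D = ?n then written (vectors ! \<iota>) \<tau> else s)"
          using cell_step[OF valid_run[of t x u] \<tau>, of "int D - int ?n"] s unfolding run_Suc h by simp
        then have w: "(if D = ?n then written (vectors ! \<iota>) \<tau> mod S else s) =
           cell (run x u (Suc t)) \<tau> (int D - int ?n - ?sh)"
          using cell_less[OF valid_run \<tau>, of "Suc t" x u "int D - int ?n - ?sh"] by auto
        \<comment> \<open>The subtraction is not truncated, as \<open>?sh + 1\<close> is at most
          2.\<close>
        have P: "int (D + 2 - nat (?sh + 1)) - int (?n + 1) = int D - int ?n - ?sh"
          "D + 2 - nat (?sh + 1) < 2 * ?n + 3"
          using shift_cases[of "vectors ! \<iota>" \<tau>] *(5) by auto
        have "?\<alpha> (var_cell ?n \<tau> (t + 1) (D + 2 - nat (?sh + 1))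
            (if D = ?n then written (vectors ! \<iota>) \<tau> mod S else s))"
          unfolding w
        proof (rule computation_assignment[THEN iffD2])
          show "cell (run x u (Suc t)) \<tau> (int D - int ?n - ?sh) < S" by (rule cell_less[OF valid_run \<tau>])
          show "t + 1 < ?n + 1" using *(6) by simp
          show "cell (run x u (t + 1)) \<tau> (int (D + 2 - nat (?sh + 1)) - int (?n + 1)) =
              cell (run x u (Suc t)) \<tau> (int D - int ?n - ?sh)"
            unfolding P(1) by simp
        qed (rule P(2))
        then have "?\<alpha> (literal_var x k s \<iota> \<tau> D t (K + 2))"
          using 1 unfolding literal_var_def by (cases "D = ?n") simp_all
        then show ?thesis
          unfolding satisfied_def by (intro exI[of _ "K + 2"]) (simp add: 1 literal_sign_def width_def)
      qed
    qed
  next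
    case 2
    have "cell (run x u ?n) K 0 = 1" using acc by (simp add: cell_def accepting_def)
    then have "?\<alpha> (var_cell ?n K ?n (?n + 1) s) \<longleftrightarrow> s = 1"
      using computation_assignment[of s "?n + 1" x ?n u K] *(2) by auto
    then show ?thesis
      unfolding satisfied_def by (intro exI[of _ 0]) (simp add: 2 literal_sign_def literal_var_def width_def)
  next
    case 3
    then have d: "\<tau> = 1" "?n \<le> D" "D < ?n + Q x" by (simp_all add: in_certificate_def)
    let ?i = "D - ?n"
    have c0: "?\<alpha> (var_cell ?n 1 0 (D + 1) r) \<longleftrightarrow> symbol u ?i = r" if "r < S" for r
      using computation_assignment[of r "D + 1" x 0 u 1] that *(5) d K_ge
      by (simp add: cell_run_0 nat_diff_distrib)
    have c1: "?\<alpha> (var_cell ?n 1 0 (D + 2) 0) \<longleftrightarrow> symbol u (Suc ?i) = 0"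
      using computation_assignment[of 0 "D + 2" x 0 u 1] *(2,5) d K_ge
      by (simp add: cell_run_0 nat_diff_distrib Suc_diff_le nat_add_distrib)
    have sy: "symbol u ?i < 3" by (simp add: symbol_def bit_symbol_def)
    show ?thesis
    proof (cases "k = 1")
      case True
      have "?\<alpha> (literal_var x k s \<iota> \<tau> D t (symbol u ?i))"
        using True 3 sy c0[of "symbol u ?i"] S_ge by (simp add: literal_var_def)
      then show ?thesis
        unfolding satisfied_def using True sy 3
        by (intro exI[of _ "symbol u ?i"]) (simp add: literal_sign_def width_def)
    next
      case False
      show ?thesis
      proof (cases "symbol u ?i = 0")
        case True
        then have "symbol u (Suc ?i) = 0" by (auto simp: symbol_def bit_symbol_def split: if_splits)
        then show ?thesis
          unfolding satisfied_def using False 3 c1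
          by (intro exI[of _ 1]) (simp add: literal_sign_def literal_var_def width_def)
      next
        case ne: False
        then show ?thesis
          unfolding satisfied_def using False 3 c0[of 0] S_ge
          by (intro exI[of _ 0]) (simp add: literal_sign_def literal_var_def width_def)
      qed
    qed
  next
    case 4
    let ?r = "if \<tau> = 0 \<and> ?n \<le> D then symbol x (D - ?n) else 0"
    have "cell (run x u 0) \<tau> (int (D + 1) - int (?n + 1)) = ?r"
    proof -
      have "symbol u (D - ?n) = 0" if "\<tau> = 1" "?n \<le> D"
        using that 4 u by (simp add: symbol_def in_certificate_def)
      then show ?thesis using cell_run_0[of \<tau> x u "int D - int ?n"] *(4)
        by (simp add: nat_diff_distrib flip: of_nat_diff)
    qed
    then have "?\<alpha> (var_cell ?n \<tau> 0 (D + 1) ?r)"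
      using computation_assignment[of ?r "D + 1" x 0 u \<tau>] *(5) symbol_less S_ge by simp
    then show ?thesis
      unfolding satisfied_def using 4
      by (intro exI[of _ 0]) (simp add: literal_sign_def literal_var_def width_def)
  qed
qed

text \<open>\<open>\<alpha>\<close> may be inconsistent, as no clause forbids two symbols in one
  cell. It is enough that, for the certificate read off from time 0, every variable that describes
  the actual run is true; the clauses of kind 3 then rule out any final state but 1.\<close>

lemma accepting_of_satisfying:
  assumes sat: "\<And>k s \<iota> \<tau> D t. k < 4 \<Longrightarrow> s < S \<Longrightarrow> \<iota> < NV \<Longrightarrow> \<tau> < K + 1 \<Longrightarrow> D < 2 * T x + 1 \<Longrightarrow> t < T x \<Longrightarrow>
      satisfied \<alpha> x k s \<iota> \<tau> D t"
  shows "\<exists>u. length u \<le> Q x \<and> accepting (run x u (T x))"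
proof -
  let ?n = "T x"
  have pos: "0 < S" "0 < NV" "0 < ?n" using S_ge NV_pos T_pos by simp_all
  have QT: "Q x < ?n" by (simp add: T_def)
  let ?b = "\<lambda>i. \<alpha> (var_cell ?n 1 0 (?n + i + 1) 0)"
  \<comment> \<open>The certificate ends at the first cell that \<open>\<alpha>\<close> calls blank;
    if there is none, it has the full length \<open>Q x\<close>.\<close>
  define z where "z = (LEAST i. i = Q x \<or> ?b i)"
  have z: "z = Q x \<or> ?b z" unfolding z_def by (rule LeastI[of _ "Q x"]) simp
  have zQ: "z \<le> Q x" unfolding z_def by (rule Least_le) simp
  have before: "\<not> ?b i" if "i < z" for i using not_less_Least[of i] that unfolding z_def by blast
  have blank: "?b (z + j)" if "z + j < Q x" for j
    using that
  proof (induction j)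
    case 0
    then show ?case using z by simp
  next
    case (Suc j)
    have "satisfied \<alpha> x 2 0 0 1 (?n + (z + j)) 0"
      by (rule sat) (use Suc.prems pos QT K_ge in simp_all)
    moreover have "in_certificate x 1 (?n + (z + j))" using Suc.prems by (simp add: in_certificate_def)
    moreover from calculation(1) obtain l where
      "\<alpha> (literal_var x 2 0 0 1 (?n + (z + j)) 0 l) = literal_sign x 2 0 1 (?n + (z + j)) l"
      unfolding satisfied_def by blast
    ultimately have "\<alpha> (if l = 0 then var_cell ?n 1 0 (?n + (z + j) + 1) 0
        else var_cell ?n 1 0 (?n + (z + j) + 2) 0) = (l \<noteq> 0)"
      unfolding literal_var_def literal_sign_def by simp
    moreover have "?b (z + j)" using Suc by simp
    ultimately have "\<alpha> (var_cell ?n 1 0 (?n + (z + j) + 2) 0)"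
      by (cases "l = 0") (simp_all add: add.assoc)
    then show ?case by (simp add: add.assoc)
  qed
  \<comment> \<open>Before \<open>z\<close> no cell is called blank, so by kind 1 it is said to
    contain 1 or 2; if both are claimed, 2 is preferred.\<close>
  define u where "u = map (\<lambda>i. \<alpha> (var_cell ?n 1 0 (?n + i + 1) 2)) [0..<z]"
  have lu: "length u = z" by (simp add: u_def)
  have init: "\<alpha> (var_cell ?n \<tau> 0 (D + 1) (cell (run x u 0) \<tau> (int D - int ?n)))"
    if \<tau>: "\<tau> < K + 1" and D: "D < 2 * ?n + 1" for \<tau> D
  proof -
    have sa: "satisfied \<alpha> x 1 0 0 \<tau> D 0" by (rule sat) (use pos \<tau> D in simp_all)
    show ?thesis
    proof (cases "in_certificate x \<tau> D")
      case True
      then have d: "\<tau> = 1" "?n \<le> D" "D < ?n + Q x" by (simp_all add: in_certificate_def)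
      define i where "i = D - ?n"
      have i: "D = ?n + i" "i < Q x" using d by (simp_all add: i_def)
      obtain l where l: "\<alpha> (var_cell ?n 1 0 (?n + i + 1) (min l 2))"
        using sa True unfolding satisfied_def by (auto simp: literal_var_def literal_sign_def i(1))
      have c: "cell (run x u 0) \<tau> (int D - int ?n) = symbol u i"
        using \<tau> by (simp add: cell_run_0 d(1) i(1))
      have "\<alpha> (var_cell ?n 1 0 (?n + i + 1) (symbol u i))"
      proof (cases "i < z")
        case True
        then have si: "symbol u i = (if \<alpha> (var_cell ?n 1 0 (?n + i + 1) 2) then 2 else 1)"
          by (simp add: symbol_def lu bit_symbol_def) (simp add: u_def)
        have "min l 2 \<noteq> 0" using l before[OF True] by metis
        then have "min l 2 = 1 \<or> min l 2 = 2" by (simp add: min_def split: if_splits) linarith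
        then show ?thesis unfolding si using l by auto
      next
        case False
        then show ?thesis using blank[of "i - z"] i by (simp add: symbol_def lu)
      qed
      then show ?thesis unfolding c using d i by simp
    next
      case False
      let ?r = "if \<tau> = 0 \<and> ?n \<le> D then symbol x (D - ?n) else 0"
      have "\<alpha> (var_cell ?n \<tau> 0 (D + 1) ?r)"
        using sa False unfolding satisfied_def by (simp add: literal_var_def literal_sign_def)
      moreover have "cell (run x u 0) \<tau> (int D - int ?n) = ?r"
      proof -
        have "symbol u (D - ?n) = 0" if "\<tau> = 1" "?n \<le> D"
          using that False zQ lu by (simp add: symbol_def in_certificate_def)
        then show ?thesis using cell_run_0[of \<tau> x u "int D - int ?n"] \<tau>
          by (simp add: nat_diff_distrib flip: of_nat_diff)
      qed
      ultimately show ?thesis by simp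
    qed
  qed
  \<comment> \<open>A head moves by at most one cell per step, so the offsets under control shrink
    by one on each side per step. At time \<open>?n\<close> the cell under the head is still among
    them.\<close>
  have main: "\<alpha> (var_cell ?n \<tau> t (D + 1) (cell (run x u t) \<tau> (int D - int ?n)))"
    if "t \<le> ?n" "\<tau> < K + 1" "abs (int D - int ?n) \<le> int ?n - int t" for t \<tau> D
    using that
  proof (induction t arbitrary: \<tau> D)
    case 0
    then show ?case using init[of \<tau> D] by simp
  next
    case (Suc t)
    let ?c = "run x u t"
    obtain \<iota> where \<iota>: "\<iota> < NV" "vectors ! \<iota> = heads ?c" using ex_vector[OF valid_run] by blast
    let ?sh = "shift (heads ?c) \<tau>"
    have \<tau>: "\<tau> \<le> K" using Suc.prems(2) by simp
    \<comment> \<open>The index before the step of the cell that has index \<open>D\<close> after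
      it.\<close>
    define E where "E = nat (int D + ?sh)"
    have E: "int E = int D + ?sh" "E < 2 * ?n + 1" "abs (int E - int ?n) \<le> int ?n - int t"
      using Suc.prems(1,3) shift_cases[of "heads ?c" \<tau>] unfolding E_def by auto
    let ?s = "cell ?c \<tau> (int E - int ?n)"
    have "satisfied \<alpha> x 0 ?s \<iota> \<tau> E t"
      by (rule sat) (use Suc.prems \<iota> E \<tau> cell_less[OF valid_run] in simp_all)
    then obtain l where l: "\<alpha> (literal_var x 0 ?s \<iota> \<tau> E t l) = (K + 2 \<le> l)"
      unfolding satisfied_def by (auto simp: literal_sign_def)
    have "K + 2 \<le> l"
    proof (rule ccontr)
      assume nl: "\<not> K + 2 \<le> l"
      show False
      proof (cases "l < K + 1")
        case True
        have "heads ?c ! l = cell ?c l 0" using True by (simp add: heads_def del: upt_Suc)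
        then have "\<alpha> (var_cell ?n l t (?n + 1) (heads ?c ! l))"
          using Suc.IH[of l ?n] Suc.prems True by simp
        then show False using l nl True \<iota>(2) by (simp add: literal_var_def)
      next
        case False
        then have "l = K + 1" using nl by simp
        then show False using l Suc.IH[OF _ Suc.prems(2) E(3)] Suc.prems(1) by (simp add: literal_var_def)
      qed
    qed
    then have "\<alpha> (var_cell ?n \<tau> (t + 1) (E + 2 - nat (?sh + 1))
        (if E = ?n then written (heads ?c) \<tau> mod S else ?s))"
      using l unfolding literal_var_def \<iota>(2) by (cases "E = ?n") simp_all
    moreover have "E + 2 - nat (?sh + 1) = D + 1"
      using E(1) shift_cases[of "heads ?c" \<tau>] by auto
    moreover have "(if E = ?n then written (heads ?c) \<tau> mod S else ?s) = cell (run x u (Suc t)) \<tau> (int D - int ?n)"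
    proof -
      have eq: "int E - int ?n - ?sh = int D - int ?n" using E(1) by simp
      have "cell (run x u (Suc t)) \<tau> (int D - int ?n) = (if E = ?n then written (heads ?c) \<tau> else ?s)"
        using cell_step[OF valid_run[of t x u] \<tau>, of "int E - int ?n"] unfolding run_Suc eq
        by (cases "E = ?n") simp_all
      moreover have "cell (run x u (Suc t)) \<tau> (int D - int ?n) < S" by (rule cell_less[OF valid_run \<tau>])
      ultimately show ?thesis by auto
    qed
    ultimately show ?case by simp
  qed
  let ?s = "cell (run x u ?n) K 0"
  have "\<alpha> (var_cell ?n K ?n (?n + 1) ?s)" using main[of ?n K ?n] by simp
  \<comment> \<open>The parameter is the actual final state: were it not 1, this clause would deny a
    variable just shown to be true.\<close>
  moreover have "satisfied \<alpha> x 3 ?s 0 0 0 0"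
    by (rule sat) (use pos cell_less[OF valid_run] in simp_all)
  ultimately have "?s = 1" unfolding satisfied_def by (auto simp: literal_var_def literal_sign_def)
  then have "accepting (run x u ?n)" by (simp add: cell_def accepting_def)
  then show ?thesis using lu zQ by blast
qed

lemma satisfiable_iff:
  "(\<exists>\<alpha>. \<forall>c<num_clauses x. \<exists>l<width. \<alpha> (clause_var x c l) = clause_sign x c l) \<longleftrightarrow>
    (\<exists>u. length u \<le> Q x \<and> accepting (run x u (T x)))"
  unfolding satisfies_all_iff using computation_satisfies accepting_of_satisfying by meson

section \<open>Computability of the clauses\<close>

lemma computable_T:
  assumes "\<And>c. W c False = X c"
  shows "computable W \<Gamma> (\<lambda>c. T (X c))" "computable W \<Gamma> (\<lambda>c. Q (X c))"
proof -
  have "computable W \<Gamma> (\<lambda>c. length (W c False))" by (rule computable_length)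
  then have 1: "computable W \<Gamma> (\<lambda>c. length (X c))" unfolding assms .
  then show 2: "computable W \<Gamma> (\<lambda>c. Q (X c))" unfolding Q_def by (rule computable_poly)
  show "computable W \<Gamma> (\<lambda>c. T (X c))"
    unfolding T_def by (intro computable_Suc computable_add computable_poly 1 2)
qed

lemma computable_clause_var:
  assumes X: "\<And>c. W c False = X c" and C: "computable W \<Gamma> C" and D: "computable W \<Gamma> D"
  shows "computable W \<Gamma> (\<lambda>p. clause_var (X p) (C p) (D p))"
proof -
  note T = computable_T[where W = W and X = X, OF X]
  have sym: "computable W \<Gamma> (\<lambda>c. symbol (X c) (F c))" if "computable W \<Gamma> F" for F
    using computable_symbol[OF that, of False] unfolding X .
  \<comment> \<open>Naming these indices exposes their constant bounds, so that
    \<open>vectors\<close> and the transition function become finite tables.\<close>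
  define \<iota> where "\<iota> p = C p div 4 div S mod NV" for p
  define \<tau> where "\<tau> p = C p div 4 div S div NV mod (K + 1)" for p
  have \<iota>: "computable W \<Gamma> \<iota>" "\<And>p. \<iota> p < NV"
    unfolding \<iota>_def by (rule computable_mod computable_div computable_const C)+ (simp add: NV_pos)
  have \<tau>: "computable W \<Gamma> \<tau>" "\<And>p. \<tau> p < K + 1"
    unfolding \<tau>_def by (rule computable_mod computable_div computable_const C)+ simp
  have l: "computable W \<Gamma> (\<lambda>p. min (D p) K)" "\<And>p. min (D p) K < K + 1"
    by (rule computable_min computable_const D)+ simp
  note tab = computable_table2[OF \<iota>(1) l(1) \<iota>(2) l(2), where f = "\<lambda>i j. vectors ! i ! j"]
    computable_table2[OF \<iota>(1) \<tau>(1) \<iota>(2) \<tau>(2), where f = "\<lambda>i j. nat (shift (vectors ! i) j + 1)"]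
    computable_table2[OF \<iota>(1) \<tau>(1) \<iota>(2) \<tau>(2), where f = "\<lambda>i j. written (vectors ! i) j mod S"]
  show ?thesis
    unfolding clause_var_def \<iota>_def[symmetric] \<tau>_def[symmetric] literal_var_def var_cell_def in_certificate_def
    by (intro computable_if decidable_conj decidable_eq decidable_le decidable_less tab \<tau>(1) T sym
        computable_add computable_sub computable_mult computable_min computable_mod computable_div
        computable_const C D)
qed

lemma decidable_clause_sign:
  assumes X: "\<And>c. W c False = X c" and C: "computable W \<Gamma> C" and D: "computable W \<Gamma> D"
  shows "decidable W \<Gamma> (\<lambda>p. clause_sign (X p) (C p) (D p))"
proof -
  note T = computable_T[where W = W and X = X, OF X]
  have "decidable W \<Gamma> (\<lambda>p. True)"
    using decidable_eq[OF C C] by simp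
  then show ?thesis
    unfolding clause_sign_def literal_sign_def in_certificate_def
    by (intro decidable_if decidable_conj decidable_disj decidable_not decidable_eq decidable_le decidable_less T
        computable_add computable_mult computable_mod computable_div computable_const C D)
qed

lemma computable_num: "computable (\<lambda>x b. if b then [] else x) [] num_vars"
  "computable (\<lambda>x b. if b then [] else x) [] num_clauses"
proof -
  have T: "computable (\<lambda>x b. if b then [] else x) [] T"
    using computable_T(1)[of "\<lambda>x b. if b then [] else x" "\<lambda>x. x" "[]"] by simp
  show "computable (\<lambda>x b. if b then [] else x) [] num_vars"
    "computable (\<lambda>x b. if b then [] else x) [] num_clauses"
    unfolding num_vars_def num_clauses_def
    by (intro computable_add computable_mult computable_const T)+
qed

lemma reduction:
  "\<exists>f. polytime_computable f \<and> (\<forall>x. f x \<in> line_graph_instances \<and>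
     (f x \<in> Odd_Cycle_Transversal \<longleftrightarrow> (\<exists>u. length u \<le> Q x \<and> accepting (run x u (T x)))))"
  unfolding satisfiable_iff[symmetric]
proof (rule reduction_from_satisfiability[OF computable_num])
  show "computable (\<lambda>p b. if b then [] else snd p) [fst] (\<lambda>p. clause_var (snd p) (C p) (D p))"
    "decidable (\<lambda>p b. if b then [] else snd p) [fst] (\<lambda>p. clause_sign (snd p) (C p) (D p))"
    if "computable (\<lambda>p b. if b then [] else snd p) [fst] C" "computable (\<lambda>p b. if b then [] else snd p) [fst] D"
    for C D :: "nat \<times> bool list \<Rightarrow> nat"
    using that by (auto intro!: computable_clause_var decidable_clause_sign)
  show "gadget (num_vars x) (num_clauses x) width (clause_var x)" for x
    by (rule gadget_clauses)
qed

end

text \<open>The running time of the verifier depends on the certificate. Since halted configurations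
  persist, all runs with \<open>length u \<le> Q x\<close> can be inspected at the common time
  \<open>T x\<close>.\<close>

lemma NP_hard:
  assumes "A \<in> NP"
  shows "\<exists>f. polytime_computable f \<and> (\<forall>x. f x \<in> line_graph_instances \<and> (x \<in> A \<longleftrightarrow> f x \<in> Odd_Cycle_Transversal))"
proof -
  obtain M p q where M: "wf_tm M" "2 \<le> num_tapes M"
    and halt: "\<And>x u. halted (tm_run M (poly p (length x + length u)) (initial_config M [x, u]))"
    and A: "\<And>x. x \<in> A \<longleftrightarrow> (\<exists>u. length u \<le> poly q (length x) \<and>
       accepting (tm_run M (poly p (length x + length u)) (initial_config M [x, u])))"
    using assms unfolding NP_def by blast
  interpret verifier M p q by unfold_locales (rule M)+
  have A': "x \<in> A \<longleftrightarrow> (\<exists>u. length u \<le> Q x \<and> accepting (run x u (T x)))" for x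
  proof -
    have "run x u (T x) = run x u (poly p (length x + length u))" if "length u \<le> Q x" for u
    proof (rule tm_run_halted[OF halt])
      have "poly p (length x + length u) \<le> poly p (length x + Q x)"
        by (rule poly_nat_mono) (use that in simp)
      then show "poly p (length x + length u) \<le> T x" by (simp add: T_def)
    qed
    then show ?thesis unfolding A Q_def by metis
  qed
  obtain f where "polytime_computable f" "\<And>x. f x \<in> line_graph_instances \<and>
     (f x \<in> Odd_Cycle_Transversal \<longleftrightarrow> (\<exists>u. length u \<le> Q x \<and> accepting (run x u (T x))))"
    using reduction by blast
  then show ?thesis unfolding A' by blast
qed


section \<open>Verification of certificates\<close>

lemma sum_of_bool_eq_card: "(\<Sum>i<n. of_bool (P i)) = card {i. i < n \<and> P i}" for n :: nat
proof -
  have "{..<n} \<inter> {i. P i} = {i. i < n \<and> P i}" by auto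
  then show ?thesis by simp
qed

lemma binary_binary_value: "w = [] \<or> last w \<Longrightarrow> binary (binary_value w) = w"
proof (induction w)
  case Nil
  then show ?case by (simp add: binary.simps)
next
  case (Cons b w)
  show ?case
  proof (cases "w = []")
    case True
    then have b using Cons.prems by simp
    then show ?thesis using True by (simp add: binary.simps[of "Suc 0"] binary.simps[of 0])
  next
    case False
    then have w: "binary (binary_value w) = w" using Cons by simp
    then have "binary_value w \<noteq> 0" using False by (metis binary.simps)
    then have "binary (binary_value (b # w)) = odd (binary_value (b # w)) # binary (binary_value (b # w) div 2)"
      by (subst binary.simps) simp
    also have "\<dots> = b # w" using w by simp
    finally show ?thesis .
  qed
qed

lemma last_binary: "binary k = [] \<or> last (binary k)"
proof (induction k rule: binary.induct)
  case (1 k)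
  show ?case
  proof (cases "k \<le> 1")
    case True
    then show ?thesis by (cases "k = 0") (auto simp: binary.simps[of k] binary.simps[of 0])
  next
    case False
    then have "binary (k div 2) \<noteq> []" by (subst binary.simps) simp
    then show ?thesis using 1 False by (subst (1 2) binary.simps) simp
  qed
qed

text \<open>For a power of two this is its exponent, hence the position of the digit with this
  weight.\<close>

definition pow2_index :: "nat \<Rightarrow> nat" where
  "pow2_index z = (\<Sum>y<z. of_bool (is_pow2 y))"

lemma pow2_index_eq: "pow2_index z = length (filter is_pow2 [0..<z])"
  unfolding pow2_index_def by (induction z) auto

lemma length_binary: "length (binary k) = pow2_index (k + 1)"
  unfolding pow2_index_eq binary_eq_map by simp

lemma pow2_index_1: "pow2_index 1 = 0"
  by (simp add: pow2_index_eq)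

lemma pow2_index_double: "0 < y \<Longrightarrow> pow2_index (2 * y) = Suc (pow2_index y)"
proof -
  assume "0 < y"
  then have "0 < 2 * y - 1" "Suc (2 * y - 1) = 2 * y" "Suc ((2 * y - 1) div 2) = y" by simp_all
  then show ?thesis using filter_pow2_upt[of "2 * y - 1"] unfolding pow2_index_eq by simp
qed

text \<open>
  The number with binary representation \<open>w\<close> can be exponential in the size of the input. It
  can be computed only if it has at most as many digits as a number \<open>n\<close> given in unary.
\<close>

definition capped_value :: "nat \<Rightarrow> bool list \<Rightarrow> nat" where
  "capped_value n w =
    (\<Sum>z<n + 1. of_bool (is_pow2 z \<and> symbol w (pow2_index z) = 2) * z)"

lemma sum_filter_upt: "(\<Sum>z<n. of_bool (P z \<and> R z) * g z) = (\<Sum>z\<leftarrow>filter P [0..<n]. of_bool (R z) * g z)"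
  for g :: "nat \<Rightarrow> nat"
  by (induction n) auto

lemma symbol_Cons: "symbol (b # w) (Suc i) = symbol w i" "symbol (b # w) 0 = bit_symbol b"
  by (simp_all add: symbol_def)

lemma capped_value_eq: "length w \<le> length (binary n) \<Longrightarrow> capped_value n w = binary_value w"
proof (induction w arbitrary: n)
  case Nil
  then show ?case by (simp add: capped_value_def symbol_def)
next
  case (Cons b w)
  have n: "0 < n" using Cons.prems by (cases "n = 0") (simp_all add: binary.simps[of 0])
  then have "binary n = odd n # binary (n div 2)" by (subst binary.simps) simp
  then have IH: "capped_value (n div 2) w = binary_value w" using Cons by simp
  let ?g = "\<lambda>z. of_bool (symbol (b # w) (pow2_index z) = 2) * z"
  have "capped_value n (b # w) = (\<Sum>z\<leftarrow>filter is_pow2 [0..<Suc n]. ?g z)"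
    unfolding capped_value_def by (simp only: sum_filter_upt Suc_eq_plus1)
  \<comment> \<open>Weight 1 belongs to the first digit; halving the other weights leads to the
    remaining word and \<open>n div 2\<close>.\<close>
  also have "\<dots> = ?g 1 + (\<Sum>z\<leftarrow>filter is_pow2 [0..<Suc (n div 2)]. ?g (2 * z))"
    unfolding filter_pow2_upt[OF n] by (simp add: comp_def del: upt_Suc)
  also have "?g 1 = of_bool b" unfolding pow2_index_1 symbol_Cons by (simp add: bit_symbol_def)
  also have "map (\<lambda>z. ?g (2 * z)) (filter is_pow2 [0..<Suc (n div 2)]) =
      map (\<lambda>z. 2 * (of_bool (symbol w (pow2_index z) = 2) * z)) (filter is_pow2 [0..<Suc (n div 2)])"
  proof (rule map_cong[OF refl])
    fix z assume "z \<in> set (filter is_pow2 [0..<Suc (n div 2)])"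
    then have "is_pow2 z" by (simp del: upt_Suc)
    then have "0 < z" by (auto simp: is_pow2_def)
    then show "?g (2 * z) = 2 * (of_bool (symbol w (pow2_index z) = 2) * z)"
      by (simp add: pow2_index_double symbol_Cons)
  qed
  also have "sum_list \<dots> = 2 * capped_value (n div 2) w"
    unfolding capped_value_def sum_filter_upt Suc_eq_plus1 by (rule sum_list_const_mult)
  finally show ?case unfolding IH by simp
qed

text \<open>A number with more digits than \<open>n\<close> is larger than \<open>n\<close> and
  hence than \<open>N\<close>; otherwise its capped value is exact.\<close>

lemma le_binary_value_iff:
  assumes "N \<le> n"
  shows "N \<le> k \<longleftrightarrow> pow2_index (n + 1) < length (binary k) \<or> N \<le> capped_value n (binary k)"
proof (cases "pow2_index (n + 1) < length (binary k)")
  case True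
  have "n < k"
  proof (rule ccontr)
    assume "\<not> n < k"
    then have "[0..<n + 1] = [0..<k + 1] @ [k + 1..<n + 1]" using upt_add_eq_append[of 0 "k + 1" "n - k"] by simp
    then have "pow2_index (k + 1) \<le> pow2_index (n + 1)" unfolding pow2_index_eq by simp
    then show False using True by (simp add: length_binary)
  qed
  then show ?thesis using True assms by simp
next
  case False
  then show ?thesis using capped_value_eq[of "binary k" n] by (simp add: length_binary)
qed

definition unary_prefix :: "bool list \<Rightarrow> nat" where
  "unary_prefix x = (\<Sum>i<length x. of_bool (\<forall>j<Suc i. symbol x j = 2))"

lemma symbol_eq_2: "symbol w i = 2 \<longleftrightarrow> i < length w \<and> w ! i"
  by (simp add: symbol_def bit_symbol_def)

lemma unary_prefix_eq: "unary_prefix (replicate n True @ False # ys) = n"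
proof -
  let ?x = "replicate n True @ False # ys"
  have "(\<forall>j<Suc i. symbol ?x j = 2) \<longleftrightarrow> i < n" for i
  proof
    assume *: "\<forall>j<Suc i. symbol ?x j = 2"
    show "i < n"
    proof (rule ccontr)
      assume "\<not> i < n"
      then have "symbol ?x n = 2" using * by simp
      then show False by (simp add: symbol_eq_2 nth_append)
    qed
  qed (auto simp: symbol_eq_2 nth_append less_Suc_eq_le)
  then show ?thesis unfolding unary_prefix_def by (simp only: sum_of_bool_less) simp
qed

lemma unary_prefix_replicate: "unary_prefix (replicate n True) = n"
proof -
  have "(\<Sum>i<n. of_bool (\<forall>j<Suc i. symbol (replicate n True) j = 2)) = (\<Sum>i<n. 1 :: nat)"
    by (rule sum.cong) (auto simp: symbol_eq_2)
  then show ?thesis by (simp add: unary_prefix_def)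
qed

text \<open>
  The certificate consists of the incidence matrix of the root graph (its \<open>n\<close> edges have at
  most \<open>2 * n\<close> end-vertices), the characteristic vector of the transversal and a 2-coloring of the rest.
\<close>

definition adjacency_bit :: "bool list \<Rightarrow> nat \<Rightarrow> nat \<Rightarrow> bool" where
  "adjacency_bit x i j \<longleftrightarrow> symbol x (unary_prefix x + 1 + (i * unary_prefix x + j)) = 2"

definition incidence_bit :: "nat \<Rightarrow> bool list \<Rightarrow> nat \<Rightarrow> nat \<Rightarrow> bool" where
  "incidence_bit n u i c \<longleftrightarrow> symbol u (i * (2 * n) + c) = 2"

definition deleted_bit :: "nat \<Rightarrow> bool list \<Rightarrow> nat \<Rightarrow> bool" where
  "deleted_bit n u i \<longleftrightarrow> symbol u (n * (2 * n) + i) = 2"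

definition color_bit :: "nat \<Rightarrow> bool list \<Rightarrow> nat \<Rightarrow> bool" where
  "color_bit n u i \<longleftrightarrow> symbol u (n * (2 * n) + (n + i)) = 2"

text \<open>In turn: rows are edges, adjacency is that of the line graph, and no two edges are
  parallel. The second condition also forces the adjacency matrix to be symmetric with zero
  diagonal, so it ensures that the input graph is simple.\<close>

definition line_graph_certificate :: "nat \<Rightarrow> (nat \<Rightarrow> nat \<Rightarrow> bool) \<Rightarrow> (nat \<Rightarrow> nat \<Rightarrow> bool) \<Rightarrow> bool" where
  "line_graph_certificate n adj incid \<longleftrightarrow>
    (\<forall>i<n. (\<Sum>c<2 * n. of_bool (incid i c)) = (2::nat)) \<and>
    (\<forall>i<n. \<forall>j<n. adj i j \<longleftrightarrow> i \<noteq> j \<and> (\<exists>c<2 * n. incid i c \<and> incid j c)) \<and>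
    (\<forall>i<n. \<forall>j<n. i \<noteq> j \<longrightarrow> (\<exists>c<2 * n. \<not> (incid i c \<longleftrightarrow> incid j c)))"

definition coloring_certificate :: "nat \<Rightarrow> (nat \<Rightarrow> nat \<Rightarrow> bool) \<Rightarrow> (nat \<Rightarrow> bool) \<Rightarrow> (nat \<Rightarrow> bool) \<Rightarrow> bool" where
  "coloring_certificate n adj del col \<longleftrightarrow>
    (\<forall>i<n. \<forall>j<n. adj i j \<longrightarrow> \<not> del i \<longrightarrow> \<not> del j \<longrightarrow> \<not> (col i \<longleftrightarrow> col j))"

definition budget_bit :: "bool list \<Rightarrow> nat \<Rightarrow> bool" where
  "budget_bit x j \<longleftrightarrow> symbol x (unary_prefix x + 1 + (unary_prefix x * unary_prefix x + j)) = 2"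

definition budget_length :: "bool list \<Rightarrow> nat" where
  "budget_length x = length x - (unary_prefix x + 1 + unary_prefix x * unary_prefix x)"

text \<open>Digits are stored from the least significant one, so the absence of leading zeros means
  that the last digit is True.\<close>

definition well_formed :: "bool list \<Rightarrow> bool" where
  "well_formed x \<longleftrightarrow> unary_prefix x + 1 + unary_prefix x * unary_prefix x \<le> length x \<and>
    (budget_length x = 0 \<or> budget_bit x (budget_length x - 1))"

text \<open>The right-hand side of \<open>le_binary_value_iff\<close>, with the number of vertices
  as \<open>n\<close> and the digits looked up in the input.\<close>

definition within_budget :: "bool list \<Rightarrow> nat \<Rightarrow> bool" where
  "within_budget x N \<longleftrightarrow> pow2_index (unary_prefix x + 1) < budget_length x \<or>
     N \<le> (\<Sum>z<unary_prefix x + 1. of_bool (is_pow2 z \<and> budget_bit x (pow2_index z)) * z)"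

definition verifies :: "bool list \<Rightarrow> bool list \<Rightarrow> bool" where
  "verifies x u \<longleftrightarrow> well_formed x \<and>
     line_graph_certificate (unary_prefix x) (adjacency_bit x) (incidence_bit (unary_prefix x) u) \<and>
     coloring_certificate (unary_prefix x) (adjacency_bit x)
       (deleted_bit (unary_prefix x) u) (color_bit (unary_prefix x) u) \<and>
     within_budget x (\<Sum>i<unary_prefix x. of_bool (deleted_bit (unary_prefix x) u i))"

lemma symbol_after_prefix: "symbol (replicate n True @ False # ys) (n + 1 + t) = symbol ys t"
  by (simp add: symbol_def nth_append)

lemma decode_bits:
  assumes x: "x = replicate n True @ False # ys @ w" and len: "length ys = n * n"
  shows "unary_prefix x = n" "\<And>i j. i < n \<Longrightarrow> j < n \<Longrightarrow> adjacency_bit x i j \<longleftrightarrow> ys ! (i * n + j)"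
    "\<And>j. budget_bit x j \<longleftrightarrow> symbol w j = 2" "budget_length x = length w"
proof -
  show n: "unary_prefix x = n" unfolding x by (rule unary_prefix_eq)
  show "adjacency_bit x i j \<longleftrightarrow> ys ! (i * n + j)" if "i < n" "j < n" for i j
  proof -
    have "i * n + j < n * n"
      using mixed_radix_less[OF that(2,1)] by (simp add: mult.commute add.commute)
    then show ?thesis
      unfolding adjacency_bit_def n unfolding x symbol_after_prefix symbol_eq_2 using len by (simp add: nth_append)
  qed
  show "budget_bit x j \<longleftrightarrow> symbol w j = 2" for j
    unfolding budget_bit_def n unfolding x symbol_after_prefix symbol_eq_2 using len by (simp add: nth_append)
  show "budget_length x = length w"
    unfolding budget_length_def n unfolding x using len by simp
qed

lemma within_budget_iff:
  assumes x: "x = replicate n True @ False # ys @ binary k" and len: "length ys = n * n" and "N \<le> n"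
  shows "within_budget x N \<longleftrightarrow> N \<le> k"
  unfolding within_budget_def decode_bits[OF x len] le_binary_value_iff[OF \<open>N \<le> n\<close>, of k] capped_value_def ..

lemma well_formedE:
  assumes "well_formed x"
  obtains n ys k where "x = replicate n True @ False # ys @ binary k" "length ys = n * n"
proof -
  define n where "n = length (takeWhile (\<lambda>b. b) x)"
  have tw: "takeWhile (\<lambda>b. b) x = replicate n True"
    unfolding n_def by (rule replicate_eqI[symmetric, THEN sym]) (auto dest: set_takeWhileD)
  then have x: "x = replicate n True @ dropWhile (\<lambda>b. b) x" by (metis takeWhile_dropWhile_id)
  show thesis
  proof (cases "dropWhile (\<lambda>b. b) x")
    case Nil
    have "x = replicate n True" using x unfolding Nil by simp
    then have "unary_prefix x = n" "length x = n" using unary_prefix_replicate by simp_all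
    then show thesis using assms by (simp add: well_formed_def)
  next
    case (Cons b zs)
    then have b: "\<not> b" using hd_dropWhile[of "\<lambda>b. b" x] by simp
    define ys w where "ys = take (n * n) zs" "w = drop (n * n) zs"
    have x': "x = replicate n True @ False # zs" using x b unfolding Cons by simp
    have "unary_prefix x = n" unfolding x' by (rule unary_prefix_eq)
    then have "n * n \<le> length zs" using assms x' by (simp add: well_formed_def)
    then have len: "length ys = n * n" by (simp add: ys_w_def)
    have xw: "x = replicate n True @ False # ys @ w" using x' by (simp add: ys_w_def)
    have "w = [] \<or> last w"
      using assms unfolding well_formed_def decode_bits(3,4)[OF xw len] symbol_eq_2
      by (cases "w = []") (auto simp: last_conv_nth)
    then have "binary (binary_value w) = w" by (rule binary_binary_value)
    then show thesis using that[of n ys "binary_value w"] xw len by simp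
  qed
qed

lemma verifies_sound:
  assumes "verifies x u"
  shows "x \<in> Odd_Cycle_Transversal \<inter> line_graph_instances"
proof -
  have wf: "well_formed x" using assms by (simp add: verifies_def)
  obtain n ys k where x: "x = replicate n True @ False # ys @ binary k" and len: "length ys = n * n"
    using well_formedE[OF wf] .
  note n = decode_bits(1)[OF x len] and adj = decode_bits(2)[OF x len]
  let ?inc = "incidence_bit n u" and ?del = "deleted_bit n u" and ?col = "color_bit n u"
  have inc2: "(\<Sum>c<2 * n. of_bool (?inc i c)) = (2::nat)" if "i < n" for i
    using assms that unfolding verifies_def n line_graph_certificate_def by blast
  have adj_iff: "adjacency_bit x i j \<longleftrightarrow> i \<noteq> j \<and> (\<exists>c<2 * n. ?inc i c \<and> ?inc j c)" if "i < n" "j < n" for i j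
    using assms that unfolding verifies_def n line_graph_certificate_def by blast
  have distinct: "\<exists>c<2 * n. ?inc i c \<noteq> ?inc j c" if "i < n" "j < n" "i \<noteq> j" for i j
    using assms that unfolding verifies_def n line_graph_certificate_def by blast
  have coloring: "?col i \<noteq> ?col j" if "i < n" "j < n" "adjacency_bit x i j" "\<not> ?del i" "\<not> ?del j" for i j
    using assms that unfolding verifies_def n coloring_certificate_def by blast
  define E where "E = {{i, j} | i j. i < n \<and> j < n \<and> adjacency_bit x i j}"
  have E_iff: "{i, j} \<in> E \<longleftrightarrow> i < n \<and> j < n \<and> adjacency_bit x i j" for i j
  proof -
    have sym: "adjacency_bit x i j = adjacency_bit x j i" if "i < n" "j < n" for i j
      using adj_iff[OF that] adj_iff[OF that(2,1)] by auto
    show ?thesis unfolding E_def using sym by (auto simp: doubleton_eq_iff)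
  qed
  have simple: "simple_graph ({..<n}, E)"
    using adj_iff by (auto simp: simple_graph_def E_def)
  have enc: "x = encode_instance n E k"
  proof -
    have "map (\<lambda>t. {t div n, t mod n} \<in> E) [0..<n * n] = ys"
    proof (rule nth_equalityI)
      fix t assume "t < length (map (\<lambda>t. {t div n, t mod n} \<in> E) [0..<n * n])"
      then have t: "t < n * n" by simp
      then have "0 < n" by (auto intro: gr0I)
      then have d: "t div n < n" "t mod n < n" using t by (simp_all add: div_less_iff_less_mult)
      have "t div n * n + t mod n = t" by simp
      then show "map (\<lambda>t. {t div n, t mod n} \<in> E) [0..<n * n] ! t = ys ! t"
        using t d adj[OF d] by (simp add: E_iff)
    qed (simp add: len)
    then show ?thesis unfolding encode_instance_eq x by simp
  qed
  have "is_line_graph ({..<n}, E)"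
  proof -
    \<comment> \<open>In the root graph, columns are the vertices and row \<open>i\<close> is the
      edge that corresponds to vertex \<open>i\<close> of the input.\<close>
    let ?r = "\<lambda>i. {c. c < 2 * n \<and> ?inc i c}"
    let ?H = "({..<2 * n}, ?r ` {..<n})"
    have "simple_graph ?H"
      using inc2 by (auto simp: simple_graph_def sum_of_bool_eq_card)
    moreover have "graph_isomorphic ({..<n}, E) (line_graph ?H)"
      unfolding graph_isomorphic_def
    proof (intro exI[of _ ?r] conjI ballI)
      have inj: "inj_on ?r {..<n}"
      proof (rule inj_onI, rule ccontr)
        fix i j assume ij: "i \<in> {..<n}" "j \<in> {..<n}" "?r i = ?r j" "i \<noteq> j"
        then obtain c where "c < 2 * n" "?inc i c \<noteq> ?inc j c" using distinct[of i j] by auto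
        then show False using ij(3) by blast
      qed
      then show "bij_betw ?r (verts ({..<n}, E)) (verts (line_graph ?H))"
        by (simp add: bij_betw_def line_graph_def)
      fix i j assume "i \<in> verts ({..<n}, E)" "j \<in> verts ({..<n}, E)"
      then have ij: "i < n" "j < n" by simp_all
      have "?r i \<noteq> ?r j \<longleftrightarrow> i \<noteq> j" using inj_on_eq_iff[OF inj, of i j] ij by simp
      moreover have "?r i \<inter> ?r j \<noteq> {} \<longleftrightarrow> (\<exists>c<2 * n. ?inc i c \<and> ?inc j c)" by blast
      ultimately show "{i, j} \<in> edges ({..<n}, E) \<longleftrightarrow> {?r i, ?r j} \<in> edges (line_graph ?H)"
        unfolding line_graph_edge_iff snd_conv E_iff using ij adj_iff[OF ij] by simp
    qed
    ultimately show ?thesis unfolding is_line_graph_def by blast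
  qed
  then have "x \<in> line_graph_instances" unfolding line_graph_instances_def using enc simple by blast
  moreover have "x \<in> Odd_Cycle_Transversal"
    unfolding enc encode_in_Odd_Cycle_Transversal[OF simple]
  proof (intro exI conjI)
    let ?S = "{i. i < n \<and> ?del i}"
    show "odd_cycle_transversal ({..<n}, E) ?S"
      unfolding odd_cycle_transversal_iff_coloring[OF simple]
      using coloring by (auto simp: E_iff intro!: exI[of _ ?col])
    have "within_budget x (card ?S)"
      using assms unfolding verifies_def n sum_of_bool_eq_card by blast
    moreover have "card ?S \<le> n" using card_mono[of "{..<n}" ?S] by auto
    ultimately show "card ?S \<le> k" using within_budget_iff[OF x len] by blast
  qed
  ultimately show ?thesis by blast
qed

text \<open>The polynomial consists of \<open>2 * n * n\<close> bits for the incidence matrix and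
  \<open>n\<close> bits each for the transversal and the coloring, with \<open>n\<close> estimated
  by the input length.\<close>

lemma verifies_complete:
  assumes "x \<in> Odd_Cycle_Transversal \<inter> line_graph_instances"
  shows "\<exists>u. length u \<le> poly [:0, 2, 2:] (length x) \<and> verifies x u"
proof -
  obtain n E k S where enc: "x = encode_instance n E k" and simple: "simple_graph ({..<n}, E)"
    and S: "odd_cycle_transversal ({..<n}, E) S" "card S \<le> k"
    using assms unfolding Odd_Cycle_Transversal_def by blast
  obtain n' E' k' where enc': "x = encode_instance n' E' k'" and simple': "simple_graph ({..<n'}, E')"
    and lg': "is_line_graph ({..<n'}, E')"
    using assms unfolding line_graph_instances_def by blast
  have "n' = n \<and> E' = E \<and> k' = k"
    by (rule encode_instance_inj[OF trans[OF enc[symmetric] enc'] simple simple'])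
  then have lg: "is_line_graph ({..<n}, E)" using lg' by blast
  let ?ys = "map (\<lambda>t. {t div n, t mod n} \<in> E) [0..<n * n]"
  have x: "x = replicate n True @ False # ?ys @ binary k" unfolding enc encode_instance_eq by simp
  have len: "length ?ys = n * n" by simp
  note n = decode_bits(1)[OF x len]
  have adj: "adjacency_bit x i j \<longleftrightarrow> {i, j} \<in> E" if "i < n" "j < n" for i j
  proof -
    have "i * n + j < n * n"
      using mixed_radix_less[OF that(2,1)] by (simp add: mult.commute add.commute)
    then show ?thesis using decode_bits(2)[OF x len that] that by simp
  qed
  obtain H :: "nat graph" and f where H: "simple_graph H" and f: "bij_betw f {..<n} (edges H)"
    and iso: "\<And>i j. i < n \<Longrightarrow> j < n \<Longrightarrow> {i, j} \<in> E \<longleftrightarrow> {f i, f j} \<in> edges (line_graph H)"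
    using lg unfolding is_line_graph_def graph_isomorphic_def by (auto simp: line_graph_def)
  have f_edge: "f i \<in> edges H" if "i < n" for i using f that by (auto simp: bij_betw_def)
  then have f2: "card (f i) = 2" if "i < n" for i using H that by (auto simp: simple_graph_def)
  let ?U = "\<Union>i<n. f i"
  have finf: "finite (f i)" if "i < n" for i using f2[OF that] by (intro card_ge_0_finite) simp
  \<comment> \<open>The root graph may have large vertex numbers and isolated vertices. Only the
    end-vertices of edges matter, and they are renamed by \<open>g\<close> to fit into the
    columns.\<close>
  have "card ?U \<le> (\<Sum>i<n. card (f i))" by (rule card_UN_le) simp
  also have "\<dots> = 2 * n" using f2 by simp
  finally obtain g where g: "g ` ?U \<subseteq> {..<2 * n}" "inj_on g ?U"
    using card_le_inj[of ?U "{..<2 * n}"] finf by auto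
  have g_inj: "inj_on g (f i \<union> f j)" if "i < n" "j < n" for i j
    by (rule inj_on_subset[OF g(2)]) (use that in auto)
  have g_less: "g c < 2 * n" if "c \<in> f i" "i < n" for c i using g(1) that by auto
  obtain col :: "nat \<Rightarrow> bool" where S_sub: "S \<subseteq> {..<n}"
    and col: "\<And>i j. {i, j} \<in> E \<Longrightarrow> i \<notin> S \<Longrightarrow> j \<notin> S \<Longrightarrow> col i \<noteq> col j"
    using S(1) unfolding odd_cycle_transversal_iff_coloring[OF simple] by auto
  define u where "u = map (\<lambda>t. if t < n * (2 * n) then t mod (2 * n) \<in> g ` f (t div (2 * n))
      else if t < n * (2 * n) + n then t - n * (2 * n) \<in> S else col (t - (n * (2 * n) + n))) [0..<n * (2 * n) + (n + n)]"
  have inc: "incidence_bit n u i c \<longleftrightarrow> c \<in> g ` f i" if "i < n" "c < 2 * n" for i c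
  proof -
    have "i * (2 * n) + c < n * (2 * n)"
      using mixed_radix_less[OF that(2,1)] by (simp add: mult.commute add.commute)
    then show ?thesis using that unfolding incidence_bit_def symbol_eq_2 by (simp add: u_def)
  qed
  have del: "deleted_bit n u i \<longleftrightarrow> i \<in> S" if "i < n" for i
    using that unfolding deleted_bit_def symbol_eq_2 by (simp add: u_def)
  have cbit: "color_bit n u i \<longleftrightarrow> col i" if "i < n" for i
    using that unfolding color_bit_def symbol_eq_2 by (simp add: u_def)
  have "verifies x u"
    unfolding verifies_def n
  proof (intro conjI)
    show "well_formed x"
      using last_binary[of k] unfolding well_formed_def decode_bits[OF x len] symbol_eq_2
      by (auto simp: x last_conv_nth)
    show "line_graph_certificate n (adjacency_bit x) (incidence_bit n u)"
      unfolding line_graph_certificate_def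
    proof (intro conjI allI impI)
      fix i assume i: "i < n"
      have "{c. c < 2 * n \<and> incidence_bit n u i c} = g ` f i"
        using inc[OF i] g_less[OF _ i] by auto
      moreover have "card (g ` f i) = card (f i)"
        by (rule card_image) (use g_inj[OF i i] in simp)
      ultimately show "(\<Sum>c<2 * n. of_bool (incidence_bit n u i c)) = (2::nat)"
        unfolding sum_of_bool_eq_card using f2[OF i] by simp
    next
      fix i j assume ij: "i < n" "j < n"
      have fij: "f i = f j \<longleftrightarrow> i = j" using f ij by (auto simp: bij_betw_def inj_on_def)
      have "adjacency_bit x i j \<longleftrightarrow> i \<noteq> j \<and> f i \<inter> f j \<noteq> {}"
        unfolding adj[OF ij] iso[OF ij] line_graph_edge_iff using f_edge ij fij by auto
      also have "f i \<inter> f j \<noteq> {} \<longleftrightarrow> (\<exists>c<2 * n. incidence_bit n u i c \<and> incidence_bit n u j c)"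
      proof
        assume "f i \<inter> f j \<noteq> {}"
        then obtain v where "v \<in> f i" "v \<in> f j" by blast
        then show "\<exists>c<2 * n. incidence_bit n u i c \<and> incidence_bit n u j c"
          using g_less ij inc by (intro exI[of _ "g v"]) auto
      next
        assume "\<exists>c<2 * n. incidence_bit n u i c \<and> incidence_bit n u j c"
        then obtain v v' where "v \<in> f i" "v' \<in> f j" "g v = g v'" using inc ij by auto
        moreover from this have "v = v'" using g_inj[OF ij] by (auto simp: inj_on_def)
        ultimately show "f i \<inter> f j \<noteq> {}" by blast
      qed
      finally show "adjacency_bit x i j \<longleftrightarrow> i \<noteq> j \<and> (\<exists>c<2 * n. incidence_bit n u i c \<and> incidence_bit n u j c)" .
      assume "i \<noteq> j"
      then have "g ` f i \<noteq> g ` f j"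
        using fij inj_on_image_eq_iff[OF g_inj[OF ij], of "f i" "f j"] by simp
      then obtain c where "(c \<in> g ` f i) \<noteq> (c \<in> g ` f j)" by blast
      moreover from this have "c < 2 * n" using g_less ij by auto
      ultimately show "\<exists>c<2 * n. \<not> (incidence_bit n u i c \<longleftrightarrow> incidence_bit n u j c)" using inc ij by blast
    qed
    show "coloring_certificate n (adjacency_bit x) (deleted_bit n u) (color_bit n u)"
      unfolding coloring_certificate_def using adj del cbit col by simp
    have "{i. i < n \<and> deleted_bit n u i} = S" using del S_sub by auto
    then have "(\<Sum>i<n. of_bool (deleted_bit n u i)) = card S" unfolding sum_of_bool_eq_card by simp
    moreover have "card S \<le> n" using card_mono[OF _ S_sub] by simp
    ultimately show "within_budget x (\<Sum>i<n. of_bool (deleted_bit n u i))"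
      using within_budget_iff[OF x len] S(2) by simp
  qed
  moreover have "length u \<le> poly [:0, 2, 2:] (length x)"
  proof -
    have "n \<le> length x" unfolding x by simp
    then have "n * (2 * n) + (n + n) \<le> length x * (2 * length x) + (length x + length x)"
      by (intro add_mono mult_mono) simp_all
    then show ?thesis by (simp add: u_def algebra_simps)
  qed
  ultimately show ?thesis by blast
qed

section \<open>Decidability of the verification relation\<close>

lemma computable_pow2_index:
  "computable W \<Gamma> F \<Longrightarrow> computable W \<Gamma> (\<lambda>c. pow2_index (F c))"
  unfolding pow2_index_def
  by (rule computable_sum computable_of_bool decidable_pow2 computable_fst | assumption)+

lemma computable_unary_prefix: "computable W \<Gamma> (\<lambda>c. unary_prefix (W c False))"
  unfolding unary_prefix_def
  by (rule computable_sum computable_length computable_of_bool decidable_all computable_Suc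
      decidable_eq computable_symbol computable_const computable_fst)+

lemma computable_budget_length: "computable W \<Gamma> (\<lambda>c. budget_length (W c False))"
  unfolding budget_length_def
  by (rule computable_sub computable_length computable_add computable_mult computable_const
      computable_unary_prefix)+

lemma decidable_budget_bit:
  "computable W \<Gamma> F \<Longrightarrow> decidable W \<Gamma> (\<lambda>c. budget_bit (W c False) (F c))"
  unfolding budget_bit_def
  by (rule decidable_eq computable_symbol computable_add computable_mult computable_unary_prefix
      computable_const | assumption)+

lemma decidable_adjacency_incidence:
  assumes "computable W \<Gamma> F" "computable W \<Gamma> G"
  shows "decidable W \<Gamma> (\<lambda>c. adjacency_bit (W c False) (F c) (G c))"
    "decidable W \<Gamma> (\<lambda>c. incidence_bit (unary_prefix (W c False)) (W c True) (F c) (G c))"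
  unfolding adjacency_bit_def incidence_bit_def
  by (rule decidable_eq computable_symbol computable_add computable_mult computable_unary_prefix
      computable_const assms)+

lemma decidable_deleted_color:
  assumes "computable W \<Gamma> F"
  shows "decidable W \<Gamma> (\<lambda>c. deleted_bit (unary_prefix (W c False)) (W c True) (F c))"
    "decidable W \<Gamma> (\<lambda>c. color_bit (unary_prefix (W c False)) (W c True) (F c))"
  unfolding deleted_bit_def color_bit_def
  by (rule decidable_eq computable_symbol computable_add computable_mult computable_unary_prefix
      computable_const assms)+

lemma decidable_verifies: "decidable W \<Gamma> (\<lambda>c. verifies (W c False) (W c True))"
proof -
  have 1: "decidable W \<Gamma> (\<lambda>c. well_formed (W c False))"
    unfolding well_formed_def
    by (rule decidable_conj decidable_le decidable_disj decidable_eq decidable_budget_bit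
        computable_add computable_mult computable_sub computable_length computable_budget_length
        computable_unary_prefix computable_const)+
  have 2: "decidable W \<Gamma> (\<lambda>c. line_graph_certificate (unary_prefix (W c False)) (adjacency_bit (W c False))
      (incidence_bit (unary_prefix (W c False)) (W c True)))"
    unfolding line_graph_certificate_def
    by (rule decidable_conj decidable_all decidable_ex decidable_iff decidable_not decidable_imp decidable_eq
        decidable_adjacency_incidence decidable_deleted_color computable_sum computable_of_bool computable_mult computable_const
        computable_unary_prefix computable_fst computable_weaken)+
  have 3: "decidable W \<Gamma> (\<lambda>c. coloring_certificate (unary_prefix (W c False)) (adjacency_bit (W c False))
      (deleted_bit (unary_prefix (W c False)) (W c True)) (color_bit (unary_prefix (W c False)) (W c True)))"
    unfolding coloring_certificate_def
    by (rule decidable_all decidable_iff decidable_not decidable_imp decidable_adjacency_incidence decidable_deleted_color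
        computable_unary_prefix computable_fst computable_weaken)+
  have 4: "decidable W \<Gamma> (\<lambda>c. within_budget (W c False)
      (\<Sum>i<unary_prefix (W c False). of_bool (deleted_bit (unary_prefix (W c False)) (W c True) i)))"
    unfolding within_budget_def
    by (rule decidable_disj decidable_less decidable_le decidable_conj decidable_pow2 decidable_budget_bit
        computable_pow2_index computable_budget_length computable_sum computable_of_bool computable_mult
        computable_add computable_unary_prefix computable_const decidable_adjacency_incidence decidable_deleted_color computable_fst)+
  show ?thesis unfolding verifies_def by (intro decidable_conj 1 2 3 4)
qed

lemma OCT_line_graphs_in_NP: "Odd_Cycle_Transversal \<inter> line_graph_instances \<in> NP"
proof (rule NP_I)
  have eq: "(\<lambda>c. verifies ((\<lambda>(x, u) b. if b then u else x) c False) ((\<lambda>(x, u) b. if b then u else x) c True)) =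
      (\<lambda>(x, u). verifies x u)"
    by (auto simp: fun_eq_iff)
  show "decidable (\<lambda>(x, u) b. if b then u else x) [] (\<lambda>(x, u). verifies x u)"
    using decidable_verifies[of "\<lambda>(x, u) b. if b then u else x" "[]"] unfolding eq .
  show "x \<in> Odd_Cycle_Transversal \<inter> line_graph_instances \<longleftrightarrow>
      (\<exists>u. length u \<le> poly [:0, 2, 2:] (length x) \<and> verifies x u)" for x
    using verifies_sound verifies_complete by blast
qed

theorem theorem1: "NP_complete_restricted Odd_Cycle_Transversal line_graph_instances"
  unfolding NP_complete_restricted_def using OCT_line_graphs_in_NP NP_hard by blast

end
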